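(* Let $n\ge1$. For $I\subseteq\{1,\ldots,n\}$ set $\xi_I=\sum_{i\in I}H_i$. If $\sum_{i\in I} i$ is even, then $\xi_I$ and $\xi_I+2H_j$, for each odd $j\in\{1,\ldots,n\}$, are symmetric canonical elements of $Spin(2n+1)$. Moreover, all the symmetric canonical elements of $Spin(2n+1)$ are obtained in this way.
   Context: General setting. Let $G$ be a compact connected Lie group with Lie algebra $\mathfrak g$, $\mathfrak t\subset\mathfrak g$ a maximal torus (maximal abelian subalgebra), $\alpha_1,\ldots,\alpha_n\in\sqrt{-1}\,\mathfrak t^*$ the positive simple roots for a chosen set of positive roots $\Delta^+$, and $H_1,\ldots,H_n\in\mathfrak t$ the dual basis: $\alpha_i(H_j)=\sqrt{-1}\,\delta_{ij}$. Put $\mathfrak I(G)=\{\xi\in\mathfrak t:\exp_G(2\pi\xi)=e\}$, $\mathfrak I'(G)=\{\xi\in\mathfrak I(G): \alpha(\xi)/\sqrt{-1}\ge 0 \text{ for all }\alpha\in\Delta^+\}$ and $\mathfrak I^2(G)=\{\xi\in\mathfrak t:\exp_G(\pi\xi)=e\}$. For $\xi\in\mathfrak I'(G)$ let $\mathfrak g^\xi_j$ ($j\in\mathbb Z$) be the $\sqrt{-1}\,j$-eigenspace of $\mathrm{ad}\,\xi$ on $\mathfrak g^{\mathbb C}$ and $\mathfrak p_i^\xi=\bigoplus_{j\le i}\mathfrak g_j^\xi$. Define $\xi\preceq\xi'$ iff $\mathfrak p^\xi_i\subseteq\mathfrak p^{\xi'}_i$ for all $i\ge 0$ (writing $\xi=\sum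 n_iH_i$, $\xi'=\sum n_i'H_i$, this is equivalent to $n_i'\le n_i$ for all $i$). Define a second partial order on $\mathfrak I'(G)$ by: $\xi\preceq_{\mathcal I}\xi'$ iff $\xi\preceq\xi'$ and $\xi-\xi'\in\mathfrak I^2(G)$. A symmetric canonical element of $G$ is a maximal element of $(\mathfrak I'(G),\preceq_{\mathcal I})$. The case $(B_n)$. $\mathfrak g=\mathfrak{so}(2n+1)$, with simply connected group $Spin(2n+1)$. With respect to a basis $e_1,\ldots,e_{2n+1}$ of $\mathbb C^{2n+1}$ with $Q(e_i,e_{n+i})=1$ $(1\le i\le n)$, $Q(e_{2n+1},e_{2n+1})=1$ and all other pairings zero, where $Q$ is the complex-bilinear extension of the standard inner product of $\mathbb R^{2n+1}$, and with $e_{n+i}=\overline{e_i}$ and $e_{2n+1}$ real, $E_i$ is the diagonal matrix with $E_ie_i=\sqrt{-1}e_i$, $E_ie_{n+i}=-\sqrt{-1}e_{n+i}$, and zero on the other basis vectors. $\mathfrak t=\{\sum a_iE_i: a_i\in\mathbb R\}$, and $L_1,\ldots,L_n\in\sqrt{-1}\,\mathfrak t^*$ are given by $L_i(E_j)=\sqrt{-1}\,\delta_{ij}$. The positive roots are $\Delta^+=\{L_i\pm L_j\}_{i<j}\cup\{L_i\}_i$, with simple roots $\alpha_i=L_i-L_{i+1}$ for $1\le i\le n-1$ and $\alpha_n=L_n$, so that $H_i=E_1+\ldots+E_i$. *)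

theory Defs
  imports Complex_Main "Jordan_Normal_Form.VS_Connect"
begin

section \<open>Canonical elements\<close>

abbreviation Mat :: "nat \<Rightarrow> (complex, complex mat) module" where
  "Mat m \<equiv> module_mat TYPE(complex) m m"

text \<open>The data of a compact Lie group that enter the notion of a canonical element: the
  complexified Lie algebra \<open>gC\<close> (a Lie algebra of \<open>m \<times> m\<close> matrices), a maximal torus \<open>tor\<close>, the
  positive roots \<open>pos\<close> (functionals on \<open>tor\<close>), the abstract group \<open>G\<close> and its exponential map
  \<open>ex\<close>. The matrices only realise the Lie algebra, so \<open>G\<close> need not be the matrix group.\<close>

locale lie_group_data =
  fixes m :: nat
    and gC :: "complex mat set"
    and tor :: "complex mat set"
    and pos :: "(complex mat \<Rightarrow> complex) set"
    and G :: "('g, 'b) monoid_scheme"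
    and ex :: "complex mat \<Rightarrow> 'g"
begin

definition integral :: "complex mat set" where
  "integral = {\<xi> \<in> tor. ex (complex_of_real (2 * pi) \<cdot>\<^sub>m \<xi>) = \<one>\<^bsub>G\<^esub>}"

text \<open>The order on complex numbers is that of \<open>HOL-Library.Complex_Order\<close>: \<open>0 \<le> z\<close> means that \<open>z\<close>
  is real and nonnegative.\<close>

definition dominant_integral :: "complex mat set" where
  "dominant_integral = {\<xi> \<in> integral. \<forall>\<alpha> \<in> pos. 0 \<le> \<alpha> \<xi> / \<i>}"

definition integral2 :: "complex mat set" where
  "integral2 = {\<xi> \<in> tor. ex (complex_of_real pi \<cdot>\<^sub>m \<xi>) = \<one>\<^bsub>G\<^esub>}"

definition ad_eigenspace :: "complex mat \<Rightarrow> int \<Rightarrow> complex mat set" where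
  "ad_eigenspace \<xi> j = {X \<in> gC. \<xi> * X - X * \<xi> = (\<i> * of_int j) \<cdot>\<^sub>m X}"

definition filtration :: "complex mat \<Rightarrow> int \<Rightarrow> complex mat set" where
  "filtration \<xi> i = {\<Oplus>\<^bsub>Mat m\<^esub> j \<in> J. X j | J X.
     finite J \<and> J \<subseteq> {..i} \<and> (\<forall>j \<in> J. X j \<in> ad_eigenspace \<xi> j)}"

definition can_le :: "complex mat \<Rightarrow> complex mat \<Rightarrow> bool" where
  "can_le \<xi> \<xi>' \<longleftrightarrow> (\<forall>i \<ge> 0. filtration \<xi> i \<subseteq> filtration \<xi>' i)"

definition sym_le :: "complex mat \<Rightarrow> complex mat \<Rightarrow> bool" where
  "sym_le \<xi> \<xi>' \<longleftrightarrow> can_le \<xi> \<xi>' \<and> \<xi> - \<xi>' \<in> integral2"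

definition symmetric_canonical :: "complex mat set" where
  "symmetric_canonical =
     {\<xi> \<in> dominant_integral. \<forall>\<xi>' \<in> dominant_integral. sym_le \<xi> \<xi>' \<longrightarrow> \<xi>' = \<xi>}"

end


section \<open>The group $Spin(m)$ and its exponential map\<close>

text \<open>An element of the real Clifford algebra of $\mathbb R^m$ is given by its coefficients with
  respect to the basis $\varepsilon_A = \varepsilon_{a_1} \cdots \varepsilon_{a_k}$, where
  $A = \{a_1 < \cdots < a_k\} \subseteq \{0,\ldots,m-1\}$ and the standard basis vectors satisfy
  $\varepsilon_a^2 = -1$, $\varepsilon_a \varepsilon_b = - \varepsilon_b \varepsilon_a$.\<close>

type_synonym clifford = "nat set \<Rightarrow> real"

text \<open>$\varepsilon_A \varepsilon_B = \pm \varepsilon_{A \triangle B}$: there is one sign change for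
  each transposition needed to sort the product (the pairs with $a > b$) and one for each square
  $\varepsilon_a^2 = -1$ (the pairs with $a = b$).\<close>

definition cl_sign :: "nat set \<Rightarrow> nat set \<Rightarrow> real" where
  "cl_sign A B = (- 1) ^ card {(a, b) \<in> A \<times> B. a \<ge> b}"

definition Cl :: "nat \<Rightarrow> clifford monoid" where
  "Cl m = \<lparr>carrier = {x. \<forall>A. x A \<noteq> 0 \<longrightarrow> A \<subseteq> {..<m}},
     mult = (\<lambda>x y C. \<Sum>(A, B) | A \<subseteq> {..<m} \<and> B \<subseteq> {..<m} \<and> sym_diff A B = C.
                       cl_sign A B * x A * y B),
     one = (\<lambda>A. if A = {} then 1 else 0)\<rparr>"

definition cl_vec :: "real vec \<Rightarrow> clifford" where
  "cl_vec v = (\<lambda>A. \<Sum>i < dim_vec v. if A = {i} then v $ i else 0)"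

definition Spin :: "nat \<Rightarrow> clifford monoid" where
  "Spin m = (Cl m)\<lparr>carrier := {foldr (\<lambda>v x. cl_vec v \<otimes>\<^bsub>Cl m\<^esub> x) vs \<one>\<^bsub>Cl m\<^esub> | vs.
     even (length vs) \<and> (\<forall>v \<in> set vs. v \<in> carrier_vec m \<and> v \<bullet> v = 1)}\<rparr>"

definition cl_exp :: "nat \<Rightarrow> clifford \<Rightarrow> clifford" where
  "cl_exp m x = (\<lambda>A. \<Sum>k. (x [^]\<^bsub>Cl m\<^esub> (k :: nat)) A / fact k)"

definition spin_lie :: "nat \<Rightarrow> clifford set" where
  "spin_lie m =
     {x \<in> carrier (Cl m). \<forall>s :: real. cl_exp m (\<lambda>A. s * x A) \<in> carrier (Spin m)}"

text \<open>The differential of the covering $Spin(m) \to SO(m)$, $g \mapsto (v \mapsto g v g^{-1})$, sends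
  \<open>x\<close> to $v \mapsto x v - v x$. It is an isomorphism of Lie algebras onto $\mathfrak{so}(m)$ for
  \<open>m \<ge> 2\<close>, by means of which the exponential map of $Spin(m)$ is defined on
  $\mathfrak{so}(m)$.\<close>

definition spin_diff :: "nat \<Rightarrow> clifford \<Rightarrow> complex mat" where
  "spin_diff m x = mat m m (\<lambda>(i, j). complex_of_real
     ((x \<otimes>\<^bsub>Cl m\<^esub> cl_vec (unit_vec m j)) {i} - (cl_vec (unit_vec m j) \<otimes>\<^bsub>Cl m\<^esub> x) {i}))"

definition spin_exp :: "nat \<Rightarrow> complex mat \<Rightarrow> clifford" where
  "spin_exp m \<xi> = cl_exp m (inv_into (spin_lie m) (spin_diff m) \<xi>)"


section \<open>The Lie algebra $\mathfrak{so}(2n+1)$\<close>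

definition soC :: "nat \<Rightarrow> complex mat set" where
  "soC m = {X \<in> carrier_mat m m. transpose_mat X = - X}"

text \<open>Here \<open>\<bullet>\<close> is the complex-bilinear form \<open>Q\<close>. The basis is indexed by \<open>1, \<dots>, 2n + 1\<close>.\<close>

locale adapted_basis =
  fixes n :: nat and e :: "nat \<Rightarrow> complex vec"
  assumes basis: "vectorspace.basis class_ring (module_vec TYPE(complex) (2 * n + 1)) (e ` {1..2 * n + 1})"
    and form: "\<And>i j. i \<in> {1..2 * n + 1} \<Longrightarrow> j \<in> {1..2 * n + 1} \<Longrightarrow>
      e i \<bullet> e j = (if i \<le> n \<and> j = n + i \<or> j \<le> n \<and> i = n + j \<or> i = 2 * n + 1 \<and> j = 2 * n + 1
                 then 1 else 0)"
    and conjugate_pair: "\<And>i. i \<in> {1..n} \<Longrightarrow> e (n + i) = map_vec cnj (e i)"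
    and real_vector: "map_vec cnj (e (2 * n + 1)) = e (2 * n + 1)"
begin

abbreviation M :: "(complex, complex mat) module" where
  "M \<equiv> Mat (2 * n + 1)"

definition E :: "nat \<Rightarrow> complex mat" where
  "E i = (THE A. A \<in> carrier M \<and> A *\<^sub>v e i = \<i> \<cdot>\<^sub>v e i \<and> A *\<^sub>v e (n + i) = (- \<i>) \<cdot>\<^sub>v e (n + i) \<and>
     (\<forall>k \<in> {1..2 * n + 1} - {i, n + i}. A *\<^sub>v e k = 0\<^sub>v (2 * n + 1)))"

definition torus_elem :: "(nat \<Rightarrow> real) \<Rightarrow> complex mat" where
  "torus_elem a = (\<Oplus>\<^bsub>M\<^esub> i \<in> {1..n}. complex_of_real (a i) \<cdot>\<^sub>m E i)"

definition torus :: "complex mat set" where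
  "torus = range torus_elem"

text \<open>The real-linear functional on the torus with $L_i(E_j) = \sqrt{-1}\,\delta_{ij}$.\<close>

definition L :: "nat \<Rightarrow> complex mat \<Rightarrow> complex" where
  "L i \<xi> = (THE z. \<exists>a. \<xi> = torus_elem a \<and> z = \<i> * complex_of_real (a i))"

definition positive_roots :: "(complex mat \<Rightarrow> complex) set" where
  "positive_roots =
     {\<lambda>\<xi>. L i \<xi> + L j \<xi> | i j. 1 \<le> i \<and> i < j \<and> j \<le> n} \<union>
     {\<lambda>\<xi>. L i \<xi> - L j \<xi> | i j. 1 \<le> i \<and> i < j \<and> j \<le> n} \<union>
     {L i | i. 1 \<le> i \<and> i \<le> n}"

definition simple_root :: "nat \<Rightarrow> complex mat \<Rightarrow> complex" where
  "simple_root i \<xi> = (if i < n then L i \<xi> - L (i + 1) \<xi> else L n \<xi>)"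

definition H :: "nat \<Rightarrow> complex mat" where
  "H j = (THE h. h \<in> torus \<and> (\<forall>i \<in> {1..n}. simple_root i h = (if i = j then \<i> else 0)))"

definition xi :: "nat set \<Rightarrow> complex mat" where
  "xi I = (\<Oplus>\<^bsub>M\<^esub> i \<in> I. H i)"

definition spin_symmetric_canonical :: "complex mat set" where
  "spin_symmetric_canonical =
     lie_group_data.symmetric_canonical (2 * n + 1) (soC (2 * n + 1)) torus positive_roots
       (Spin (2 * n + 1)) (spin_exp (2 * n + 1))"

end

end

theory Submission
  imports Defs "Jordan_Normal_Form.Determinant"
begin

text \<open>Write an element of the torus as \<open>\<xi> = \<Sum> a\<^sub>i E\<^sub>i = \<Sum> c\<^sub>i H\<^sub>i\<close>, so that
\<open>a\<^sub>k = c\<^sub>k + \<dots> + c\<^sub>n\<close>. Three computations turn the theorem into a statement about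
coefficients.

The lattice. Each \<open>E\<^sub>j\<close> is the infinitesimal rotation of a plane with orthonormal basis \<open>u\<^sub>j, v\<^sub>j\<close>,
and \<open>-\<onehalf> u\<^sub>j v\<^sub>j\<close> is its preimage in the Clifford algebra. The elements \<open>u\<^sub>j v\<^sub>j\<close> commute and
square to \<open>-1\<close>, so the exponential of \<open>2\<pi>\<xi>\<close> in the Spin group is the product of the
\<open>cos (\<pi> a\<^sub>j) - sin (\<pi> a\<^sub>j) u\<^sub>j v\<^sub>j\<close>. It is \<open>1\<close> exactly if all \<open>a\<^sub>j\<close> are integers with even sum
(\<open>spin_exp_so_elem_eq_one_iff\<close>), that is, if all \<open>c\<^sub>i\<close> are integers and \<open>\<Sum> i c\<^sub>i\<close> is even
(\<open>even_lattice_tail_iff\<close>). The exponential map is defined through an inverse of the differential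
of the covering on the set of all \<open>x\<close> whose one-parameter group stays in the Spin group; that this
inverse is the expected one needs injectivity on that set (\<open>spin_diff_inj\<close>). It is obtained by
differentiating the polynomial identities satisfied by the elements of the Spin group.

The order. With respect to the adapted basis, an element of the complexified Lie algebra is an
antisymmetric matrix, on whose entries \<open>ad \<xi>\<close> acts by sums of two weights. This describes the
filtration of \<open>\<xi>\<close> entrywise (\<open>filtration_iff\<close>). Since a sum of two weights has a constant sign on
the dominant chamber, \<open>\<xi> \<preceq> \<xi>'\<close> holds for dominant integral elements if and only if
\<open>c'\<^sub>i \<le> c\<^sub>i\<close> for all \<open>i\<close> (\<open>can_le_iff\<close>).

Maximality. Going up in the order therefore means to replace \<open>c\<close> by \<open>c - 2d\<close> where \<open>d\<close> has
natural number entries, \<open>2 d\<^sub>i \<le> c\<^sub>i\<close> and \<open>\<Sum> i d\<^sub>i\<close> is even (\<open>sym_le_iff\<close>). An element is maximal if only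
\<open>d = 0\<close> is possible. Taking \<open>d\<close> to be the indicator of an even \<open>i\<close>, twice the indicator of some
\<open>i\<close>, or the indicator of two odd indices shows that a maximal \<open>c\<close> has entries \<open>0\<close> and \<open>1\<close>,
except for at most one entry \<open>2\<close> or \<open>3\<close>, in an odd position (\<open>irreducible_coeffs_small\<close>).\<close>

section \<open>The Clifford algebra as a ring\<close>

lemma finite_sym_diff: "finite A \<Longrightarrow> finite B \<Longrightarrow> finite (sym_diff A B)"
  by auto

lemma card_sym_diff_parity:
  assumes "finite X" "finite Y"
  shows "even (card (sym_diff X Y)) \<longleftrightarrow> (even (card X) \<longleftrightarrow> even (card Y))"
proof -
  have "card X = card (X - Y) + card (X \<inter> Y)" "card Y = card (Y - X) + card (X \<inter> Y)"
    using assms by (metis Int_commute card_Int_Diff add.commute)+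
  moreover have "card (sym_diff X Y) = card (X - Y) + card (Y - X)"
    using assms by (intro card_Un_disjoint) auto
  ultimately show ?thesis by presburger
qed

lemma minus_one_power_card_sym_diff:
  assumes "finite X" "finite Y"
  shows "(- 1 :: real) ^ card (sym_diff X Y) = (- 1) ^ card X * (- 1) ^ card Y"
  using card_sym_diff_parity[OF assms]
  by (cases "even (card X)"; cases "even (card Y)") (simp_all add: uminus_power_if)

text \<open>The sign is a bicharacter of the group of finite sets under symmetric difference, because the
pairs counted in its exponent form the symmetric difference of the two sets of pairs. All identities
between signs below follow from this.\<close>

lemma cl_sign_sym_diff_left:
  assumes "finite A" "finite A'" "finite B"
  shows "cl_sign (sym_diff A A') B = cl_sign A B * cl_sign A' B"
proof -
  let ?P = "\<lambda>A. {(a, b) \<in> A \<times> B. a \<ge> b}"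
  have fin: "finite (?P A)" if "finite A" for A
    by (rule finite_subset[of _ "A \<times> B"]) (use that assms in auto)
  have "?P (sym_diff A A') = sym_diff (?P A) (?P A')" by auto
  with minus_one_power_card_sym_diff[OF fin fin, OF assms(1,2)] show ?thesis
    unfolding cl_sign_def by (simp only:)
qed

lemma cl_sign_sym_diff_right:
  assumes "finite A" "finite B" "finite B'"
  shows "cl_sign A (sym_diff B B') = cl_sign A B * cl_sign A B'"
proof -
  let ?P = "\<lambda>B. {(a, b) \<in> A \<times> B. a \<ge> b}"
  have fin: "finite (?P B)" if "finite B" for B
    by (rule finite_subset[of _ "A \<times> B"]) (use that assms in auto)
  have "?P (sym_diff B B') = sym_diff (?P B) (?P B')" by auto
  with minus_one_power_card_sym_diff[OF fin fin, OF assms(2,3)] show ?thesis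
    unfolding cl_sign_def by (simp only:)
qed

lemma cl_sign_empty [simp]: "cl_sign {} B = 1" "cl_sign A {} = 1"
  by (simp_all add: cl_sign_def)

lemma cl_sign_cases: "cl_sign A B = 1 \<or> cl_sign A B = -1"
  by (simp add: cl_sign_def uminus_power_if)

lemma cl_sign_square [simp]: "cl_sign A B * cl_sign A B = 1"
  using cl_sign_cases[of A B] by auto

lemma cl_sign_square' [simp]: "cl_sign A B * (cl_sign A B * z) = z"
  using cl_sign_cases[of A B] by auto

lemma abs_cl_sign [simp]: "\<bar>cl_sign A B\<bar> = 1"
  using cl_sign_cases[of A B] by auto

lemma sym_diff_cancel [simp]: "sym_diff A (sym_diff A B) = B"
  by auto

text \<open>The union of all \<open>Cl m\<close> is a type, on which ring operations and powers are available without
reference to a carrier; \<open>in_Cl m\<close> singles out the subalgebra generated by the first \<open>m\<close> basis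
vectors.\<close>

typedef clif = "\<Union>m. carrier (Cl m)"
  morphisms coef Clif
  by (auto simp: Cl_def intro!: exI[of _ "\<lambda>_. 0"])

setup_lifting type_definition_clif

lemma clif_eqI: "(\<And>A. coef x A = coef y A) \<Longrightarrow> x = y"
  by (metis coef_inject ext)

definition in_Cl :: "nat \<Rightarrow> clif \<Rightarrow> bool" where
  "in_Cl m x \<longleftrightarrow> coef x \<in> carrier (Cl m)"

lemma in_Cl_iff: "in_Cl m x \<longleftrightarrow> (\<forall>A. coef x A \<noteq> 0 \<longrightarrow> A \<subseteq> {..<m})"
  by (simp add: in_Cl_def Cl_def)

lemma in_Cl_exists: "\<exists>m. in_Cl m x"
  using coef[of x] by (auto simp: in_Cl_def)

lemma in_Cl_mono: "in_Cl m x \<Longrightarrow> m \<le> k \<Longrightarrow> in_Cl k x"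
  unfolding in_Cl_iff by (meson lessThan_subset_iff order_trans)

lemma in_Cl_exists2: "\<exists>m. in_Cl m x \<and> in_Cl m y"
proof -
  obtain j k where "in_Cl j x" "in_Cl k y" using in_Cl_exists by blast
  then have "in_Cl (max j k) x" "in_Cl (max j k) y" by (auto elim: in_Cl_mono)
  then show ?thesis by blast
qed

lemma in_Cl_exists3: "\<exists>m. in_Cl m x \<and> in_Cl m y \<and> in_Cl m z"
proof -
  obtain j k where "in_Cl j x" "in_Cl j y" "in_Cl k z" using in_Cl_exists in_Cl_exists2 by metis
  then have "in_Cl (max j k) x" "in_Cl (max j k) y" "in_Cl (max j k) z" by (auto elim: in_Cl_mono)
  then show ?thesis by blast
qed

lemma coef_Clif: "f \<in> carrier (Cl m) \<Longrightarrow> coef (Clif f) = f"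
  by (rule Clif_inverse) auto

lemma coef_eq_0: "in_Cl m x \<Longrightarrow> \<not> A \<subseteq> {..<m} \<Longrightarrow> coef x A = 0"
  by (auto simp: in_Cl_iff)

lemma coef_infinite: "infinite A \<Longrightarrow> coef x A = 0"
proof -
  assume "infinite A"
  obtain m where "in_Cl m x" using in_Cl_exists by blast
  moreover have "\<not> A \<subseteq> {..<m}" using \<open>infinite A\<close> finite_subset by blast
  ultimately show ?thesis by (rule coef_eq_0)
qed

instantiation clif :: real_vector
begin

lift_definition zero_clif :: clif is "\<lambda>_. 0" by (auto simp: Cl_def)

lift_definition plus_clif :: "clif \<Rightarrow> clif \<Rightarrow> clif" is "\<lambda>x y A. x A + y A"
proof -
  fix f g :: clifford assume *: "f \<in> (\<Union>m. carrier (Cl m))" "g \<in> (\<Union>m. carrier (Cl m))"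
  obtain j where "in_Cl j (Clif f)" "in_Cl j (Clif g)" using in_Cl_exists2 by blast
  with * have fg: "f \<in> carrier (Cl j)" "g \<in> carrier (Cl j)" by (simp_all add: in_Cl_def Clif_inverse)
  have "A \<subseteq> {..<j}" if "f A + g A \<noteq> 0" for A
    using that fg by (cases "f A = 0") (simp_all add: Cl_def)
  then have "(\<lambda>A. f A + g A) \<in> carrier (Cl j)" by (simp add: Cl_def)
  then show "(\<lambda>A. f A + g A) \<in> (\<Union>m. carrier (Cl m))" by auto
qed

lift_definition uminus_clif :: "clif \<Rightarrow> clif" is "\<lambda>x A. - x A" by (auto simp: Cl_def)

lift_definition scaleR_clif :: "real \<Rightarrow> clif \<Rightarrow> clif" is "\<lambda>r x A. r * x A"
  by (auto simp: Cl_def)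

definition minus_clif :: "clif \<Rightarrow> clif \<Rightarrow> clif" where "x - y = x + - y" for x :: clif

instance
  by standard (auto intro!: clif_eqI simp: minus_clif_def plus_clif.rep_eq uminus_clif.rep_eq
    zero_clif.rep_eq scaleR_clif.rep_eq algebra_simps)

end

lemma coef_diff: "coef (x - y) A = coef x A - coef y A"
  unfolding minus_clif_def plus_clif.rep_eq uminus_clif.rep_eq by simp

lemma coef_linear [simp]:
  "coef 0 A = 0" "coef (x + y) A = coef x A + coef y A" "coef (- x) A = - coef x A"
  "coef (x - y) A = coef x A - coef y A" "coef (r *\<^sub>R x) A = r * coef x A"
  by (simp_all add: coef_diff plus_clif.rep_eq uminus_clif.rep_eq zero_clif.rep_eq
    scaleR_clif.rep_eq)

lemma coef_sum: "coef (sum f S) A = (\<Sum>i\<in>S. coef (f i) A)"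
  by (induction S rule: infinite_finite_induct) auto

text \<open>The twisted convolution of \<open>Cl m\<close> with the second summation index eliminated. The sum runs over
the finite support of \<open>x\<close>, so that it is meaningful for all \<open>m\<close> at once.\<close>

definition cmul :: "clif \<Rightarrow> clif \<Rightarrow> clifford" where
  "cmul x y C = (\<Sum>A | coef x A \<noteq> 0. cl_sign A (sym_diff A C) * coef x A * coef y (sym_diff A C))"

lemma cmul_eq:
  assumes "in_Cl m x"
  shows "cmul x y C = (\<Sum>A\<in>Pow {..<m}. cl_sign A (sym_diff A C) * coef x A * coef y (sym_diff A C))"
  unfolding cmul_def
proof (rule sum.mono_neutral_left)
  show "{A. coef x A \<noteq> 0} \<subseteq> Pow {..<m}" using assms unfolding in_Cl_iff by blast
qed simp_all

lemma cmul_carrier: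
  assumes "in_Cl m x" "in_Cl m y"
  shows "cmul x y \<in> carrier (Cl m)"
proof -
  have "C \<subseteq> {..<m}" if "cmul x y C \<noteq> 0" for C
  proof -
    obtain A where "A \<in> Pow {..<m}"
      "cl_sign A (sym_diff A C) * coef x A * coef y (sym_diff A C) \<noteq> 0"
      using \<open>cmul x y C \<noteq> 0\<close> unfolding cmul_eq[OF assms(1)]
      by (rule sum.not_neutral_contains_not_neutral)
    then have "A \<subseteq> {..<m}" "coef y (sym_diff A C) \<noteq> 0" by simp_all
    moreover from this have "sym_diff A C \<subseteq> {..<m}" using assms(2) unfolding in_Cl_iff by blast
    ultimately show ?thesis by blast
  qed
  then show ?thesis by (simp add: Cl_def)
qed

instantiation clif :: ring_1
begin

definition one_clif :: clif where "1 = Clif (\<lambda>A. if A = {} then 1 else 0)"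

definition times_clif :: "clif \<Rightarrow> clif \<Rightarrow> clif" where "x * y = Clif (cmul x y)"

lemma coef_one: "coef 1 A = (if A = {} then 1 else 0)"
  unfolding one_clif_def by (subst coef_Clif[of _ 0]) (auto simp: Cl_def)

lemma coef_times_cmul: "coef (x * y) = cmul x y"
proof -
  obtain m where "in_Cl m x" "in_Cl m y" using in_Cl_exists2 by blast
  then show ?thesis unfolding times_clif_def by (intro coef_Clif cmul_carrier)
qed

lemma coef_times:
  assumes "in_Cl m x"
  shows "coef (x * y) C =
    (\<Sum>A\<in>Pow {..<m}. cl_sign A (sym_diff A C) * coef x A * coef y (sym_diff A C))"
  by (simp add: coef_times_cmul cmul_eq[OF assms])

lemma in_Cl_times: "in_Cl m x \<Longrightarrow> in_Cl m y \<Longrightarrow> in_Cl m (x * y)"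
  using cmul_carrier by (simp add: in_Cl_def coef_times_cmul)

text \<open>Since the sign is a bicharacter for \<open>\<triangle>\<close>, it is in particular a 2-cocycle; this is
  exactly associativity of the twisted convolution.\<close>

lemma clif_assoc: "(x * y) * z = x * (y * z)" for x y z :: clif
proof (rule clif_eqI)
  fix C
  obtain m where m: "in_Cl m x" "in_Cl m y" "in_Cl m z" using in_Cl_exists3 by blast
  let ?P = "Pow {..<m}"
  have fin: "finite A" if "A \<in> ?P" for A using that finite_subset by auto
  show "coef ((x * y) * z) C = coef (x * (y * z)) C"
  proof (cases "C \<subseteq> {..<m}")
    case False
    then show ?thesis using m by (simp add: coef_eq_0[of m] in_Cl_times)
  next
    case True
    have finC: "finite C" using True finite_subset by blast
    have "coef ((x * y) * z) C = (\<Sum>D\<in>?P. \<Sum>A\<in>?P.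
        cl_sign D (sym_diff D C) * (cl_sign A (sym_diff A D) * coef x A * coef y (sym_diff A D)) * coef z (sym_diff D C))"
      by (simp add: coef_times[OF in_Cl_times[OF m(1,2)]] coef_times[OF m(1)] sum_distrib_left sum_distrib_right)
    also have "\<dots> = (\<Sum>A\<in>?P. \<Sum>D\<in>?P.
        cl_sign D (sym_diff D C) * (cl_sign A (sym_diff A D) * coef x A * coef y (sym_diff A D)) * coef z (sym_diff D C))"
      by (rule sum.swap)
    also have "\<dots> = (\<Sum>A\<in>?P. \<Sum>B\<in>?P.
        cl_sign A (sym_diff A C) * coef x A * (cl_sign B (sym_diff B (sym_diff A C)) * coef y B * coef z (sym_diff B (sym_diff A C))))"
    proof (rule sum.cong[OF refl])
      fix A assume A: "A \<in> ?P"
      let ?f = "\<lambda>D. cl_sign D (sym_diff D C) * (cl_sign A (sym_diff A D) * coef x A * coef y (sym_diff A D)) * coef z (sym_diff D C)"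
      have "(\<Sum>D\<in>?P. ?f D) = (\<Sum>B\<in>?P. ?f (sym_diff A B))"
        by (rule sum.reindex_bij_witness[of _ "\<lambda>B. sym_diff A B" "\<lambda>B. sym_diff A B"]) (use A in auto)
      also have "\<dots> = (\<Sum>B\<in>?P.
        cl_sign A (sym_diff A C) * coef x A * (cl_sign B (sym_diff B (sym_diff A C)) * coef y B * coef z (sym_diff B (sym_diff A C))))"
      proof (rule sum.cong[OF refl])
        fix B assume B: "B \<in> ?P"
        have e: "sym_diff (sym_diff A B) C = sym_diff B (sym_diff A C)" by auto
        note f = fin[OF A] fin[OF B] finC
        have "cl_sign (sym_diff A B) (sym_diff B (sym_diff A C)) * cl_sign A B =
          cl_sign A (sym_diff A C) * cl_sign B (sym_diff B (sym_diff A C))"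
          using f
          by (simp add: cl_sign_sym_diff_left cl_sign_sym_diff_right finite_sym_diff mult.assoc mult.left_commute
             del: Diff_iff Un_iff)
        then show "?f (sym_diff A B) = cl_sign A (sym_diff A C) * coef x A * (cl_sign B (sym_diff B (sym_diff A C)) * coef y B * coef z (sym_diff B (sym_diff A C)))"
          unfolding e sym_diff_cancel by (simp add: algebra_simps)
      qed
      finally show "(\<Sum>D\<in>?P. ?f D) = (\<Sum>B\<in>?P.
        cl_sign A (sym_diff A C) * coef x A * (cl_sign B (sym_diff B (sym_diff A C)) * coef y B * coef z (sym_diff B (sym_diff A C))))" .
    qed
    also have "\<dots> = coef (x * (y * z)) C"
      by (simp add: coef_times[OF m(1)] coef_times[OF m(2)] sum_distrib_left)
    finally show ?thesis .
  qed
qed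

instance
proof
  fix x y z :: clif
  show "(x * y) * z = x * (y * z)" by (rule clif_assoc)
  have in0: "in_Cl 0 1" by (simp add: in_Cl_iff coef_one)
  show "1 * x = x"
    by (rule clif_eqI) (simp add: coef_times[OF in0] coef_one)
  obtain m where m: "in_Cl m x" "in_Cl m y" using in_Cl_exists2 by blast
  show "x * 1 = x"
  proof (rule clif_eqI)
    fix C
    have "coef (x * 1) C = (\<Sum>A\<in>Pow {..<m}. if A = C then coef x C else 0)"
      unfolding coef_times[OF m(1)]
    proof (rule sum.cong[OF refl])
      fix A
      show "cl_sign A (sym_diff A C) * coef x A * coef 1 (sym_diff A C) = (if A = C then coef x C else 0)"
        by (cases "A = C") (auto simp: coef_one)
    qed
    also have "\<dots> = coef x C"
      by (cases "C \<subseteq> {..<m}") (simp_all add: coef_eq_0[OF m(1)])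
    finally show "coef (x * 1) C = coef x C" .
  qed
  show "x * (y + z) = x * y + x * z"
    by (rule clif_eqI) (simp only: coef_times[OF m(1)] distrib_left distrib_right sum.distrib coef_linear)
  have "in_Cl m (x + y)" 
    unfolding in_Cl_iff
  proof (intro allI impI)
    fix A assume "coef (x + y) A \<noteq> 0"
    then show "A \<subseteq> {..<m}" using m by (cases "coef x A = 0") (simp_all add: in_Cl_iff)
  qed
  note xy = coef_times[OF this]
  show "(x + y) * z = x * z + y * z"
    by (rule clif_eqI) (simp only: coef_times[OF m(1)] coef_times[OF m(2)] xy distrib_left
      distrib_right sum.distrib coef_linear)
  show "(0::clif) \<noteq> 1"
  proof
    assume "(0::clif) = 1"
    then have "coef 0 {} = coef 1 {}" by simp
    then show False by (simp add: coef_one)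
  qed
qed

end

instance clif :: real_algebra_1
proof
  fix x y :: clif and r :: real
  obtain m where m: "in_Cl m x" "in_Cl m y" using in_Cl_exists2 by blast
  have "in_Cl m (r *\<^sub>R x)" using m by (auto simp: in_Cl_iff)
  note rx = coef_times[OF this]
  show "(r *\<^sub>R x) * y = r *\<^sub>R (x * y)"
    by (rule clif_eqI) (simp add: coef_times[OF m(1)] rx sum_distrib_left ac_simps)
  show "x * (r *\<^sub>R y) = r *\<^sub>R (x * y)"
    by (rule clif_eqI) (simp add: coef_times[OF m(1)] sum_distrib_left ac_simps)
qed

section \<open>Basis monomials, vectors and Clifford conjugation\<close>

lemma in_Cl_closed [intro]:
  "in_Cl m 0" "in_Cl m 1" "in_Cl m x \<Longrightarrow> in_Cl m y \<Longrightarrow> in_Cl m (x + y)"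
  "in_Cl m x \<Longrightarrow> in_Cl m (- x)" "in_Cl m x \<Longrightarrow> in_Cl m y \<Longrightarrow> in_Cl m (x - y)"
  "in_Cl m x \<Longrightarrow> in_Cl m (r *\<^sub>R x)" "in_Cl m x \<Longrightarrow> in_Cl m y \<Longrightarrow> in_Cl m (x * y)"
proof -
  show "in_Cl m x \<Longrightarrow> in_Cl m y \<Longrightarrow> in_Cl m (x + y)" for x y
    unfolding in_Cl_iff by (metis add.right_neutral coef_linear(2))
  show "in_Cl m x \<Longrightarrow> in_Cl m y \<Longrightarrow> in_Cl m (x - y)" for x y
    unfolding in_Cl_iff by (metis diff_zero coef_linear(4))
  show "in_Cl m x \<Longrightarrow> in_Cl m y \<Longrightarrow> in_Cl m (x * y)" for x y
    by (rule in_Cl_times)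
qed (auto simp: in_Cl_iff coef_one)

lemma in_Cl_power: "in_Cl m x \<Longrightarrow> in_Cl m (x ^ k)"
  by (induction k) auto

lemma in_Cl_sum: "(\<And>i. i \<in> S \<Longrightarrow> in_Cl m (f i)) \<Longrightarrow> in_Cl m (sum f S)"
  by (induction S rule: infinite_finite_induct) auto

lemma in_Cl_prod_list: "(\<And>x. x \<in> set xs \<Longrightarrow> in_Cl m x) \<Longrightarrow> in_Cl m (prod_list xs)"
  by (induction xs) auto

text \<open>This is Clifford conjugation, the anti-automorphism that changes the sign of every vector: on a
monomial of degree \<open>k\<close>, the sign \<open>cl_sign A A\<close> is \<open>(-1)\<^bsup>k(k+1)/2\<^esup>\<close>. With this form of the
sign, the proof of multiplicativity is again the bicharacter property.\<close>

lift_definition cconj :: "clif \<Rightarrow> clif" is "\<lambda>x A. cl_sign A A * x A"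
  by (auto simp: Cl_def)

lemma coef_cconj: "coef (cconj x) A = cl_sign A A * coef x A"
  by (simp add: cconj.rep_eq)

lemma in_Cl_cconj: "in_Cl m x \<Longrightarrow> in_Cl m (cconj x)"
  by (auto simp: in_Cl_iff coef_cconj)

lemma cconj_times: "cconj (x * y) = cconj y * cconj x"
proof (rule clif_eqI)
  fix C
  obtain m where m: "in_Cl m x" "in_Cl m y" using in_Cl_exists2 by blast
  show "coef (cconj (x * y)) C = coef (cconj y * cconj x) C"
  proof (cases "C \<subseteq> {..<m}")
    case False
    then show ?thesis using m
      by (simp add: coef_eq_0[of m] in_Cl_times in_Cl_cconj coef_cconj)
  next
    case True
    let ?P = "Pow {..<m}"
    have "coef (cconj y * cconj x) C = (\<Sum>B\<in>?P. cl_sign B (sym_diff B C) *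
        (cl_sign B B * coef y B) * (cl_sign (sym_diff B C) (sym_diff B C) * coef x (sym_diff B C)))"
      by (simp add: coef_times[OF in_Cl_cconj[OF m(2)]] coef_cconj)
    also have "\<dots> = (\<Sum>A\<in>?P. cl_sign C C * (cl_sign A (sym_diff A C) * coef x A * coef y (sym_diff A C)))"
    proof (rule sum.reindex_bij_witness[of _ "\<lambda>A. sym_diff A C" "\<lambda>A. sym_diff A C"])
      fix B assume B: "B \<in> ?P"
      have fin: "finite B" "finite C" using B True finite_subset by auto
      have e: "sym_diff (sym_diff B C) C = B" by auto
      have "cl_sign C C * cl_sign (sym_diff B C) B =
        cl_sign B (sym_diff B C) * cl_sign B B * cl_sign (sym_diff B C) (sym_diff B C)"
        using fin by (simp add: cl_sign_sym_diff_left cl_sign_sym_diff_right finite_sym_diff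
            mult.assoc mult.left_commute)
      then show "cl_sign C C * (cl_sign (sym_diff B C) (sym_diff (sym_diff B C) C) *
          coef x (sym_diff B C) * coef y (sym_diff (sym_diff B C) C)) =
        cl_sign B (sym_diff B C) * (cl_sign B B * coef y B) *
          (cl_sign (sym_diff B C) (sym_diff B C) * coef x (sym_diff B C))"
        unfolding e by (simp add: algebra_simps)
    qed (use True in auto)
    also have "\<dots> = coef (cconj (x * y)) C"
      by (simp add: coef_cconj coef_times[OF m(1)] sum_distrib_left)
    finally show ?thesis by simp
  qed
qed

lemma cconj_one [simp]: "cconj 1 = 1"
  by (rule clif_eqI) (simp add: coef_cconj coef_one)

text \<open>For an infinite set the value is \<open>0\<close>, as its indicator belongs to no \<open>Cl m\<close>.\<close>

definition bas :: "nat set \<Rightarrow> clif" where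
  "bas A = Clif (\<lambda>B. if finite A \<and> B = A then 1 else 0)"

lemma coef_bas: "finite A \<Longrightarrow> coef (bas A) B = (if B = A then 1 else 0)"
proof -
  assume "finite A"
  then obtain k where "A \<subseteq> {..<k}" using finite_nat_iff_bounded by blast
  then show ?thesis
    unfolding bas_def by (subst coef_Clif[of _ k]) (use \<open>finite A\<close> in \<open>auto simp: Cl_def\<close>)
qed

lemma in_Cl_bas: "A \<subseteq> {..<m} \<Longrightarrow> in_Cl m (bas A)"
  using finite_subset[of A "{..<m}"] by (auto simp: in_Cl_iff coef_bas split: if_splits)

lemma clif_expand:
  assumes "in_Cl m x"
  shows "x = (\<Sum>A\<in>Pow {..<m}. coef x A *\<^sub>R bas A)"
proof (rule clif_eqI)
  fix B
  have "(\<Sum>A\<in>Pow {..<m}. coef x A * coef (bas A) B) = (\<Sum>A\<in>Pow {..<m}. if B = A then coef x A else 0)"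
  proof (rule sum.cong[OF refl])
    fix A assume "A \<in> Pow {..<m}"
    then have "finite A" using finite_subset by auto
    then show "coef x A * coef (bas A) B = (if B = A then coef x A else 0)" by (simp add: coef_bas)
  qed
  also have "\<dots> = coef x B"
    by (cases "B \<subseteq> {..<m}") (simp_all add: coef_eq_0[OF assms])
  finally show "coef x B = coef (\<Sum>A\<in>Pow {..<m}. coef x A *\<^sub>R bas A) B" by (simp add: coef_sum)
qed

lemma coef_bas_times:
  assumes "finite A"
  shows "coef (bas A * x) C = cl_sign A (sym_diff A C) * coef x (sym_diff A C)"
proof -
  obtain k where k: "A \<subseteq> {..<k}" using assms finite_nat_iff_bounded by blast
  have "coef (bas A * x) C = (\<Sum>B\<in>Pow {..<k}. if A = B then cl_sign A (sym_diff A C) * coef x (sym_diff A C) else 0)"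
    unfolding coef_times[OF in_Cl_bas[OF k]] by (rule sum.cong) (simp_all add: coef_bas assms)
  then show ?thesis using k by simp
qed

lemma coef_times_bas:
  assumes "finite A"
  shows "coef (x * bas A) C = cl_sign (sym_diff A C) A * coef x (sym_diff A C)"
proof -
  obtain m where x: "in_Cl m x" using in_Cl_exists by blast
  have "coef (x * bas A) C = (\<Sum>B\<in>Pow {..<m}. if sym_diff A C = B then cl_sign (sym_diff A C) A * coef x (sym_diff A C) else 0)"
    unfolding coef_times[OF x]
  proof (rule sum.cong[OF refl])
    fix B
    have "sym_diff B C = A \<longleftrightarrow> sym_diff A C = B" by auto
    then show "cl_sign B (sym_diff B C) * coef x B * coef (bas A) (sym_diff B C) =
      (if sym_diff A C = B then cl_sign (sym_diff A C) A * coef x (sym_diff A C) else 0)"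
      by (auto simp: coef_bas assms)
  qed
  also have "\<dots> = cl_sign (sym_diff A C) A * coef x (sym_diff A C)"
  proof (cases "sym_diff A C \<subseteq> {..<m}")
    case True
    then show ?thesis unfolding sum.delta'[OF finite_Pow_iff[THEN iffD2, OF finite_lessThan]] by simp
  next
    case False
    then show ?thesis
      unfolding sum.delta'[OF finite_Pow_iff[THEN iffD2, OF finite_lessThan]] coef_eq_0[OF x False] by simp
  qed
  finally show ?thesis .
qed

lemma cl_sign_singletons: "cl_sign {i} {j} = (if i \<ge> j then - 1 else 1)"
proof -
  have "{(a, b) \<in> {i} \<times> {j}. a \<ge> b} = (if i \<ge> j then {(i, j)} else {})" by auto
  then show ?thesis by (simp add: cl_sign_def)
qed

lemma bas_anticommute: "bas {i} * bas {j} + bas {j} * bas {i} = (if i = j then - 2 else 0) *\<^sub>R 1"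
proof (rule clif_eqI)
  fix C
  have eq: "sym_diff {i} C = {j} \<longleftrightarrow> C = sym_diff {i} {j}" "sym_diff {j} C = {i} \<longleftrightarrow> C = sym_diff {i} {j}"
    by auto
  have "cl_sign {i} (sym_diff {i} C) * coef (bas {j}) (sym_diff {i} C) +
      cl_sign {j} (sym_diff {j} C) * coef (bas {i}) (sym_diff {j} C) =
    (if i = j then - 2 else 0) * coef 1 C"
  proof (cases "i = j")
    case False
    then have "sym_diff {i} {j} = {i, j}" "sym_diff {j} {i, j} = {i}" "sym_diff {i} {i, j} = {j}" by auto
    then show ?thesis using False
      by (cases "C = {i, j}") (simp_all only: coef_bas eq cl_sign_singletons finite.intros, simp_all)
  next
    case True
    moreover have "sym_diff {j} {} = {j}" by auto
    moreover have "C = {}" if "sym_diff {j} C = {j}" using that by blast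
    ultimately show ?thesis
      by (cases "C = {}") (auto simp: coef_bas cl_sign_singletons coef_one)
  qed
  then show "coef (bas {i} * bas {j} + bas {j} * bas {i}) C = coef ((if i = j then - 2 else 0) *\<^sub>R 1) C"
    by (simp only: coef_linear coef_bas_times[OF finite.insertI[OF finite.emptyI]])
qed

definition vect :: "real vec \<Rightarrow> clif" where "vect v = (\<Sum>i<dim_vec v. v $ i *\<^sub>R bas {i})"

lemma coef_vect: "coef (vect v) = cl_vec v"
  by (rule ext) (auto simp: vect_def cl_vec_def coef_sum coef_bas intro!: sum.cong)

lemma in_Cl_vect: "v \<in> carrier_vec m \<Longrightarrow> in_Cl m (vect v)"
  unfolding vect_def by (intro in_Cl_sum in_Cl_closed in_Cl_bas) auto

lemma coef_vect_nonsingleton: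
  assumes "v \<in> carrier_vec m" "\<nexists>i. i < m \<and> A = {i}"
  shows "coef (vect v) A = 0"
  using assms by (auto simp: coef_vect cl_vec_def intro!: sum.neutral)

lemma vect_add: "v \<in> carrier_vec m \<Longrightarrow> w \<in> carrier_vec m \<Longrightarrow> vect (v + w) = vect v + vect w"
  unfolding vect_def by (simp add: sum.distrib scaleR_add_left)

lemma vect_smult: "vect (r \<cdot>\<^sub>v v) = r *\<^sub>R vect v"
  by (simp add: vect_def scaleR_right.sum)

lemma vect_uminus: "vect (- v) = - vect v"
  by (simp add: vect_def sum_negf[symmetric])

lemma vect_unit: "j < m \<Longrightarrow> vect (unit_vec m j) = bas {j}"
proof -
  assume "j < m"
  have "vect (unit_vec m j) = (\<Sum>i<m. if i = j then bas {j} else 0)"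
    unfolding vect_def by (rule sum.cong) (auto simp: unit_vec_def)
  then show ?thesis using \<open>j < m\<close> by simp
qed

lemma vect_anticommute:
  assumes "v \<in> carrier_vec m" "w \<in> carrier_vec m"
  shows "vect v * vect w + vect w * vect v = (- 2 * (v \<bullet> w)) *\<^sub>R 1"
proof -
  have v: "vect v = (\<Sum>i<m. v $ i *\<^sub>R bas {i})" and w: "vect w = (\<Sum>j<m. w $ j *\<^sub>R bas {j})"
    using assms by (auto simp: vect_def)
  have "vect v * vect w = (\<Sum>i<m. \<Sum>j<m. (v $ i * w $ j) *\<^sub>R (bas {i} * bas {j}))"
    by (simp add: v w sum_product mult.commute)
  moreover have "vect w * vect v = (\<Sum>i<m. \<Sum>j<m. (v $ i * w $ j) *\<^sub>R (bas {j} * bas {i}))"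
    unfolding v w sum_product by (subst sum.swap) (intro sum.cong refl, simp add: mult.commute)
  ultimately have "vect v * vect w + vect w * vect v =
      (\<Sum>i<m. \<Sum>j<m. (v $ i * w $ j) *\<^sub>R (bas {i} * bas {j} + bas {j} * bas {i}))"
    by (simp add: sum.distrib scaleR_add_right)
  also have "\<dots> = (\<Sum>i<m. \<Sum>j<m. if i = j then (- 2 * (v $ i * w $ i)) *\<^sub>R 1 else 0)"
    unfolding bas_anticommute by (intro sum.cong refl) auto
  also have "\<dots> = (\<Sum>i<m. (- 2 * (v $ i * w $ i)) *\<^sub>R 1)"
    by simp
  also have "\<dots> = (- 2 * (v \<bullet> w)) *\<^sub>R 1"
    using assms
    by (simp only: scalar_prod_def sum_distrib_left scaleR_left.sum lessThan_atLeast0 carrier_vecD)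
  finally show ?thesis .
qed

lemma vect_square:
  assumes "v \<in> carrier_vec m"
  shows "vect v * vect v = (- (v \<bullet> v)) *\<^sub>R 1"
proof -
  have "2 *\<^sub>R (vect v * vect v) = 2 *\<^sub>R ((- (v \<bullet> v)) *\<^sub>R 1)"
    using vect_anticommute[OF assms assms] by (simp add: scaleR_2)
  then show ?thesis by (simp only: scaleR_cancel_left) simp
qed

lemma cconj_vect: "cconj (vect v) = - vect v"
proof (rule clif_eqI)
  fix A
  show "coef (cconj (vect v)) A = coef (- vect v) A"
  proof (cases "\<exists>i. A = {i}")
    case True
    then show ?thesis by (auto simp: coef_cconj cl_sign_singletons)
  next
    case False
    then have "coef (vect v) A = 0" by (intro coef_vect_nonsingleton[of v "dim_vec v"]) auto
    then show ?thesis by (simp add: coef_cconj)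
  qed
qed

section \<open>The exponential series in the Clifford algebra\<close>

text \<open>A submultiplicative norm, which bounds the coefficients of powers and makes the exponential
series converge coefficientwise.\<close>

definition l1 :: "nat \<Rightarrow> clif \<Rightarrow> real" where
  "l1 m x = (\<Sum>A\<in>Pow {..<m}. \<bar>coef x A\<bar>)"

lemma l1_one: "l1 m 1 = 1"
  by (simp add: l1_def coef_one if_distrib cong: if_cong)

lemma l1_times:
  assumes x: "in_Cl m x"
  shows "l1 m (x * y) \<le> l1 m x * l1 m y"
proof -
  let ?P = "Pow {..<m}"
  have "l1 m (x * y) \<le> (\<Sum>C\<in>?P. \<Sum>A\<in>?P. \<bar>coef x A\<bar> * \<bar>coef y (sym_diff A C)\<bar>)"
    unfolding l1_def
  proof (rule sum_mono)
    fix C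
    show "\<bar>coef (x * y) C\<bar> \<le> (\<Sum>A\<in>?P. \<bar>coef x A\<bar> * \<bar>coef y (sym_diff A C)\<bar>)"
      unfolding coef_times[OF x] by (rule order_trans[OF sum_abs]) (simp add: abs_mult)
  qed
  also have "\<dots> = (\<Sum>A\<in>?P. \<Sum>C\<in>?P. \<bar>coef x A\<bar> * \<bar>coef y (sym_diff A C)\<bar>)"
    by (rule sum.swap)
  also have "\<dots> = (\<Sum>A\<in>?P. \<Sum>B\<in>?P. \<bar>coef x A\<bar> * \<bar>coef y B\<bar>)"
  proof (rule sum.cong[OF refl])
    fix A assume A: "A \<in> ?P"
    show "(\<Sum>C\<in>?P. \<bar>coef x A\<bar> * \<bar>coef y (sym_diff A C)\<bar>) = (\<Sum>B\<in>?P. \<bar>coef x A\<bar> * \<bar>coef y B\<bar>)"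
      by (rule sum.reindex_bij_witness[of _ "\<lambda>B. sym_diff A B" "\<lambda>B. sym_diff A B"]) (use A in auto)
  qed
  also have "\<dots> = l1 m x * l1 m y"
    by (simp add: l1_def sum_product)
  finally show ?thesis .
qed

lemma l1_nonneg: "0 \<le> l1 m x"
  by (simp add: l1_def sum_nonneg)

lemma abs_coef_power:
  assumes x: "in_Cl m x"
  shows "\<bar>coef (x ^ k) A\<bar> \<le> l1 m x ^ k"
proof (cases "A \<subseteq> {..<m}")
  case False
  then show ?thesis by (simp add: coef_eq_0[OF in_Cl_power[OF x]] l1_nonneg)
next
  case True
  have "\<bar>coef (x ^ k) A\<bar> \<le> l1 m (x ^ k)"
    unfolding l1_def using True by (intro member_le_sum) auto
  also have "\<dots> \<le> l1 m x ^ k"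
  proof (induction k)
    case (Suc k)
    have "l1 m (x ^ Suc k) \<le> l1 m x * l1 m (x ^ k)" using l1_times[OF x] by simp
    also have "\<dots> \<le> l1 m x * l1 m x ^ k" using Suc l1_nonneg by (intro mult_left_mono)
    finally show ?case by simp
  qed (simp add: l1_one)
  finally show ?thesis .
qed

lemma summable_coef_exp: "summable (\<lambda>k. \<bar>coef (x ^ k) A / fact k\<bar>)"
proof -
  obtain m where x: "in_Cl m x" using in_Cl_exists by blast
  show ?thesis
  proof (rule summable_comparison_test[OF _ summable_exp])
    show "\<exists>N. \<forall>k\<ge>N. norm \<bar>coef (x ^ k) A / fact k\<bar> \<le> inverse (fact k) * l1 m x ^ k"
      using abs_coef_power[OF x] by (auto simp: field_simps)
  qed
qed

lift_definition clif_exp :: "clif \<Rightarrow> clif" is "\<lambda>x A. \<Sum>k. coef (Clif x ^ k) A / fact k"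
proof -
  fix x :: clifford assume "x \<in> (\<Union>m. carrier (Cl m))"
  then obtain m where "x \<in> carrier (Cl m)" by blast
  then have "in_Cl m (Clif x)" by (simp add: in_Cl_def coef_Clif)
  have "A \<subseteq> {..<m}" if "(\<Sum>k. coef (Clif x ^ k) A / fact k) \<noteq> 0" for A
  proof (rule ccontr)
    assume "\<not> A \<subseteq> {..<m}"
    then have "(\<Sum>k. coef (Clif x ^ k) A / fact k) = 0"
      by (simp add: coef_eq_0[OF in_Cl_power[OF \<open>in_Cl m (Clif x)\<close>]])
    with that show False by simp
  qed
  then show "(\<lambda>A. \<Sum>k. coef (Clif x ^ k) A / fact k) \<in> (\<Union>m. carrier (Cl m))"
    by (auto simp: Cl_def)
qed

lemma coef_exp: "coef (clif_exp x) A = (\<Sum>k. coef (x ^ k) A / fact k)"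
  by (simp add: clif_exp.rep_eq coef_inverse)

lemma coef_exp_sums: "(\<lambda>k. coef (x ^ k) A / fact k) sums coef (clif_exp x) A"
  unfolding coef_exp
proof (rule summable_sums)
  have "summable (\<lambda>k. norm (coef (x ^ k) A / fact k))" using summable_coef_exp by simp
  then show "summable (\<lambda>k. coef (x ^ k) A / fact k)" by (rule summable_norm_cancel)
qed

lemma in_Cl_exp: "in_Cl m x \<Longrightarrow> in_Cl m (clif_exp x)"
  unfolding in_Cl_iff[of m "clif_exp x"] coef_exp
proof (intro allI impI, rule ccontr)
  fix A
  assume "in_Cl m x" "(\<Sum>k. coef (x ^ k) A / fact k) \<noteq> 0" "\<not> A \<subseteq> {..<m}"
  then show False by (simp add: coef_eq_0[OF in_Cl_power])
qed

lemma power_scaleR_right: "(r *\<^sub>R x) ^ n = r ^ n *\<^sub>R x ^ n" for x :: "'a :: real_algebra_1"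
  by (induction n) (simp_all add: mult.commute)

text \<open>The binomial theorem for commuting elements, normalised so that it is the coefficient identity
behind the Cauchy product of two exponential series.\<close>

lemma divided_power_add:
  fixes x y :: "'a :: real_algebra_1"
  assumes comm: "x * y = y * x"
  shows "(1 / fact n) *\<^sub>R (x + y) ^ n =
    (\<Sum>i\<le>n. ((1 / fact i) *\<^sub>R x ^ i) * ((1 / fact (n - i)) *\<^sub>R y ^ (n - i)))"
proof -
  have "(x + y) ^ n = (\<Sum>i\<le>n. real (n choose i) *\<^sub>R (x ^ i * y ^ (n - i)))"
  proof (induction n)
    case (Suc n)
    have yx: "y * (x ^ i * y ^ (n - i)) = x ^ i * y ^ (Suc n - i)" if "i \<le> n" for i
    proof -
      have "y * (x ^ i * y ^ (n - i)) = x ^ i * y * y ^ (n - i)"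
        using power_commuting_commutes[OF comm] by (simp add: mult.assoc[symmetric])
      then show ?thesis using that by (simp add: Suc_diff_le mult.assoc)
    qed
    have "(x + y) ^ Suc n = (\<Sum>i\<le>n. real (n choose i) *\<^sub>R (x * (x ^ i * y ^ (n - i)))) +
        (\<Sum>i\<le>n. real (n choose i) *\<^sub>R (y * (x ^ i * y ^ (n - i))))"
      by (simp only: power_Suc Suc.IH distrib_right sum_distrib_left mult_scaleR_right
          scaleR_add_right sum.distrib)
    also have "(\<Sum>i\<le>n. real (n choose i) *\<^sub>R (y * (x ^ i * y ^ (n - i)))) =
        (\<Sum>i\<le>Suc n. real (n choose i) *\<^sub>R (x ^ i * y ^ (Suc n - i)))"
      by (simp add: yx)
    also have "(\<Sum>i\<le>n. real (n choose i) *\<^sub>R (x * (x ^ i * y ^ (n - i)))) + \<dots> =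
        (\<Sum>i\<le>Suc n. real (Suc n choose i) *\<^sub>R (x ^ i * y ^ (Suc n - i)))"
      by (simp only: sum.atMost_Suc_shift) (simp add: sum.distrib scaleR_add_left mult.assoc)
    finally show ?case .
  qed simp
  then have "(1 / fact n) *\<^sub>R (x + y) ^ n =
      (\<Sum>i\<le>n. (real (n choose i) / fact n) *\<^sub>R (x ^ i * y ^ (n - i)))"
    by (simp add: scaleR_right.sum)
  also have "\<dots> = (\<Sum>i\<le>n. ((1 / fact i) *\<^sub>R x ^ i) * ((1 / fact (n - i)) *\<^sub>R y ^ (n - i)))"
    by (intro sum.cong refl) (simp add: binomial_fact mult.commute)
  finally show ?thesis .
qed

text \<open>In each coefficient, the product is a finite sum of products of absolutely convergent real
series, to which the Cauchy product applies.\<close>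

lemma exp_add:
  assumes comm: "x * y = y * x"
  shows "clif_exp (x + y) = clif_exp x * clif_exp y"
proof (rule clif_eqI)
  fix C
  obtain m where m: "in_Cl m x" "in_Cl m y" using in_Cl_exists2 by blast
  let ?P = "Pow {..<m}"
  have "(\<lambda>n. \<Sum>A\<in>?P. cl_sign A (sym_diff A C) *
      (\<Sum>i\<le>n. (coef (x ^ i) A / fact i) * (coef (y ^ (n - i)) (sym_diff A C) / fact (n - i))))
    sums (\<Sum>A\<in>?P. cl_sign A (sym_diff A C) * (coef (clif_exp x) A * coef (clif_exp y) (sym_diff A C)))"
    unfolding coef_exp using summable_coef_exp
    by (intro sums_sum sums_mult Cauchy_product_sums) simp_all
  moreover have "(\<Sum>A\<in>?P. cl_sign A (sym_diff A C) *
      (\<Sum>i\<le>n. (coef (x ^ i) A / fact i) * (coef (y ^ (n - i)) (sym_diff A C) / fact (n - i)))) =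
    coef ((x + y) ^ n) C / fact n" for n
  proof -
    have "coef ((x + y) ^ n) C / fact n = coef ((1 / fact n) *\<^sub>R (x + y) ^ n) C" by simp
    also have "\<dots> = (\<Sum>i\<le>n. coef (((1 / fact i) *\<^sub>R x ^ i) * ((1 / fact (n - i)) *\<^sub>R y ^ (n - i))) C)"
      unfolding divided_power_add[OF comm] coef_sum ..
    also have "\<dots> = (\<Sum>i\<le>n. \<Sum>A\<in>?P. cl_sign A (sym_diff A C) *
      ((coef (x ^ i) A / fact i) * (coef (y ^ (n - i)) (sym_diff A C) / fact (n - i))))"
    proof (rule sum.cong[OF refl])
      fix i
      have in': "in_Cl m ((1 / fact i) *\<^sub>R x ^ i)" using m in_Cl_power by auto
      show "coef (((1 / fact i) *\<^sub>R x ^ i) * ((1 / fact (n - i)) *\<^sub>R y ^ (n - i))) C =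
        (\<Sum>A\<in>?P. cl_sign A (sym_diff A C) *
          ((coef (x ^ i) A / fact i) * (coef (y ^ (n - i)) (sym_diff A C) / fact (n - i))))"
        unfolding coef_times[OF in'] coef_linear by (simp add: ac_simps)
    qed
    also have "\<dots> = (\<Sum>A\<in>?P. \<Sum>i\<le>n. cl_sign A (sym_diff A C) *
      ((coef (x ^ i) A / fact i) * (coef (y ^ (n - i)) (sym_diff A C) / fact (n - i))))"
      by (rule sum.swap)
    finally show ?thesis by (simp add: sum_distrib_left)
  qed
  ultimately have "(\<lambda>n. coef ((x + y) ^ n) C / fact n) sums coef (clif_exp x * clif_exp y) C"
    by (simp add: coef_times[OF in_Cl_exp[OF m(1)]] mult.assoc)
  then show "coef (clif_exp (x + y)) C = coef (clif_exp x * clif_exp y) C"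
    using coef_exp_sums sums_unique2 by blast
qed

lemma exp_zero: "clif_exp 0 = 1"
proof (rule clif_eqI)
  fix A
  have "(\<lambda>k. coef (0 ^ k) A / fact k) = (\<lambda>k. if k = 0 then coef 1 A else 0)"
    by (auto simp: power_0_left)
  then show "coef (clif_exp 0) A = coef 1 A"
    using coef_exp_sums[of 0 A] sums_single[of 0 "\<lambda>_. coef 1 A"] sums_unique2 by metis
qed

lemma exp_imaginary_unit:
  assumes B: "B * B = - (1 :: clif)"
  shows "clif_exp (c *\<^sub>R B) = cos c *\<^sub>R 1 + sin c *\<^sub>R B"
proof (rule clif_eqI)
  fix A
  have even: "B ^ (2 * k) = (- 1) ^ k *\<^sub>R 1" for k
    by (simp add: power_mult power2_eq_square B) (metis minus_one_power_iff scaleR_minus_left scaleR_one)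
  have odd: "B ^ Suc (2 * k) = (- 1) ^ k *\<^sub>R B" for k
    unfolding power_Suc even by simp
  have pow: "(1 / fact k) *\<^sub>R (c *\<^sub>R B) ^ k = (cos_coeff k *\<^sub>R c ^ k) *\<^sub>R 1 + (sin_coeff k *\<^sub>R c ^ k) *\<^sub>R B" for k
  proof (cases "even k")
    case True
    then obtain j where "k = 2 * j" by blast
    then show ?thesis
      unfolding power_scaleR_right \<open>k = 2 * j\<close> even by (simp add: cos_coeff_def sin_coeff_def)
  next
    case False
    then obtain j where "k = Suc (2 * j)" by (metis oddE Suc_eq_plus1)
    then show ?thesis
      unfolding power_scaleR_right \<open>k = Suc (2 * j)\<close> odd by (simp add: cos_coeff_def sin_coeff_def)
  qed
  have "coef ((c *\<^sub>R B) ^ k) A / fact k =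
      (cos_coeff k *\<^sub>R c ^ k) * coef 1 A + (sin_coeff k *\<^sub>R c ^ k) * coef B A" for k
    using arg_cong[OF pow[of k], of "\<lambda>z. coef z A"] by simp
  moreover have "(\<lambda>k. (cos_coeff k *\<^sub>R c ^ k) * coef 1 A + (sin_coeff k *\<^sub>R c ^ k) * coef B A) sums
      (cos c * coef 1 A + sin c * coef B A)"
    by (intro sums_add sums_mult2 cos_converges sin_converges)
  ultimately have "(\<lambda>k. coef ((c *\<^sub>R B) ^ k) A / fact k) sums (cos c * coef 1 A + sin c * coef B A)"
    by simp
  then show "coef (clif_exp (c *\<^sub>R B)) A = coef (cos c *\<^sub>R 1 + sin c *\<^sub>R B) A"
    using coef_exp_sums[of "c *\<^sub>R B" A] sums_unique2 by fastforce
qed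

lemma exp_sum_list:
  assumes "\<And>j. j \<in> set js \<Longrightarrow> B j * B j = - (1 :: clif)"
    and "\<And>j k. j \<in> set js \<Longrightarrow> k \<in> set js \<Longrightarrow> B j * B k = B k * B j"
  shows "clif_exp (\<Sum>j\<leftarrow>js. c j *\<^sub>R B j) = (\<Prod>j\<leftarrow>js. cos (c j) *\<^sub>R 1 + sin (c j) *\<^sub>R B j)"
  using assms
proof (induction js)
  case Nil
  then show ?case by (simp add: exp_zero)
next
  case (Cons i js)
  have "B i * (\<Sum>j\<leftarrow>ks. c j *\<^sub>R B j) = (\<Sum>j\<leftarrow>ks. c j *\<^sub>R B j) * B i" if "set ks \<subseteq> set js" for ks
    using that by (induction ks) (simp_all add: distrib_left distrib_right Cons.prems(2))
  then have "clif_exp (c i *\<^sub>R B i + (\<Sum>j\<leftarrow>js. c j *\<^sub>R B j)) =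
      clif_exp (c i *\<^sub>R B i) * clif_exp (\<Sum>j\<leftarrow>js. c j *\<^sub>R B j)"
    by (intro exp_add) simp
  then show ?case using Cons by (simp add: exp_imaginary_unit)
qed

text \<open>Every coefficient of \<open>exp (s x)\<close> is an everywhere convergent power series in \<open>s\<close> whose linear
coefficient is that of \<open>x\<close>.\<close>

lemma DERIV_coef_exp: "((\<lambda>s. coef (clif_exp (s *\<^sub>R x)) A) has_real_derivative coef x A) (at 0)"
proof -
  define c where "c = (\<lambda>k. coef (x ^ k) A / fact k)"
  have c: "coef ((s *\<^sub>R x) ^ k) A / fact k = c k * s ^ k" for s k
    by (simp add: c_def power_scaleR_right)
  have "summable (\<lambda>k. c k * s ^ k)" for s
    using coef_exp_sums[of "s *\<^sub>R x" A] unfolding c by (rule sums_summable)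
  from termdiffs_strong_converges_everywhere[OF this, of 0]
  have "((\<lambda>s. \<Sum>k. c k * s ^ k) has_real_derivative diffs c 0) (at 0)" by simp
  moreover have "diffs c 0 = coef x A" by (simp add: diffs_def c_def)
  ultimately show ?thesis unfolding coef_exp c by simp
qed

section \<open>The Spin group and its Lie algebra\<close>

lemma Cl_mult:
  assumes "in_Cl m x" "in_Cl m y"
  shows "coef x \<otimes>\<^bsub>Cl m\<^esub> coef y = coef (x * y)"
proof
  fix C
  let ?S = "{(A, B). A \<subseteq> {..<m} \<and> B \<subseteq> {..<m} \<and> sym_diff A B = C}"
  have "(coef x \<otimes>\<^bsub>Cl m\<^esub> coef y) C = (\<Sum>(A, B)\<in>?S. cl_sign A B * coef x A * coef y B)"
    by (simp add: Cl_def)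
  also have "\<dots> = (\<Sum>A | A \<subseteq> {..<m} \<and> sym_diff A C \<subseteq> {..<m}.
      cl_sign A (sym_diff A C) * coef x A * coef y (sym_diff A C))"
  proof (rule sum.reindex_bij_witness[of _ "\<lambda>A. (A, sym_diff A C)" fst])
    fix p assume "p \<in> ?S"
    then obtain A B where p: "p = (A, B)" "A \<subseteq> {..<m}" "B \<subseteq> {..<m}" "sym_diff A B = C" by blast
    then have B: "sym_diff A C = B" by auto
    show "(fst p, sym_diff (fst p) C) = p" using p(1) B by simp
    show "fst p \<in> {A. A \<subseteq> {..<m} \<and> sym_diff A C \<subseteq> {..<m}}"
      using p(2,3) by (simp only: p(1) fst_conv mem_Collect_eq B)
    show "cl_sign (fst p) (sym_diff (fst p) C) * coef x (fst p) * coef y (sym_diff (fst p) C) =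
      (case p of (A, B) \<Rightarrow> cl_sign A B * coef x A * coef y B)"
      using p(1) B by simp
  next
    fix A assume "A \<in> {A. A \<subseteq> {..<m} \<and> sym_diff A C \<subseteq> {..<m}}"
    then show "(A, sym_diff A C) \<in> ?S" by (simp only: mem_Collect_eq case_prod_conv sym_diff_cancel)
    show "fst (A, sym_diff A C) = A" by simp
  qed
  also have "\<dots> = coef (x * y) C"
    unfolding coef_times[OF assms(1)]
  proof (rule sum.mono_neutral_left)
    show "\<forall>A\<in>Pow {..<m} - {A. A \<subseteq> {..<m} \<and> sym_diff A C \<subseteq> {..<m}}.
        cl_sign A (sym_diff A C) * coef x A * coef y (sym_diff A C) = 0"
    proof
      fix A assume "A \<in> Pow {..<m} - {A. A \<subseteq> {..<m} \<and> sym_diff A C \<subseteq> {..<m}}"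
      then have "\<not> sym_diff A C \<subseteq> {..<m}" unfolding Diff_iff Pow_iff mem_Collect_eq by iprover
      from coef_eq_0[OF assms(2) this]
      show "cl_sign A (sym_diff A C) * coef x A * coef y (sym_diff A C) = 0" by simp
    qed
  qed auto
  finally show "(coef x \<otimes>\<^bsub>Cl m\<^esub> coef y) C = coef (x * y) C" .
qed

lemma Cl_one: "\<one>\<^bsub>Cl m\<^esub> = coef 1"
  by (rule ext) (simp add: Cl_def coef_one)

lemma Cl_power:
  assumes "in_Cl m x"
  shows "coef x [^]\<^bsub>Cl m\<^esub> (k :: nat) = coef (x ^ k)"
proof (induction k)
  case 0
  then show ?case by (simp add: nat_pow_def Cl_one)
next
  case (Suc k)
  then show ?case
    using Cl_mult[OF in_Cl_power[OF assms] assms, of k]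
    by (simp add: nat_pow_def power_commutes)
qed

lemma cl_exp_coef:
  assumes "in_Cl m x"
  shows "cl_exp m (coef x) = coef (clif_exp x)"
  by (rule ext) (simp add: cl_exp_def Cl_power[OF assms] coef_exp)

text \<open>The carrier of \<open>Spin m\<close>, transported to the type \<open>clif\<close>.\<close>

definition spin_elem :: "nat \<Rightarrow> clif set" where
  "spin_elem m = {prod_list (map vect vs) | vs.
     even (length vs) \<and> (\<forall>v\<in>set vs. v \<in> carrier_vec m \<and> v \<bullet> v = 1)}"

lemma foldr_vect:
  assumes "\<forall>v\<in>set vs. v \<in> carrier_vec m"
  shows "foldr (\<lambda>v x. cl_vec v \<otimes>\<^bsub>Cl m\<^esub> x) vs \<one>\<^bsub>Cl m\<^esub> = coef (prod_list (map vect vs))"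
  using assms
proof (induction vs)
  case (Cons v vs)
  have "in_Cl m (prod_list (map vect vs))"
    using Cons.prems by (intro in_Cl_prod_list) (auto intro: in_Cl_vect)
  then show ?case
    using Cons Cl_mult[OF in_Cl_vect] by (simp add: coef_vect)
qed (simp add: Cl_one)

lemma carrier_Spin: "carrier (Spin m) = coef ` spin_elem m"
  unfolding Spin_def spin_elem_def
  by (auto simp: foldr_vect image_iff) (metis foldr_vect)+

lemma spin_elem_induct [consumes 1, case_names one mult]:
  assumes "g \<in> spin_elem m" "P 1"
    and "\<And>u v g. u \<in> carrier_vec m \<Longrightarrow> v \<in> carrier_vec m \<Longrightarrow> u \<bullet> u = 1 \<Longrightarrow> v \<bullet> v = 1 \<Longrightarrow>
      g \<in> spin_elem m \<Longrightarrow> P g \<Longrightarrow> P (vect u * (vect v * g))"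
  shows "P g"
proof -
  have "P (prod_list (map vect vs))"
    if "even (length vs)" "\<forall>v\<in>set vs. v \<in> carrier_vec m \<and> v \<bullet> v = 1" for vs
    using that
  proof (induction "length vs" arbitrary: vs rule: less_induct)
    case less
    show ?case
    proof (cases vs)
      case Nil
      then show ?thesis using assms(2) by simp
    next
      case (Cons u ws)
      with less.prems(1) obtain v us where vs: "vs = u # v # us" by (cases ws) auto
      have us: "even (length us)" "\<forall>v\<in>set us. v \<in> carrier_vec m \<and> v \<bullet> v = 1"
        using less.prems vs by auto
      then have "prod_list (map vect us) \<in> spin_elem m" by (auto simp: spin_elem_def)
      moreover have "P (prod_list (map vect us))" using less.hyps[of us] vs us by simp
      ultimately show ?thesis using assms(3) less.prems(2) by (simp add: vs)
    qed
  qed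
  then show ?thesis using assms(1) by (auto simp: spin_elem_def)
qed

lemma spin_elem_one: "1 \<in> spin_elem m"
  unfolding spin_elem_def by (auto intro!: exI[of _ "[]"])

lemma spin_elem_vect_times:
  assumes "u \<in> carrier_vec m" "v \<in> carrier_vec m" "u \<bullet> u = 1" "v \<bullet> v = 1" "g \<in> spin_elem m"
  shows "vect u * (vect v * g) \<in> spin_elem m"
proof -
  obtain vs where "g = prod_list (map vect vs)" "even (length vs)"
    "\<forall>v\<in>set vs. v \<in> carrier_vec m \<and> v \<bullet> v = 1"
    using assms(5) by (auto simp: spin_elem_def)
  then show ?thesis using assms
    unfolding spin_elem_def by (auto intro!: exI[of _ "u # v # vs"])
qed

definition even_clif :: "clif \<Rightarrow> bool" where
  "even_clif x \<longleftrightarrow> (\<forall>A. coef x A \<noteq> 0 \<longrightarrow> even (card A))"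

text \<open>The product of two basis vectors with a monomial changes the parity of the degree twice.\<close>

lemma even_vect_vect_times:
  assumes "even_clif g"
  shows "even_clif (vect u * (vect v * g))"
proof -
  have single: "even (card (sym_diff {i} A)) \<longleftrightarrow> odd (card A)" if "finite A" for i :: nat and A
    using card_sym_diff_parity[of "{i}" A] that by simp
  have "even_clif (bas {i} * (bas {j} * g))" for i j
    unfolding even_clif_def
  proof (intro allI impI)
    fix C assume "coef (bas {i} * (bas {j} * g)) C \<noteq> 0"
    then have *: "coef g (sym_diff {j} (sym_diff {i} C)) \<noteq> 0"
      by (simp only: coef_bas_times[OF finite.insertI[OF finite.emptyI]] mult_eq_0_iff) blast
    have cancel: "finite D" if "finite (sym_diff {k} D)" for k :: nat and D
      by (rule finite_subset[of _ "insert k (sym_diff {k} D)"]) (use that in auto)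
    have "finite (sym_diff {j} (sym_diff {i} C))" using * coef_infinite by blast
    then have fin: "finite (sym_diff {i} C)" by (rule cancel)
    then have finC: "finite C" by (rule cancel)
    have "even (card (sym_diff {j} (sym_diff {i} C)))"
      by (rule assms[unfolded even_clif_def, rule_format, OF *])
    then have "\<not> even (card (sym_diff {i} C))" by (rule single[OF fin, THEN iffD1])
    then show "even (card C)" unfolding single[OF finC] by (rule notnotD)
  qed
  moreover have "vect u * (vect v * g) =
      (\<Sum>i<dim_vec u. \<Sum>j<dim_vec v. (u $ i * v $ j) *\<^sub>R (bas {i} * (bas {j} * g)))"
    by (simp add: vect_def sum_distrib_right[of _ _ g] sum_product mult.commute)
  ultimately show ?thesis
    by (auto simp: even_clif_def coef_sum elim!: sum.not_neutral_contains_not_neutral)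
qed

lemma spin_elem_even: "g \<in> spin_elem m \<Longrightarrow> even_clif g"
proof (induction rule: spin_elem_induct)
  case one
  then show ?case by (simp add: even_clif_def coef_one)
qed (rule even_vect_vect_times)

lemma vect_unit_square: "v \<in> carrier_vec m \<Longrightarrow> v \<bullet> v = 1 \<Longrightarrow> vect v * vect v = - 1"
  using vect_square[of v m] by simp

text \<open>For a unit vector \<open>v\<close> conjugation gives \<open>-v\<close>, and \<open>v * (-v) = 1\<close>; a product telescopes.\<close>

lemma spin_elem_cconj: "g \<in> spin_elem m \<Longrightarrow> g * cconj g = 1"
proof (induction rule: spin_elem_induct)
  case (mult u v g)
  have "vect u * (vect v * g) * cconj (vect u * (vect v * g)) =
      vect u * (vect v * (g * cconj g) * vect v) * vect u"
    by (simp add: cconj_times cconj_vect mult.assoc)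
  also have "\<dots> = vect u * (vect v * vect v) * vect u" by (simp add: mult.IH)
  also have "\<dots> = 1"
    using vect_unit_square[OF mult.hyps(1,3)] vect_unit_square[OF mult.hyps(2,4)] by simp
  finally show ?case .
qed simp

text \<open>Up to the factor \<open>v \<bullet> v\<close> this is the reflection of \<open>w\<close> in the hyperplane orthogonal
to \<open>v\<close>.\<close>

lemma vect_conjugate_vect:
  assumes v: "v \<in> carrier_vec m" and w: "w \<in> carrier_vec m"
  shows "\<exists>w'\<in>carrier_vec m. vect v * vect w * vect v = vect w'"
proof
  have "vect w * vect v = - vect v * vect w + (- 2 * (v \<bullet> w)) *\<^sub>R 1"
    unfolding vect_anticommute[OF v w, symmetric] by simp
  then have "vect v * vect w * vect v = - (vect v * vect v) * vect w - (2 * (v \<bullet> w)) *\<^sub>R vect v"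
    by (simp add: mult.assoc right_diff_distrib)
  also have "\<dots> = vect ((v \<bullet> v) \<cdot>\<^sub>v w + (- 2 * (v \<bullet> w)) \<cdot>\<^sub>v v)"
    using v w by (subst vect_add[of _ m]) (auto simp: vect_square[OF v] vect_smult)
  finally show "vect v * vect w * vect v = vect ((v \<bullet> v) \<cdot>\<^sub>v w + (- 2 * (v \<bullet> w)) \<cdot>\<^sub>v v)" .
  show "(v \<bullet> v) \<cdot>\<^sub>v w + (- 2 * (v \<bullet> w)) \<cdot>\<^sub>v v \<in> carrier_vec m" using v w by simp
qed

lemma spin_elem_conjugates_vect:
  "g \<in> spin_elem m \<Longrightarrow> \<forall>w\<in>carrier_vec m. \<exists>w'\<in>carrier_vec m. g * vect w * cconj g = vect w'"
proof (induction rule: spin_elem_induct)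
  case one
  then show ?case by auto
next
  case (mult u v g)
  show ?case
  proof
    fix w :: "real vec" assume "w \<in> carrier_vec m"
    then obtain w1 where w1: "w1 \<in> carrier_vec m" "g * vect w * cconj g = vect w1" using mult.IH by blast
    obtain w2 where w2: "w2 \<in> carrier_vec m" "vect v * vect w1 * vect v = vect w2"
      using vect_conjugate_vect[OF mult.hyps(2) w1(1)] by blast
    obtain w3 where w3: "w3 \<in> carrier_vec m" "vect u * vect w2 * vect u = vect w3"
      using vect_conjugate_vect[OF mult.hyps(1) w2(1)] by blast
    have "vect u * (vect v * g) * vect w * cconj (vect u * (vect v * g)) =
        vect u * (vect v * (g * vect w * cconj g) * vect v) * vect u"
      by (simp add: cconj_times cconj_vect mult.assoc)
    also have "\<dots> = vect w3" by (simp add: w1 w2 w3)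
    finally show "\<exists>w'\<in>carrier_vec m. vect u * (vect v * g) * vect w * cconj (vect u * (vect v * g)) = vect w'"
      using w3(1) by blast
  qed
qed

text \<open>The set \<open>spin_lie m\<close>, transported to the type \<open>clif\<close>.\<close>

definition lie_elem :: "nat \<Rightarrow> clif set" where
  "lie_elem m = {x. in_Cl m x \<and> (\<forall>s. clif_exp (s *\<^sub>R x) \<in> spin_elem m)}"

lemma spin_lie_eq: "spin_lie m = coef ` lie_elem m"
proof -
  have eq: "cl_exp m (\<lambda>A. s * coef x A) \<in> carrier (Spin m) \<longleftrightarrow> clif_exp (s *\<^sub>R x) \<in> spin_elem m"
    if "in_Cl m x" for s x
  proof -
    have "(\<lambda>A. s * coef x A) = coef (s *\<^sub>R x)" by (rule ext) simp
    then have "cl_exp m (\<lambda>A. s * coef x A) = coef (clif_exp (s *\<^sub>R x))"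
      using cl_exp_coef[of m "s *\<^sub>R x"] that by auto
    then show ?thesis by (simp add: carrier_Spin image_iff coef_inject)
  qed
  show ?thesis
  proof (intro equalityI subsetI)
    fix f assume f: "f \<in> spin_lie m"
    then have "f \<in> carrier (Cl m)" by (simp add: spin_lie_def)
    then have c: "coef (Clif f) = f" "in_Cl m (Clif f)" by (simp_all add: coef_Clif in_Cl_def)
    then have "Clif f \<in> lie_elem m" using f eq[OF c(2)] by (simp add: spin_lie_def lie_elem_def)
    then show "f \<in> coef ` lie_elem m" using c(1) by (metis imageI)
  next
    fix f assume "f \<in> coef ` lie_elem m"
    then show "f \<in> spin_lie m" using eq by (auto simp: spin_lie_def lie_elem_def in_Cl_def)
  qed
qed

text \<open>The coefficients of \<open>g y (cconj g)\<close> are bilinear in those of \<open>g\<close>, so the product rule and the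
derivative of the exponential at \<open>0\<close> suffice.\<close>

lemma DERIV_conjugate:
  assumes x: "in_Cl m x"
  shows "((\<lambda>s. coef (clif_exp (s *\<^sub>R x) * y * cconj (clif_exp (s *\<^sub>R x))) C)
    has_real_derivative coef (x * y + y * cconj x) C) (at 0)"
proof -
  let ?P = "Pow {..<m}"
  have expand: "coef (g * y * cconj h) C =
      (\<Sum>A\<in>?P. \<Sum>B\<in>?P. coef g A * coef h B * coef (bas A * y * cconj (bas B)) C)"
    if "in_Cl m g" "in_Cl m h" for g h
  proof -
    have cc: "cconj h = (\<Sum>B\<in>?P. coef h B *\<^sub>R cconj (bas B))"
    proof (rule clif_eqI)
      fix D
      have "coef (cconj h) D = cl_sign D D * coef (\<Sum>B\<in>?P. coef h B *\<^sub>R bas B) D"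
        using clif_expand[OF that(2)] by (simp add: coef_cconj)
      then show "coef (cconj h) D = coef (\<Sum>B\<in>?P. coef h B *\<^sub>R cconj (bas B)) D"
        by (simp add: coef_sum coef_cconj sum_distrib_left ac_simps)
    qed
    have "g * y * cconj h = (\<Sum>A\<in>?P. coef g A *\<^sub>R bas A) * y * (\<Sum>B\<in>?P. coef h B *\<^sub>R cconj (bas B))"
      using clif_expand[OF that(1)] cc by simp
    also have "\<dots> = (\<Sum>A\<in>?P. coef g A *\<^sub>R (bas A * y)) * (\<Sum>B\<in>?P. coef h B *\<^sub>R cconj (bas B))"
      by (simp add: sum_distrib_right)
    also have "\<dots> = (\<Sum>A\<in>?P. \<Sum>B\<in>?P. (coef g A * coef h B) *\<^sub>R (bas A * y * cconj (bas B)))"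
      by (simp add: sum_product mult.commute)
    finally show ?thesis by (simp add: coef_sum)
  qed
  have in_exp: "in_Cl m (clif_exp (s *\<^sub>R x))" for s using x by (intro in_Cl_exp) auto
  have one: "clif_exp (0 *\<^sub>R x) = 1" by (simp add: exp_zero)
  have "((\<lambda>s. \<Sum>A\<in>?P. \<Sum>B\<in>?P. coef (clif_exp (s *\<^sub>R x)) A * coef (clif_exp (s *\<^sub>R x)) B *
      coef (bas A * y * cconj (bas B)) C) has_real_derivative
    (\<Sum>A\<in>?P. \<Sum>B\<in>?P. (coef x A * coef 1 B + coef x B * coef 1 A) *
      coef (bas A * y * cconj (bas B)) C)) (at 0)"
    using DERIV_mult[OF DERIV_coef_exp[of x] DERIV_coef_exp[of x]]
    by (intro DERIV_sum DERIV_cmult_right) (simp add: one exp_zero)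
  moreover have "(\<Sum>A\<in>?P. \<Sum>B\<in>?P. (coef x A * coef 1 B + coef x B * coef 1 A) *
      coef (bas A * y * cconj (bas B)) C) = coef (x * y * cconj 1) C + coef (1 * y * cconj x) C"
    unfolding expand[OF x in_Cl_closed(2)] expand[OF in_Cl_closed(2) x] sum.distrib[symmetric]
    by (intro sum.cong refl) (simp add: algebra_simps)
  ultimately show ?thesis unfolding expand[OF in_exp in_exp] by simp
qed

text \<open>Along the one-parameter group of \<open>x\<close>, the odd coefficients vanish, \<open>g (cconj g)\<close> is constant, and
the coefficients of \<open>g w (cconj g)\<close> in degrees other than one vanish. At \<open>0\<close>, the derivatives of these identities
are the evenness of \<open>x\<close>, the equation for \<open>cconj x\<close> and the statement on commutators.\<close>

lemma lie_elem_properties: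
  assumes "x \<in> lie_elem m"
  shows lie_elem_in_Cl: "in_Cl m x"
    and lie_elem_even: "even_clif x"
    and lie_elem_cconj: "cconj x = - x"
    and lie_elem_commutator: "w \<in> carrier_vec m \<Longrightarrow> \<nexists>i. i < m \<and> C = {i} \<Longrightarrow>
      coef (x * vect w - vect w * x) C = 0"
proof -
  show x: "in_Cl m x" using assms by (simp add: lie_elem_def)
  have spin: "clif_exp (s *\<^sub>R x) \<in> spin_elem m" for s using assms by (simp add: lie_elem_def)
  show "even_clif x"
    unfolding even_clif_def
  proof (intro allI impI, rule ccontr)
    fix A assume A: "coef x A \<noteq> 0" "odd (card A)"
    have "coef (clif_exp (s *\<^sub>R x)) A = 0" for s
      using spin_elem_even[OF spin] A(2) unfolding even_clif_def by blast
    then have "((\<lambda>s. 0) has_real_derivative coef x A) (at 0)" using DERIV_coef_exp[of x A] by simp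
    then show False using A(1) DERIV_unique[OF DERIV_const] by metis
  qed
  show conj: "cconj x = - x"
  proof (rule clif_eqI)
    fix C
    have "((\<lambda>s. coef 1 C) has_real_derivative coef (x * 1 + 1 * cconj x) C) (at 0)"
      using DERIV_conjugate[OF x, of 1 C] by (simp add: spin_elem_cconj[OF spin])
    then have "coef (x * 1 + 1 * cconj x) C = 0" using DERIV_unique[OF DERIV_const] by metis
    then show "coef (cconj x) C = coef (- x) C" by simp
  qed
  assume w: "w \<in> carrier_vec m" and C: "\<nexists>i. i < m \<and> C = {i}"
  have "coef (clif_exp (s *\<^sub>R x) * vect w * cconj (clif_exp (s *\<^sub>R x))) C = 0" for s
    using spin_elem_conjugates_vect[OF spin[of s]] w coef_vect_nonsingleton[OF _ C] by metis
  then have "((\<lambda>s. 0) has_real_derivative coef (x * vect w + vect w * cconj x) C) (at 0)"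
    using DERIV_conjugate[OF x, of "vect w" C] by simp
  then have "coef (x * vect w + vect w * cconj x) C = 0" using DERIV_unique[OF DERIV_const] by metis
  then show "coef (x * vect w - vect w * x) C = 0" by (simp add: conj)
qed

lemma spin_diff_coef:
  assumes "in_Cl m x"
  shows "spin_diff m (coef x) =
    mat m m (\<lambda>(i, j). complex_of_real (coef (x * vect (unit_vec m j) - vect (unit_vec m j) * x) {i}))"
  unfolding spin_diff_def coef_vect[symmetric]
  by (intro cong_mat refl) (simp add: Cl_mult assms in_Cl_vect)

text \<open>The matrix \<open>spin_diff m x\<close> only records the components of degree one of the commutators with
vectors, but for elements of the Lie algebra there are no others. Two elements with the same image
thus have a difference \<open>z\<close> that commutes with all vectors. A monomial of positive even degree
anticommutes with each of the basis vectors occurring in it, and the constant term is excluded by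
\<open>cconj z = - z\<close>; so \<open>z = 0\<close>.\<close>

lemma spin_diff_inj: "inj_on (spin_diff m) (spin_lie m)"
proof (rule inj_onI)
  fix f g assume "f \<in> spin_lie m" "g \<in> spin_lie m" and eq: "spin_diff m f = spin_diff m g"
  then obtain x y where x: "x \<in> lie_elem m" "f = coef x" and y: "y \<in> lie_elem m" "g = coef y"
    by (auto simp: spin_lie_eq)
  define z where "z = x - y"
  have z: "in_Cl m z" using x y by (auto simp: z_def lie_elem_in_Cl)
  have even: "even (card A)" if "coef z A \<noteq> 0" for A
    using that lie_elem_even[OF x(1)] lie_elem_even[OF y(1)]
    by (cases "coef x A = 0") (auto simp: z_def even_clif_def)
  have comm: "z * bas {j} = bas {j} * z" if j: "j < m" for j
  proof (rule clif_eqI)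
    fix C
    let ?w = "unit_vec m j :: real vec"
    have "coef (x * vect ?w - vect ?w * x) C = coef (y * vect ?w - vect ?w * y) C"
    proof (cases "\<exists>i. i < m \<and> C = {i}")
      case True
      then obtain i where i: "i < m" "C = {i}" by blast
      then have "spin_diff m f $$ (i, j) = spin_diff m g $$ (i, j)" using eq by simp
      then show ?thesis
        using i j x y by (simp add: spin_diff_coef lie_elem_in_Cl del: coef_linear of_real_diff)
    next
      case False
      then show ?thesis using lie_elem_commutator[OF _ _ False] x y by simp
    qed
    then show "coef (z * bas {j}) C = coef (bas {j} * z) C"
      using j by (simp add: z_def vect_unit algebra_simps)
  qed
  have "z = 0"
  proof (rule clif_eqI)
    fix A
    show "coef z A = coef 0 A"
    proof (cases "A = {}")
      case True
      have "cconj z = cconj x - cconj y"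
        by (rule clif_eqI) (simp add: z_def coef_cconj right_diff_distrib)
      then have "cconj z = - z" using lie_elem_cconj x y by (simp add: z_def)
      then have "coef z {} = - coef z {}" using coef_cconj[of z "{}"] by simp
      then show ?thesis using True by simp
    next
      case False
      show ?thesis
      proof (rule ccontr)
        assume nz: "coef z A \<noteq> coef 0 A"
        then have A: "A \<subseteq> {..<m}" "even (card A)" using even coef_eq_0[OF z] by auto
        then have fin: "finite A" using finite_subset by blast
        \<comment> \<open>The commutator with this basis vector detects the coefficient at A.\<close>
        obtain j where j: "j \<in> A" using False by blast
        have "coef (z * bas {j}) (sym_diff {j} A) = coef (bas {j} * z) (sym_diff {j} A)"
          using comm A(1) j by auto
        then have "cl_sign A {j} * coef z A = cl_sign {j} A * coef z A"
          by (simp only: coef_bas_times[OF finite.insertI[OF finite.emptyI]]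
            coef_times_bas[OF finite.insertI[OF finite.emptyI]] sym_diff_cancel)
        then have same: "cl_sign A {j} = cl_sign {j} A" using nz by simp
        have "{(a, b) \<in> A \<times> {j}. a \<ge> b} = (\<lambda>a. (a, j)) ` {a \<in> A. j \<le> a}"
          "{(a, b) \<in> {j} \<times> A. a \<ge> b} = (\<lambda>a. (j, a)) ` {a \<in> A. a \<le> j}" by auto
        then have "card {(a, b) \<in> A \<times> {j}. a \<ge> b} = card {a \<in> A. j \<le> a}"
          "card {(a, b) \<in> {j} \<times> A. a \<ge> b} = card {a \<in> A. a \<le> j}"
          by (simp_all add: card_image inj_on_def)
        moreover have "card {a \<in> A. j \<le> a} + card {a \<in> A. a \<le> j} = card A + 1"
        proof -
          have "{a \<in> A. j \<le> a} \<union> {a \<in> A. a \<le> j} = A" "{a \<in> A. j \<le> a} \<inter> {a \<in> A. a \<le> j} = {j}"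
            using j by auto
          then show ?thesis using card_Un_Int[of "{a \<in> A. j \<le> a}" "{a \<in> A. a \<le> j}"] fin by simp
        qed
        ultimately have "cl_sign A {j} * cl_sign {j} A = (- 1) ^ (card A + 1)"
          by (simp add: cl_sign_def power_add[symmetric])
        then have "cl_sign A {j} * cl_sign A {j} = - 1" using same A(2) by simp
        then show False by simp
      qed
    qed
  qed
  then show "f = g" using x y by (simp add: z_def)
qed

text \<open>By injectivity, the inverse of the differential in the definition of \<open>spin_exp\<close> can be computed from
  any preimage in the Lie algebra.\<close>

lemma spin_exp_eq:
  assumes "x \<in> lie_elem m" "spin_diff m (coef x) = \<xi>"
  shows "spin_exp m \<xi> = coef (clif_exp x)"
proof -
  have "coef x \<in> spin_lie m" using assms(1) by (simp add: spin_lie_eq)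
  then have "inv_into (spin_lie m) (spin_diff m) \<xi> = coef x"
    using inv_into_f_f[OF spin_diff_inj] assms(2) by blast
  then show ?thesis using assms(1) by (simp add: spin_exp_def cl_exp_coef lie_elem_in_Cl)
qed

section \<open>The exponential of a maximal torus\<close>

lemma anticommute_pair_commutes:
  fixes a b w :: "'a :: ring_1"
  assumes "a * w = - (w * a)" "b * w = - (w * b)"
  shows "a * b * w = w * (a * b)"
proof -
  have "a * b * w = - (a * w * b)" by (simp add: mult.assoc assms(2))
  then show ?thesis by (simp add: assms(1) mult.assoc)
qed

lemma commutes_prod_list:
  fixes w :: "'a :: monoid_mult"
  assumes "\<And>x. x \<in> set xs \<Longrightarrow> w * x = x * w"
  shows "w * prod_list xs = prod_list xs * w"
  using assms
proof (induction xs)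
  case (Cons x xs)
  have "w * (x * prod_list xs) = x * (w * prod_list xs)"
    using Cons.prems[of x] by (simp add: mult.assoc[symmetric])
  then show ?case using Cons by (simp add: mult.assoc)
qed simp

text \<open>The planes spanned by \<open>u j\<close> and \<open>v j\<close> are pairwise orthogonal; the rotations of these planes form a
torus of the orthogonal group, and the products \<open>u j * v j\<close> span the Lie algebra of its preimage
in the Spin group.\<close>

locale orthonormal_pairs =
  fixes m n :: nat and u v :: "nat \<Rightarrow> real vec"
  assumes u_carrier: "\<And>j. j \<in> {1..n} \<Longrightarrow> u j \<in> carrier_vec m"
    and v_carrier: "\<And>j. j \<in> {1..n} \<Longrightarrow> v j \<in> carrier_vec m"
    and uu: "\<And>j k. j \<in> {1..n} \<Longrightarrow> k \<in> {1..n} \<Longrightarrow> u j \<bullet> u k = (if j = k then 1 else 0)"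
    and vv: "\<And>j k. j \<in> {1..n} \<Longrightarrow> k \<in> {1..n} \<Longrightarrow> v j \<bullet> v k = (if j = k then 1 else 0)"
    and uv: "\<And>j k. j \<in> {1..n} \<Longrightarrow> k \<in> {1..n} \<Longrightarrow> u j \<bullet> v k = 0"
begin

definition plane :: "nat \<Rightarrow> clif" where "plane j = vect (u j) * vect (v j)"

definition torus_log :: "(nat \<Rightarrow> real) \<Rightarrow> clif" where
  "torus_log c = (\<Sum>j\<leftarrow>[1..<Suc n]. c j *\<^sub>R plane j)"

definition rotor :: "(nat \<Rightarrow> real) \<Rightarrow> nat \<Rightarrow> clif" where
  "rotor c j = cos (c j) *\<^sub>R 1 + sin (c j) *\<^sub>R plane j"

lemma vect_orthogonal:
  assumes "a \<in> carrier_vec m" "b \<in> carrier_vec m" "a \<bullet> b = 0"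
  shows "vect a * vect b = - (vect b * vect a)"
  using vect_anticommute[OF assms(1,2)] assms(3) by (simp add: eq_neg_iff_add_eq_0)

lemma vu:
  assumes "j \<in> {1..n}" "k \<in> {1..n}"
  shows "v j \<bullet> u k = 0"
  using uv[OF assms(2,1)] comm_scalar_prod[OF v_carrier[OF assms(1)] u_carrier[OF assms(2)]] by simp

lemma u_square: "j \<in> {1..n} \<Longrightarrow> vect (u j) * vect (u j) = - 1"
  and v_square: "j \<in> {1..n} \<Longrightarrow> vect (v j) * vect (v j) = - 1"
  by (rule vect_unit_square[OF u_carrier]; simp add: uu) (rule vect_unit_square[OF v_carrier]; simp add: vv)

lemma v_times_u: "j \<in> {1..n} \<Longrightarrow> k \<in> {1..n} \<Longrightarrow> vect (v j) * vect (u k) = - (vect (u k) * vect (v j))"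
  by (intro vect_orthogonal u_carrier v_carrier vu)

lemma plane_commutes_u:
  assumes "j \<in> {1..n}" "k \<in> {1..n}" "j \<noteq> k"
  shows "plane j * vect (u k) = vect (u k) * plane j"
  unfolding plane_def using assms uu
  by (intro anticommute_pair_commutes vect_orthogonal u_carrier v_carrier vu) auto

lemma plane_commutes_v:
  assumes "j \<in> {1..n}" "k \<in> {1..n}" "j \<noteq> k"
  shows "plane j * vect (v k) = vect (v k) * plane j"
  unfolding plane_def using assms vv uv
  by (intro anticommute_pair_commutes vect_orthogonal u_carrier v_carrier) auto

lemma plane_commutes:
  assumes "j \<in> {1..n}" "k \<in> {1..n}"
  shows "plane j * plane k = plane k * plane j"
proof (cases "j = k")
  case False
  have "plane j * (vect (u k) * vect (v k)) = vect (u k) * (plane j * vect (v k))"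
    using plane_commutes_u[OF assms False] by (simp add: mult.assoc[symmetric])
  also have "\<dots> = vect (u k) * vect (v k) * plane j"
    using plane_commutes_v[OF assms False] by (simp add: mult.assoc)
  finally show ?thesis by (simp add: plane_def[of k])
qed simp

lemma u_times_plane:
  assumes "j \<in> {1..n}"
  shows "vect (u j) * plane j = - vect (v j)"
  unfolding plane_def by (simp add: mult.assoc[symmetric] u_square[OF assms])

lemma plane_times_u:
  assumes "j \<in> {1..n}"
  shows "plane j * vect (u j) = vect (v j)"
  unfolding plane_def mult.assoc v_times_u[OF assms assms]
  by (simp add: mult.assoc[symmetric] u_square[OF assms])

lemma plane_square:
  assumes "j \<in> {1..n}"
  shows "plane j * plane j = - 1"
proof -
  have "plane j * plane j = plane j * vect (u j) * vect (v j)" by (simp add: plane_def[of j] mult.assoc)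
  then show ?thesis by (simp add: plane_times_u[OF assms] v_square[OF assms])
qed

lemma exp_planes:
  assumes "set js \<subseteq> {1..n}"
  shows "clif_exp (\<Sum>j\<leftarrow>js. c j *\<^sub>R plane j) = (\<Prod>j\<leftarrow>js. rotor c j)"
  unfolding rotor_def
proof (rule exp_sum_list)
  show "plane j * plane j = - 1" if "j \<in> set js" for j using that assms plane_square by blast
  show "plane j * plane k = plane k * plane j" if "j \<in> set js" "k \<in> set js" for j k
    using that assms plane_commutes by blast
qed

text \<open>A rotor is the product of the two unit vectors \<open>- u j\<close> and
\<open>cos (c j) u j - sin (c j) v j\<close>.\<close>

lemma rotors_spin_elem:
  assumes "set js \<subseteq> {1..n}"
  shows "(\<Prod>j\<leftarrow>js. rotor c j) \<in> spin_elem m"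
  using assms
proof (induction js)
  case Nil
  then show ?case by (simp add: spin_elem_one)
next
  case (Cons j js)
  then have j: "j \<in> {1..n}" by simp
  let ?a = "- u j" and ?b = "cos (c j) \<cdot>\<^sub>v u j + (- sin (c j)) \<cdot>\<^sub>v v j"
  have carr: "?a \<in> carrier_vec m" "?b \<in> carrier_vec m" using u_carrier[OF j] v_carrier[OF j] by auto
  have "?b \<bullet> ?b = (cos (c j))\<^sup>2 + (sin (c j))\<^sup>2"
    using u_carrier[OF j] v_carrier[OF j]
    by (simp add: add_scalar_prod_distrib[of _ m] scalar_prod_add_distrib[of _ m] uu[OF j j] vv[OF j j]
      uv[OF j j] vu[OF j j]
      power2_eq_square)
  then have b: "?b \<bullet> ?b = 1" by simp
  have a: "?a \<bullet> ?a = 1" using u_carrier[OF j] uu[OF j j] by simp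
  have "rotor c j = vect ?a * vect ?b"
    using u_carrier[OF j] v_carrier[OF j]
    by (simp add: rotor_def plane_def vect_uminus vect_add[of _ m] vect_smult
      right_diff_distrib u_square[OF j])
  then show ?case
    using spin_elem_vect_times[OF carr a b] Cons by (simp add: mult.assoc)
qed

lemma plane_in_Cl: "j \<in> {1..n} \<Longrightarrow> in_Cl m (plane j)"
  unfolding plane_def by (intro in_Cl_closed in_Cl_vect u_carrier v_carrier)

lemma exp_torus_log: "clif_exp (torus_log c) = (\<Prod>j\<leftarrow>[1..<Suc n]. rotor c j)"
  unfolding torus_log_def by (intro exp_planes) auto

lemma torus_log_sum: "torus_log c = (\<Sum>j\<in>{1..n}. c j *\<^sub>R plane j)"
  unfolding torus_log_def by (subst sum_list_distinct_conv_sum_set) (auto intro: sum.cong)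

lemma torus_log_lie: "torus_log c \<in> lie_elem m"
proof -
  have "in_Cl m (torus_log c)"
    unfolding torus_log_sum by (intro in_Cl_sum in_Cl_closed plane_in_Cl)
  moreover have scale: "s *\<^sub>R torus_log c = torus_log (\<lambda>j. s * c j)" for s
    by (simp add: torus_log_sum scaleR_right.sum)
  moreover have "(\<Prod>j\<leftarrow>[1..<Suc n]. rotor d j) \<in> spin_elem m" for d
    by (rule rotors_spin_elem) auto
  ultimately show ?thesis
    unfolding lie_elem_def mem_Collect_eq scale exp_torus_log by blast
qed

text \<open>A product of rotors equal to 1 commutes with \<open>u j\<close>, as do all its factors but the one
  in the plane of \<open>u j\<close>. Hence that factor commutes with \<open>u j\<close> as well. But \<open>u j\<close> anticommutes
  with \<open>plane j\<close>, so the sine vanishes.\<close>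

lemma exp_torus_log_eq_1_iff:
  "clif_exp (torus_log c) = 1 \<longleftrightarrow> (\<forall>j\<in>{1..n}. sin (c j) = 0) \<and> (\<Prod>j\<in>{1..n}. cos (c j)) = 1"
proof -
  have scalar: "clif_exp (torus_log c) = (\<Prod>j\<in>{1..n}. cos (c j)) *\<^sub>R 1"
    if "\<forall>j\<in>{1..n}. sin (c j) = 0"
  proof -
    have "(\<Prod>j\<leftarrow>js. rotor c j) = (\<Prod>j\<leftarrow>js. cos (c j)) *\<^sub>R 1" if "set js \<subseteq> {1..n}" for js
      using that \<open>\<forall>j\<in>{1..n}. sin (c j) = 0\<close> by (induction js) (auto simp: rotor_def)
    moreover have "(\<Prod>j\<leftarrow>[1..<Suc n]. cos (c j)) = (\<Prod>j\<in>{1..n}. cos (c j))"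
      by (subst prod.distinct_set_conv_list[symmetric]) (auto intro: prod.cong)
    ultimately show ?thesis unfolding exp_torus_log by (metis atLeastLessThanSuc_atLeastAtMost set_upt subset_refl)
  qed
  have sin0: "sin (c j) = 0" if one: "clif_exp (torus_log c) = 1" and j: "j \<in> {1..n}" for j
  proof -
    \<comment> \<open>The remaining factors, which commute with u j, are the inverse of the factor in the plane of u j.\<close>
    define ks where "ks = remove1 j [1..<Suc n]"
    define h where "h = (\<Prod>k\<leftarrow>ks. rotor c k)"
    have ks: "set ks = {1..n} - {j}" by (auto simp: ks_def set_remove1_eq)
    have "torus_log c = (\<Sum>k\<leftarrow>j # ks. c k *\<^sub>R plane k)"
      unfolding torus_log_def ks_def using j by (subst sum_list_map_remove1[of j]) auto
    then have h: "rotor c j * h = 1"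
      using exp_planes[of "j # ks" c] one j ks by (auto simp: h_def)
    have "vect (u j) * h = h * vect (u j)"
      unfolding h_def
    proof (rule commutes_prod_list)
      fix x assume "x \<in> set (map (rotor c) ks)"
      then have "x \<in> rotor c ` ({1..n} - {j})" by (simp only: set_map ks)
      then obtain k where "k \<in> {1..n}" "k \<noteq> j" "x = rotor c k" by blast
      then show "vect (u j) * x = x * vect (u j)"
        using plane_commutes_u[of k j] j by (simp add: rotor_def distrib_left distrib_right)
    qed
    moreover have "h = cos (c j) *\<^sub>R 1 - sin (c j) *\<^sub>R plane j"
    proof -
      have "(cos (c j) *\<^sub>R 1 - sin (c j) *\<^sub>R plane j) * rotor c j =
          (cos (c j) * cos (c j)) *\<^sub>R 1 + (sin (c j) * sin (c j)) *\<^sub>R 1"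
        unfolding rotor_def
        by (simp add: left_diff_distrib distrib_left plane_square[OF j] scaleR_right_distrib
          scaleR_right_diff_distrib mult.commute)
      then have inv: "(cos (c j) *\<^sub>R 1 - sin (c j) *\<^sub>R plane j) * rotor c j = 1"
        by (simp only: scaleR_left_distrib[symmetric] sin_cos_squared_add3 scaleR_one)
      have "h = (cos (c j) *\<^sub>R 1 - sin (c j) *\<^sub>R plane j) * rotor c j * h" by (simp only: inv mult_1)
      then show ?thesis by (simp only: mult.assoc h mult_1_right)
    qed
    ultimately have "sin (c j) *\<^sub>R vect (v j) = - (sin (c j) *\<^sub>R vect (v j))"
      by (simp add: left_diff_distrib right_diff_distrib u_times_plane[OF j] plane_times_u[OF j])
    then have "(2 * sin (c j)) *\<^sub>R vect (v j) = 0"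
      by (simp only: eq_neg_iff_add_eq_0 scaleR_left_distrib mult_2)
    moreover have "vect (v j) \<noteq> 0" using v_square[OF j] by auto
    ultimately show ?thesis by simp
  qed
  show ?thesis
  proof
    assume one: "clif_exp (torus_log c) = 1"
    then have "\<forall>j\<in>{1..n}. sin (c j) = 0" using sin0 by blast
    moreover from scalar[OF this] one have "(\<Prod>j\<in>{1..n}. cos (c j)) *\<^sub>R 1 = (1 *\<^sub>R 1 :: clif)" by simp
    then have "(\<Prod>j\<in>{1..n}. cos (c j)) = 1" by (simp only: scaleR_cancel_right) simp
    ultimately show "(\<forall>j\<in>{1..n}. sin (c j) = 0) \<and> (\<Prod>j\<in>{1..n}. cos (c j)) = 1" by blast
  qed (use scalar in simp)
qed

text \<open>The matrix of the infinitesimal rotation with speed \<open>a j\<close> in the plane of \<open>u j\<close> and \<open>v j\<close>; it sends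
\<open>v j\<close> to \<open>a j\<close> times \<open>u j\<close>.\<close>

definition so_elem :: "(nat \<Rightarrow> real) \<Rightarrow> complex mat" where
  "so_elem a = mat m m (\<lambda>(i, k).
     complex_of_real (\<Sum>j\<in>{1..n}. a j * (u j $ i * v j $ k - v j $ i * u j $ k)))"

lemma plane_commutator:
  assumes j: "j \<in> {1..n}" and w: "w \<in> carrier_vec m"
  shows "plane j * vect w - vect w * plane j =
    (2 * (u j \<bullet> w)) *\<^sub>R vect (v j) - (2 * (v j \<bullet> w)) *\<^sub>R vect (u j)"
proof -
  have u: "vect (u j) * vect w = (- 2 * (u j \<bullet> w)) *\<^sub>R 1 - vect w * vect (u j)"
    using vect_anticommute[OF u_carrier[OF j] w] by (simp only: eq_diff_eq)
  have v: "vect (v j) * vect w = (- 2 * (v j \<bullet> w)) *\<^sub>R 1 - vect w * vect (v j)"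
    using vect_anticommute[OF v_carrier[OF j] w] by (simp only: eq_diff_eq)
  have "plane j * vect w = vect (u j) * ((- 2 * (v j \<bullet> w)) *\<^sub>R 1 - vect w * vect (v j))"
    by (simp only: plane_def mult.assoc v)
  also have "\<dots> = (- 2 * (v j \<bullet> w)) *\<^sub>R vect (u j) - (vect (u j) * vect w) * vect (v j)"
    by (simp add: right_diff_distrib mult.assoc)
  also have "\<dots> = (- 2 * (v j \<bullet> w)) *\<^sub>R vect (u j) + (2 * (u j \<bullet> w)) *\<^sub>R vect (v j) + vect w * plane j"
    unfolding u by (simp add: left_diff_distrib plane_def mult.assoc)
  finally show ?thesis by simp
qed

lemma cl_vec_singleton: "i < dim_vec w \<Longrightarrow> cl_vec w {i} = w $ i"
  by (simp add: cl_vec_def)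

text \<open>By \<open>plane_commutator\<close>, the differential of the covering sends \<open>u j * v j\<close> to \<open>-2\<close> times
the infinitesimal rotation of the plane, which accounts for the factor \<open>-1/2\<close>.\<close>

lemma spin_diff_torus_log: "spin_diff m (coef (torus_log (\<lambda>j. - a j / 2))) = so_elem a"
proof (rule eq_matI)
  fix i k assume "i < dim_row (so_elem a)" "k < dim_col (so_elem a)"
  then have ik: "i < m" "k < m" by (simp_all add: so_elem_def)
  let ?w = "unit_vec m k :: real vec"
  have "coef (plane j * vect ?w - vect ?w * plane j) {i} = 2 * (u j $ k * v j $ i - v j $ k * u j $ i)"
    if j: "j \<in> {1..n}" for j
    unfolding plane_commutator[OF j unit_vec_carrier] using ik u_carrier[OF j] v_carrier[OF j]
    by (simp add: coef_vect cl_vec_singleton algebra_simps)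
  moreover have "coef (torus_log (\<lambda>j. - a j / 2) * vect ?w - vect ?w * torus_log (\<lambda>j. - a j / 2)) {i} =
      (\<Sum>j\<in>{1..n}. (- a j / 2) * coef (plane j * vect ?w - vect ?w * plane j) {i})"
    by (simp add: torus_log_sum sum_distrib_left sum_distrib_right coef_sum sum_subtractf sum_negf diff_divide_distrib
      right_diff_distrib)
  ultimately have "coef (torus_log (\<lambda>j. - a j / 2) * vect ?w - vect ?w * torus_log (\<lambda>j. - a j / 2)) {i} =
      (\<Sum>j\<in>{1..n}. (- a j / 2) * (2 * (u j $ k * v j $ i - v j $ k * u j $ i)))"
    by (simp only: cong: sum.cong)
  also have "\<dots> = (\<Sum>j\<in>{1..n}. a j * (u j $ i * v j $ k - v j $ i * u j $ k))"
    by (intro sum.cong refl) (simp add: algebra_simps)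
  finally show "spin_diff m (coef (torus_log (\<lambda>j. - a j / 2))) $$ (i, k) = so_elem a $$ (i, k)"
    using ik by (simp add: spin_diff_coef[OF lie_elem_in_Cl[OF torus_log_lie]] so_elem_def
      del: coef_linear of_real_sum of_real_diff)
qed (simp_all add: spin_diff_def so_elem_def)

definition even_lattice :: "(nat \<Rightarrow> real) \<Rightarrow> bool" where
  "even_lattice a \<longleftrightarrow> (\<exists>k :: nat \<Rightarrow> int. (\<forall>j\<in>{1..n}. a j = of_int (k j)) \<and> even (\<Sum>j\<in>{1..n}. k j))"

text \<open>The half in the logarithm turns the angles \<open>2 \<pi> a j\<close> into \<open>\<pi> a j\<close>: the sines vanish if all \<open>a j\<close> are
integers, and then the product of the cosines is \<open>-1\<close> to the power \<open>\<Sum> a j\<close>.\<close>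

lemma spin_exp_so_elem_eq_one_iff:
  "spin_exp m (so_elem (\<lambda>j. 2 * pi * a j)) = \<one>\<^bsub>Spin m\<^esub> \<longleftrightarrow> even_lattice a"
proof -
  have "spin_exp m (so_elem (\<lambda>j. 2 * pi * a j)) = coef (clif_exp (torus_log (\<lambda>j. - (2 * pi * a j) / 2)))"
    by (rule spin_exp_eq[OF torus_log_lie spin_diff_torus_log])
  moreover have "\<one>\<^bsub>Spin m\<^esub> = coef 1" by (simp add: Spin_def Cl_one)
  ultimately have "spin_exp m (so_elem (\<lambda>j. 2 * pi * a j)) = \<one>\<^bsub>Spin m\<^esub> \<longleftrightarrow>
      (\<forall>j\<in>{1..n}. sin (a j * pi) = 0) \<and> (\<Prod>j\<in>{1..n}. cos (pi * a j)) = 1"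
    by (simp add: coef_inject exp_torus_log_eq_1_iff mult.commute)
  also have "\<dots> \<longleftrightarrow> even_lattice a"
  proof -
    have cosprod: "(\<Prod>j\<in>{1..n}. cos (pi * a j)) = 1 \<longleftrightarrow> even (\<Sum>j\<in>{1..n}. k j)"
      if "\<forall>j\<in>{1..n}. a j = of_int (k j)" for k
    proof -
      have "(\<Prod>j\<in>{1..n}. cos (pi * a j)) = (\<Prod>j\<in>{1..n}. if even (k j) then 1 else - 1)"
        using that by (intro prod.cong refl) simp
      also have "\<dots> = (if even (\<Sum>j\<in>{1..n}. k j) then 1 else - 1)" for S :: "nat set"
      proof -
        have "finite S \<Longrightarrow> (\<Prod>j\<in>S. if even (k j) then 1 else - 1 :: real) = (if even (\<Sum>j\<in>S. k j) then 1 else - 1)" for S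
          by (induction S rule: finite_induct) auto
        then show ?thesis by simp
      qed
      finally show ?thesis by (simp split: if_splits)
    qed
    show ?thesis
    proof
      assume *: "(\<forall>j\<in>{1..n}. sin (a j * pi) = 0) \<and> (\<Prod>j\<in>{1..n}. cos (pi * a j)) = 1"
      then have "\<forall>j\<in>{1..n}. \<exists>k :: int. a j = of_int k"
        by (metis Ints_cases sin_times_pi_eq_0)
      then obtain k :: "nat \<Rightarrow> int" where "\<forall>j\<in>{1..n}. a j = of_int (k j)" by metis
      with * cosprod[OF this] show "even_lattice a" unfolding even_lattice_def by blast
    next
      assume "even_lattice a"
      then obtain k :: "nat \<Rightarrow> int" where k: "\<forall>j\<in>{1..n}. a j = of_int (k j)" "even (\<Sum>j\<in>{1..n}. k j)"
        unfolding even_lattice_def by blast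
      with cosprod[OF k(1)] show "(\<forall>j\<in>{1..n}. sin (a j * pi) = 0) \<and> (\<Prod>j\<in>{1..n}. cos (pi * a j)) = 1"
        by (simp add: sin_times_pi_eq_0)
    qed
  qed
  finally show ?thesis .
qed

end

section \<open>The torus in an adapted basis\<close>

lemma finsum_mat_index:
  fixes f :: "'i \<Rightarrow> complex mat"
  assumes "finite A" "\<And>x. x \<in> A \<Longrightarrow> f x \<in> carrier_mat m m"
  shows "finsum (Mat m) f A \<in> carrier_mat m m"
    and "r < m \<Longrightarrow> c < m \<Longrightarrow> finsum (Mat m) f A $$ (r, c) = (\<Sum>x\<in>A. f x $$ (r, c))"
proof -
  interpret abelian_group "Mat m" by (rule abelian_group_mat)
  have "finsum (Mat m) f A \<in> carrier_mat m m \<and>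
      (\<forall>r<m. \<forall>c<m. finsum (Mat m) f A $$ (r, c) = (\<Sum>x\<in>A. f x $$ (r, c)))"
    using assms
  proof (induction A rule: finite_induct)
    case empty
    then show ?case using finsum_empty by (simp add: module_mat_simps)
  next
    case (insert x A)
    have fx: "f x \<in> carrier_mat m m" using insert.prems by simp
    have IH: "finsum (Mat m) f A \<in> carrier_mat m m"
      "\<And>r c. r < m \<Longrightarrow> c < m \<Longrightarrow> finsum (Mat m) f A $$ (r, c) = (\<Sum>x\<in>A. f x $$ (r, c))"
      using insert.IH insert.prems by blast+
    have "f \<in> A \<rightarrow> carrier (Mat m)" using insert.prems by (auto simp: module_mat_simps)
    then have eq: "finsum (Mat m) f (insert x A) = f x + finsum (Mat m) f A"
      using finsum_insert[OF insert.hyps, of f] fx by (simp only: module_mat_simps)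
    show ?case
      unfolding eq sum.insert[OF insert.hyps]
    proof (intro conjI allI impI)
      show "f x + finsum (Mat m) f A \<in> carrier_mat m m" using IH(1) by (rule add_carrier_mat)
      fix r c assume "r < m" "c < m"
      then show "(f x + finsum (Mat m) f A) $$ (r, c) = f x $$ (r, c) + (\<Sum>x\<in>A. f x $$ (r, c))"
        using index_add_mat(1)[of r "finsum (Mat m) f A" c "f x"] IH(2) carrier_matD[OF IH(1)]
        by (simp only:)
    qed
  qed
  then show "finsum (Mat m) f A \<in> carrier_mat m m"
    and "r < m \<Longrightarrow> c < m \<Longrightarrow> finsum (Mat m) f A $$ (r, c) = (\<Sum>x\<in>A. f x $$ (r, c))"
    by blast+
qed

text \<open>The dimension gets a name of its own, which prevents the numeral expression \<open>2 * n + 1\<close> from being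
rewritten by the simplifier.\<close>

locale adapted_basis_dim = adapted_basis +
  fixes m :: nat
  assumes m_def: "m = 2 * n + 1"
begin

lemma e_carrier: "k \<in> {1..m} \<Longrightarrow> e k \<in> carrier_vec m"
proof -
  interpret vec_space "TYPE(complex)" m .
  have "e ` {1..m} \<subseteq> carrier_vec m"
    using basis unfolding m_def[symmetric] basis_def by (elim conjE)
  moreover assume "k \<in> {1..m}"
  ultimately show "e k \<in> carrier_vec m" by (rule subsetD[OF _ imageI])
qed

text \<open>The index paired with \<open>k\<close> by the bilinear form.\<close>

definition dual :: "nat \<Rightarrow> nat" where
  "dual k = (if k \<le> n then n + k else if k \<le> 2 * n then k - n else k)"

lemma dual_in: "k \<in> {1..m} \<Longrightarrow> dual k \<in> {1..m}"
  by (auto simp: dual_def m_def)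

lemma dual_dual: "k \<in> {1..m} \<Longrightarrow> dual (dual k) = k"
  by (auto simp: dual_def m_def)

lemma form_dual: "i \<in> {1..m} \<Longrightarrow> j \<in> {1..m} \<Longrightarrow> e i \<bullet> e j = (if j = dual i then 1 else 0)"
  using form[of i j] unfolding m_def[symmetric] by (auto simp: dual_def m_def)

text \<open>The change of basis. Matrices are indexed from \<open>0\<close> and the basis from \<open>1\<close>, so column \<open>k\<close> is
\<open>e (k + 1)\<close>. The inverse \<open>Q\<close> has the dual basis as its rows.\<close>

definition P :: "complex mat" where "P = mat m m (\<lambda>(r, k). e (Suc k) $ r)"

definition Q :: "complex mat" where "Q = mat m m (\<lambda>(k, s). e (dual (Suc k)) $ s)"

lemma PQ_carrier [simp]: "P \<in> carrier_mat m m" "Q \<in> carrier_mat m m"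
  by (simp_all add: P_def Q_def)

lemma dot_e: "k \<in> {1..m} \<Longrightarrow> v \<in> carrier_vec m \<Longrightarrow> e k \<bullet> v = (\<Sum>r<m. e k $ r * v $ r)"
  by (simp add: scalar_prod_def lessThan_atLeast0)

lemma QP: "Q * P = 1\<^sub>m m"
proof (rule eq_matI)
  fix k l assume "k < dim_row (1\<^sub>m m)" "l < dim_col (1\<^sub>m m)"
  then have kl: "Suc k \<in> {1..m}" "Suc l \<in> {1..m}" "k < m" "l < m" by auto
  have "(Q * P) $$ (k, l) = e (dual (Suc k)) \<bullet> e (Suc l)"
    using kl by (simp add: Q_def P_def scalar_prod_def carrier_vecD[OF e_carrier])
  also have "\<dots> = (if Suc l = dual (dual (Suc k)) then 1 else 0)"
    by (rule form_dual[OF dual_in[OF kl(1)] kl(2)])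
  also have "\<dots> = 1\<^sub>m m $$ (k, l)" using kl by (simp add: dual_dual)
  finally show "(Q * P) $$ (k, l) = 1\<^sub>m m $$ (k, l)" .
qed (simp_all add: P_def Q_def)

lemma PQ: "P * Q = 1\<^sub>m m"
  by (rule mat_mult_left_right_inverse[OF PQ_carrier(2,1) QP])

lemma P_cancel:
  assumes "A \<in> carrier_mat m m" "B \<in> carrier_mat m m" "A * P = B * P"
  shows "A = B"
proof -
  have "A * P * Q = B * P * Q" using assms(3) by simp
  then show ?thesis using assms(1,2) by (simp add: assoc_mult_mat[of _ m m _ m _ m] PQ)
qed

lemma P_cancel_left:
  assumes "A \<in> carrier_mat m m" "B \<in> carrier_mat m m" "P * A = P * B"
  shows "A = B"
proof -
  have "Q * (P * A) = Q * (P * B)" using assms(3) by simp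
  then show ?thesis using assms(1,2) by (simp add: assoc_mult_mat[of _ m m _ m _ m, symmetric] QP)
qed

lemma mult_P_index:
  assumes "A \<in> carrier_mat m m" "r < m" "k < m"
  shows "(A * P) $$ (r, k) = (A *\<^sub>v e (Suc k)) $ r"
proof -
  have "e (Suc k) \<in> carrier_vec m" using assms by (intro e_carrier) auto
  then have "col P k = e (Suc k)" using assms by (auto simp: P_def)
  then show ?thesis using assms carrier_matD[OF PQ_carrier(1)] by simp
qed

lemma mat_eqI_e:
  assumes "A \<in> carrier_mat m m" "B \<in> carrier_mat m m" "\<And>k. k \<in> {1..m} \<Longrightarrow> A *\<^sub>v e k = B *\<^sub>v e k"
  shows "A = B"
proof (rule P_cancel[OF assms(1,2)], rule eq_matI)
  fix r k assume "r < dim_row (B * P)" "k < dim_col (B * P)"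
  then have "r < m" "k < m" using assms(2) by (auto simp: P_def)
  then show "(A * P) $$ (r, k) = (B * P) $$ (r, k)" using assms by (simp add: mult_P_index)
qed (use assms in auto)

text \<open>The explicit form of \<open>E j\<close>: a combination of outer products of \<open>e j\<close> and its dual vector.\<close>

definition rot :: "nat \<Rightarrow> complex mat" where
  "rot j = mat m m (\<lambda>(r, s). \<i> * (e j $ r * e (n + j) $ s - e (n + j) $ r * e j $ s))"

lemma rot_carrier [simp]: "rot j \<in> carrier_mat m m"
  by (simp add: rot_def)

lemma rot_mult_index:
  assumes j: "j \<in> {1..n}" and v: "v \<in> carrier_vec m" and r: "r < m"
  shows "(rot j *\<^sub>v v) $ r = \<i> * ((e (n + j) \<bullet> v) * e j $ r - (e j \<bullet> v) * e (n + j) $ r)"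
proof -
  have "(rot j *\<^sub>v v) $ r = (\<Sum>s<m. \<i> * (e j $ r * e (n + j) $ s - e (n + j) $ r * e j $ s) * v $ s)"
    using v r by (simp add: rot_def scalar_prod_def lessThan_atLeast0)
  also have "\<dots> = \<i> * ((\<Sum>s<m. e (n + j) $ s * v $ s) * e j $ r - (\<Sum>s<m. e j $ s * v $ s) * e (n + j) $ r)"
    by (simp add: sum_distrib_left sum_distrib_right sum_subtractf algebra_simps)
  finally show ?thesis using j v by (simp add: dot_e m_def)
qed

lemma rot_mult_e:
  assumes j: "j \<in> {1..n}"
  shows "rot j *\<^sub>v e j = \<i> \<cdot>\<^sub>v e j" "rot j *\<^sub>v e (n + j) = (- \<i>) \<cdot>\<^sub>v e (n + j)"
    "\<And>k. k \<in> {1..m} \<Longrightarrow> k \<noteq> j \<Longrightarrow> k \<noteq> n + j \<Longrightarrow> rot j *\<^sub>v e k = 0\<^sub>v m"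
proof -
  have in_m: "j \<in> {1..m}" "n + j \<in> {1..m}" using j by (auto simp: m_def)
  have dual: "dual j = n + j" "dual (n + j) = j" "j \<noteq> n + j" using j by (auto simp: dual_def)
  show "rot j *\<^sub>v e j = \<i> \<cdot>\<^sub>v e j"
    using e_carrier[OF in_m(1)] in_m dual
    by (intro eq_vecI) (auto simp: rot_mult_index[OF j] form_dual carrier_matD[OF rot_carrier]
      simp del: index_mult_mat_vec)
  show "rot j *\<^sub>v e (n + j) = (- \<i>) \<cdot>\<^sub>v e (n + j)"
    using e_carrier[OF in_m(2)] in_m dual
    by (intro eq_vecI) (auto simp: rot_mult_index[OF j] form_dual carrier_matD[OF rot_carrier]
      simp del: index_mult_mat_vec)
  fix k assume "k \<in> {1..m}" "k \<noteq> j" "k \<noteq> n + j"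
  then show "rot j *\<^sub>v e k = 0\<^sub>v m"
    using e_carrier[of k] in_m dual
    by (intro eq_vecI) (auto simp: rot_mult_index[OF j] form_dual carrier_matD[OF rot_carrier]
      simp del: index_mult_mat_vec)
qed

lemma E_eq:
  assumes j: "j \<in> {1..n}"
  shows "E j = rot j"
  unfolding E_def m_def[symmetric] module_mat_simps
proof (rule the_equality)
  show "rot j \<in> carrier_mat m m \<and> rot j *\<^sub>v e j = \<i> \<cdot>\<^sub>v e j \<and> rot j *\<^sub>v e (n + j) = - \<i> \<cdot>\<^sub>v e (n + j) \<and>
      (\<forall>k\<in>{1..m} - {j, n + j}. rot j *\<^sub>v e k = 0\<^sub>v m)"
    using rot_mult_e[OF j] by auto
next
  fix A assume A: "A \<in> carrier_mat m m \<and> A *\<^sub>v e j = \<i> \<cdot>\<^sub>v e j \<and> A *\<^sub>v e (n + j) = - \<i> \<cdot>\<^sub>v e (n + j) \<and>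
      (\<forall>k\<in>{1..m} - {j, n + j}. A *\<^sub>v e k = 0\<^sub>v m)"
  show "A = rot j"
  proof (rule mat_eqI_e)
    fix k assume k: "k \<in> {1..m}"
    show "A *\<^sub>v e k = rot j *\<^sub>v e k"
      using A rot_mult_e[OF j] k by (cases "k = j \<or> k = n + j") auto
  qed (use A in auto)
qed

lemma torus_elem_carrier [simp]: "torus_elem a \<in> carrier_mat m m"
  and torus_elem_index: "r < m \<Longrightarrow> s < m \<Longrightarrow> torus_elem a $$ (r, s) =
    (\<Sum>j\<in>{1..n}. complex_of_real (a j) * rot j $$ (r, s))"
proof -
  have eq: "complex_of_real (a j) \<cdot>\<^sub>m E j = complex_of_real (a j) \<cdot>\<^sub>m rot j" if "j \<in> {1..n}" for j
    using E_eq[OF that] by simp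
  have carr: "complex_of_real (a j) \<cdot>\<^sub>m E j \<in> carrier_mat m m" if "j \<in> {1..n}" for j
    unfolding eq[OF that] by simp
  show "torus_elem a \<in> carrier_mat m m"
    unfolding torus_elem_def m_def[symmetric] by (rule finsum_mat_index) (use carr in auto)
  assume rs: "r < m" "s < m"
  have "torus_elem a $$ (r, s) = (\<Sum>j\<in>{1..n}. (complex_of_real (a j) \<cdot>\<^sub>m E j) $$ (r, s))"
    unfolding torus_elem_def m_def[symmetric] by (rule finsum_mat_index(2)) (use carr rs in auto)
  also have "\<dots> = (\<Sum>j\<in>{1..n}. complex_of_real (a j) * rot j $$ (r, s))"
    using rs rot_carrier by (intro sum.cong refl) (simp add: eq rot_def)
  finally show "torus_elem a $$ (r, s) = (\<Sum>j\<in>{1..n}. complex_of_real (a j) * rot j $$ (r, s))" .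
qed

lemma torus_elem_cong: "(\<And>j. j \<in> {1..n} \<Longrightarrow> a j = b j) \<Longrightarrow> torus_elem a = torus_elem b"
  by (rule eq_matI) (simp_all add: torus_elem_index carrier_matD[OF torus_elem_carrier])

text \<open>The eigenvalue of \<open>torus_elem a\<close> on \<open>e (k + 1)\<close>, divided by \<open>\<i>\<close>.\<close>

definition weight :: "(nat \<Rightarrow> real) \<Rightarrow> nat \<Rightarrow> real" where
  "weight a k = (if k < n then a (Suc k) else if k < 2 * n then - a (Suc k - n) else 0)"

definition D :: "(nat \<Rightarrow> real) \<Rightarrow> complex mat" where
  "D a = mat_diag m (\<lambda>k. \<i> * complex_of_real (weight a k))"

lemma D_carrier [simp]: "D a \<in> carrier_mat m m"
  by (simp add: D_def)

lemma torus_elem_P: "torus_elem a * P = P * D a"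
proof (rule eq_matI)
  fix r k assume "r < dim_row (P * D a)" "k < dim_col (P * D a)"
  then have rk: "r < m" "k < m" by (auto simp: P_def D_def mat_diag_def)
  have k: "Suc k \<in> {1..m}" using rk by auto
  have ek: "e (Suc k) \<in> carrier_vec m" by (rule e_carrier[OF k])
  have "(torus_elem a * P) $$ (r, k) = (\<Sum>s<m. torus_elem a $$ (r, s) * e (Suc k) $ s)"
    using rk ek carrier_matD[OF torus_elem_carrier]
    by (simp add: mult_P_index scalar_prod_def lessThan_atLeast0)
  also have "\<dots> = (\<Sum>s<m. \<Sum>j\<in>{1..n}. complex_of_real (a j) * (rot j $$ (r, s) * e (Suc k) $ s))"
    using rk by (simp add: torus_elem_index sum_distrib_right mult.assoc)
  also have "\<dots> = (\<Sum>j\<in>{1..n}. complex_of_real (a j) * (rot j *\<^sub>v e (Suc k)) $ r)"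
    using rk ek carrier_matD[OF rot_carrier]
    by (subst sum.swap) (simp add: sum_distrib_left scalar_prod_def lessThan_atLeast0)
  also have "\<dots> = (\<Sum>j\<in>{1..n}. complex_of_real (a j) *
      ((if j = Suc k then \<i> * e (Suc k) $ r else 0) - (if n + j = Suc k then \<i> * e (Suc k) $ r else 0)))"
  proof (rule sum.cong[OF refl])
    fix j assume j: "j \<in> {1..n}"
    then have "n + j \<noteq> j" by simp
    then show "complex_of_real (a j) * (rot j *\<^sub>v e (Suc k)) $ r = complex_of_real (a j) *
      ((if j = Suc k then \<i> * e (Suc k) $ r else 0) - (if n + j = Suc k then \<i> * e (Suc k) $ r else 0))"
      using rot_mult_e(1,2)[OF j] rot_mult_e(3)[OF j k] rk ek
      by (cases "j = Suc k"; cases "n + j = Suc k") auto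
  qed
  also have "\<dots> = e (Suc k) $ r * (\<i> * complex_of_real (weight a k))"
  proof -
    have sum1: "(\<Sum>j\<in>{1..n}. complex_of_real (a j) * (if j = Suc k then \<i> * e (Suc k) $ r else 0)) =
        (if k < n then complex_of_real (a (Suc k)) * (\<i> * e (Suc k) $ r) else 0)"
    proof -
      have "(\<Sum>j\<in>{1..n}. complex_of_real (a j) * (if j = Suc k then \<i> * e (Suc k) $ r else 0)) =
          (\<Sum>j\<in>{1..n}. if j = Suc k then complex_of_real (a (Suc k)) * (\<i> * e (Suc k) $ r) else 0)"
        by (intro sum.cong refl) auto
      then show ?thesis by auto
    qed
    have "(\<Sum>j\<in>{1..n}. complex_of_real (a j) * (if n + j = Suc k then \<i> * e (Suc k) $ r else 0)) =
        (\<Sum>j\<in>{1..n}. if j = Suc k - n \<and> n \<le> k then complex_of_real (a (Suc k - n)) * (\<i> * e (Suc k) $ r) else 0)"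
      by (intro sum.cong refl) auto
    also have "\<dots> = (if n \<le> k \<and> k < 2 * n then complex_of_real (a (Suc k - n)) * (\<i> * e (Suc k) $ r) else 0)"
      by (cases "n \<le> k") auto
    finally have sum2: "(\<Sum>j\<in>{1..n}. complex_of_real (a j) * (if n + j = Suc k then \<i> * e (Suc k) $ r else 0)) =
        (if n \<le> k \<and> k < 2 * n then complex_of_real (a (Suc k - n)) * (\<i> * e (Suc k) $ r) else 0)" .
    show ?thesis
      unfolding right_diff_distrib sum_subtractf sum1 sum2 by (auto simp: weight_def)
  qed
  also have "\<dots> = (P * D a) $$ (r, k)"
    using rk by (simp add: D_def mat_diag_mult_right[of _ m m] P_def)
  finally show "(torus_elem a * P) $$ (r, k) = (P * D a) $$ (r, k)" .
qed (use carrier_matD[OF torus_elem_carrier] carrier_matD[OF D_carrier] in \<open>simp_all add: P_def\<close>)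

lemma torus_elem_inj:
  assumes "torus_elem a = torus_elem b" "j \<in> {1..n}"
  shows "a j = b j"
proof -
  have "P * D a = P * D b" using assms(1) by (simp add: torus_elem_P[symmetric])
  then have D: "D a = D b" by (rule P_cancel_left[OF D_carrier D_carrier])
  obtain k where k: "j = Suc k" "k < n" using assms(2) by (cases j) auto
  then have "k < m" by (simp add: m_def)
  then have "D c $$ (k, k) = \<i> * complex_of_real (c j)" for c
    using k by (simp add: D_def mat_diag_def weight_def)
  from this[of a] this[of b] D show ?thesis by simp
qed

lemma torus_elem_eqI:
  assumes "A \<in> carrier_mat m m"
    and "\<And>r s. r < m \<Longrightarrow> s < m \<Longrightarrow> A $$ (r, s) = (\<Sum>j\<in>{1..n}. complex_of_real (a j) * rot j $$ (r, s))"
  shows "A = torus_elem a"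
  using assms carrier_matD[OF torus_elem_carrier] carrier_matD[OF assms(1)]
  by (intro eq_matI) (simp_all only: torus_elem_index)

lemma torus_elem_transpose: "transpose_mat (torus_elem a) = - torus_elem a"
proof (rule eq_matI)
  fix r s assume "r < dim_row (- torus_elem a)" "s < dim_col (- torus_elem a)"
  then have rs: "r < m" "s < m" using carrier_matD[OF torus_elem_carrier] by simp_all
  have "rot j $$ (s, r) = - rot j $$ (r, s)" for j using rs by (simp add: rot_def algebra_simps)
  then show "transpose_mat (torus_elem a) $$ (r, s) = (- torus_elem a) $$ (r, s)"
    using rs carrier_matD[OF torus_elem_carrier] by (simp add: torus_elem_index sum_negf)
qed (use carrier_matD[OF torus_elem_carrier] in simp_all)

lemma torus_elem_smult: "complex_of_real t \<cdot>\<^sub>m torus_elem a = torus_elem (\<lambda>j. t * a j)"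
  by (rule torus_elem_eqI)
    (simp_all add: torus_elem_index sum_distrib_left mult.assoc carrier_matD[OF torus_elem_carrier])

lemma torus_elem_diff: "torus_elem a - torus_elem b = torus_elem (\<lambda>j. a j - b j)"
  by (rule torus_elem_eqI)
    (simp_all add: torus_elem_index sum_subtractf left_diff_distrib carrier_matD[OF torus_elem_carrier] minus_carrier_mat)

lemma torus_elem_add: "torus_elem a + torus_elem b = torus_elem (\<lambda>j. a j + b j)"
  by (rule torus_elem_eqI)
    (simp_all add: torus_elem_index sum.distrib distrib_right carrier_matD[OF torus_elem_carrier])

lemma L_torus_elem:
  assumes "j \<in> {1..n}"
  shows "L j (torus_elem a) = \<i> * complex_of_real (a j)"
  unfolding L_def
proof (rule the_equality)
  show "\<exists>b. torus_elem a = torus_elem b \<and> \<i> * complex_of_real (a j) = \<i> * complex_of_real (b j)" by blast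
  fix z assume "\<exists>b. torus_elem a = torus_elem b \<and> z = \<i> * complex_of_real (b j)"
  then obtain b where b: "torus_elem a = torus_elem b" "z = \<i> * complex_of_real (b j)" by blast
  show "z = \<i> * complex_of_real (a j)" using torus_elem_inj[OF b(1) assms] b(2) by simp
qed

text \<open>Since \<open>e (n + j)\<close> is the complex conjugate of \<open>e j\<close> and they pair to \<open>1\<close>, the real and imaginary parts
of \<open>e j\<close> are orthogonal of norm \<open>1 / sqrt 2\<close>.\<close>

definition u :: "nat \<Rightarrow> real vec" where "u j = vec m (\<lambda>r. sqrt 2 * Re (e j $ r))"
definition v :: "nat \<Rightarrow> real vec" where "v j = vec m (\<lambda>r. sqrt 2 * Im (e j $ r))"

lemma sqrt2_product: "sqrt 2 * x * (sqrt 2 * y) = 2 * (x * y)"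
  by simp

lemma orthonormal_pairs: "orthonormal_pairs m n u v"
proof
  have uu: "u j \<bullet> u k = 2 * (\<Sum>r<m. Re (e j $ r) * Re (e k $ r))"
    and vv: "v j \<bullet> v k = 2 * (\<Sum>r<m. Im (e j $ r) * Im (e k $ r))"
    and uv: "u j \<bullet> v k = 2 * (\<Sum>r<m. Re (e j $ r) * Im (e k $ r))" for j k
    by (simp_all add: u_def v_def scalar_prod_def sum_distrib_left lessThan_atLeast0 sqrt2_product del: real_sqrt_mult_self)
  fix j k assume j: "j \<in> {1..n}" and k: "k \<in> {1..n}"
  have in_m: "j \<in> {1..m}" "k \<in> {1..m}" "n + j \<in> {1..m}" using j k by (auto simp: m_def)
  have "e j \<bullet> e k = 0" using form_dual[OF in_m(1,2)] j k by (simp add: dual_def)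
  then have sum0: "(\<Sum>r<m. e j $ r * e k $ r) = 0" using dot_e[OF in_m(1) e_carrier[OF in_m(2)]] by simp
  have "e (n + j) \<bullet> e k = (if j = k then 1 else 0)"
    using form_dual[OF in_m(3,2)] j k by (auto simp: dual_def)
  moreover have "e (n + j) \<bullet> e k = (\<Sum>r<m. cnj (e j $ r) * e k $ r)"
    using dot_e[OF in_m(3) e_carrier[OF in_m(2)]] conjugate_pair[OF j] e_carrier[OF in_m(1)] by simp
  ultimately have sum1: "(\<Sum>r<m. cnj (e j $ r) * e k $ r) = (if j = k then 1 else 0)" by simp
  show "u j \<bullet> u k = (if j = k then 1 else 0)" "v j \<bullet> v k = (if j = k then 1 else 0)" "u j \<bullet> v k = 0"
    using arg_cong[OF sum0, of Re] arg_cong[OF sum0, of Im] arg_cong[OF sum1, of Re] arg_cong[OF sum1, of Im]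
    unfolding uu vv uv by (auto simp: sum.distrib sum_subtractf split: if_splits)
qed (simp_all add: u_def v_def)

sublocale orthonormal_pairs m n u v by (rule orthonormal_pairs)

lemma torus_elem_so_elem: "torus_elem a = so_elem a"
proof (rule eq_matI)
  fix r s assume "r < dim_row (so_elem a)" "s < dim_col (so_elem a)"
  then have rs: "r < m" "s < m" by (simp_all add: so_elem_def)
  have eq: "complex_of_real (a j) * rot j $$ (r, s) =
      complex_of_real (a j * (u j $ r * v j $ s - v j $ r * u j $ s))" if j: "j \<in> {1..n}" for j
  proof -
    have "e j \<in> carrier_vec m" using j by (intro e_carrier) (auto simp: m_def)
    then have "rot j $$ (r, s) = \<i> * (e j $ r * cnj (e j $ s) - cnj (e j $ r) * e j $ s)"
      using rs conjugate_pair[OF j] by (simp add: rot_def)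
    also have "\<dots> = complex_of_real (u j $ r * v j $ s - v j $ r * u j $ s)"
      using rs by (simp add: u_def v_def complex_eq_iff sqrt2_product del: real_sqrt_mult_self)
    finally show ?thesis by simp
  qed
  have "torus_elem a $$ (r, s) =
      (\<Sum>j\<in>{1..n}. complex_of_real (a j * (u j $ r * v j $ s - v j $ r * u j $ s)))"
    unfolding torus_elem_index[OF rs] by (rule sum.cong[OF refl eq])
  then show "torus_elem a $$ (r, s) = so_elem a $$ (r, s)"
    using rs by (simp add: so_elem_def)
qed (use carrier_matD[OF torus_elem_carrier] in \<open>simp_all add: so_elem_def\<close>)

section \<open>The filtrations of canonical elements\<close>

text \<open>The matrix of the bilinear form \<open>x, y \<mapsto> x \<bullet> X y\<close> in the adapted basis. In contrast to the
matrix of the operator \<open>X\<close> in that basis, it is antisymmetric exactly if \<open>X\<close> is, which makes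
membership in the Lie algebra visible on the entries.\<close>

definition gram :: "complex mat \<Rightarrow> complex mat" where
  "gram X = transpose_mat P * X * P"

definition ungram :: "complex mat \<Rightarrow> complex mat" where
  "ungram Z = transpose_mat Q * Z * Q"

lemma transpose_PQ [simp]: "transpose_mat P \<in> carrier_mat m m" "transpose_mat Q \<in> carrier_mat m m"
  by (simp_all add: transpose_carrier_mat)

lemma gram_carrier [simp]: "X \<in> carrier_mat m m \<Longrightarrow> gram X \<in> carrier_mat m m"
  and ungram_carrier [simp]: "Z \<in> carrier_mat m m \<Longrightarrow> ungram Z \<in> carrier_mat m m"
  unfolding gram_def ungram_def by (intro mult_carrier_mat[of _ m m] transpose_PQ PQ_carrier; assumption)+

lemmas assoc_m = assoc_mult_mat[of _ m m _ m _ m]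

lemma transposed_inverse:
  "transpose_mat P * transpose_mat Q = 1\<^sub>m m" "transpose_mat Q * transpose_mat P = 1\<^sub>m m"
  by (rule transpose_mult[OF PQ_carrier(2,1), unfolded QP transpose_one, symmetric])
    (rule transpose_mult[OF PQ_carrier, unfolded PQ transpose_one, symmetric])

lemma gram_ungram: assumes Z: "Z \<in> carrier_mat m m" shows "gram (ungram Z) = Z"
proof -
  note c = Z transpose_PQ PQ_carrier mult_carrier_mat[of _ m m _ m]
  have "gram (ungram Z) = (transpose_mat P * transpose_mat Q) * Z * (Q * P)"
    unfolding gram_def ungram_def by (simp only: assoc_m c)
  then show ?thesis using Z by (simp add: transposed_inverse QP)
qed

lemma ungram_gram: assumes X: "X \<in> carrier_mat m m" shows "ungram (gram X) = X"
proof -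
  note c = X transpose_PQ PQ_carrier mult_carrier_mat[of _ m m _ m]
  have "ungram (gram X) = (transpose_mat Q * transpose_mat P) * X * (P * Q)"
    unfolding gram_def ungram_def by (simp only: assoc_m c)
  then show ?thesis using X by (simp add: transposed_inverse PQ)
qed

lemma gram_inj: "X \<in> carrier_mat m m \<Longrightarrow> X' \<in> carrier_mat m m \<Longrightarrow> gram X = gram X' \<Longrightarrow> X = X'"
  using ungram_gram by metis

lemma gram_index:
  assumes X: "X \<in> carrier_mat m m" and kl: "k < m" "l < m"
  shows "gram X $$ (k, l) = (\<Sum>r<m. \<Sum>s<m. P $$ (r, k) * X $$ (r, s) * P $$ (s, l))"
proof -
  have "gram X = transpose_mat P * (X * P)"
    unfolding gram_def by (rule assoc_m) (simp_all add: X)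
  then have "gram X $$ (k, l) = (\<Sum>r<m. P $$ (r, k) * (X * P) $$ (r, l))"
    using kl X carrier_matD[OF PQ_carrier(1)] carrier_matD[OF X]
    by (simp add: scalar_prod_def lessThan_atLeast0)
  also have "\<dots> = (\<Sum>r<m. P $$ (r, k) * (\<Sum>s<m. X $$ (r, s) * P $$ (s, l)))"
    using kl carrier_matD[OF PQ_carrier(1)] carrier_matD[OF X]
    by (intro sum.cong refl) (simp add: scalar_prod_def lessThan_atLeast0)
  finally show ?thesis by (simp add: sum_distrib_left mult.assoc)
qed

lemma soC_iff_gram:
  assumes X: "X \<in> carrier_mat m m"
  shows "X \<in> soC m \<longleftrightarrow> (\<forall>k<m. \<forall>l<m. gram X $$ (l, k) = - gram X $$ (k, l))"
proof -
  have YT: "transpose_mat (gram X) = gram (transpose_mat X)"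
  proof -
    have "transpose_mat (gram X) = transpose_mat P * transpose_mat (transpose_mat P * X)"
      unfolding gram_def by (rule transpose_mult[of _ m m _ m]) (use X in \<open>simp_all add: mult_carrier_mat[of _ m m _ m]\<close>)
    also have "transpose_mat (transpose_mat P * X) = transpose_mat X * P"
      using X by (subst transpose_mult[of _ m m _ m]) auto
    also have "transpose_mat P * (transpose_mat X * P) = gram (transpose_mat X)"
      unfolding gram_def by (rule assoc_m[symmetric]) (use X in auto)
    finally show ?thesis .
  qed
  have Ym: "gram (- X) = - gram X"
  proof -
    have "transpose_mat P * - X = - (transpose_mat P * X)"
      by (rule uminus_mult_right_mat) (use X carrier_matD[OF PQ_carrier(1)] in auto)
    moreover have "- (transpose_mat P * X) * P = - (transpose_mat P * X * P)"
      by (rule uminus_mult_left_mat) (use X carrier_matD[OF PQ_carrier(1)] in auto)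
    ultimately show ?thesis by (simp only: gram_def)
  qed
  have "X \<in> soC m \<longleftrightarrow> gram (transpose_mat X) = gram (- X)"
    using X gram_inj[of "transpose_mat X" "- X"] by (auto simp: soC_def)
  also have "\<dots> \<longleftrightarrow> transpose_mat (gram X) = - gram X" by (simp only: YT Ym)
  also have "\<dots> \<longleftrightarrow> (\<forall>k<m. \<forall>l<m. gram X $$ (l, k) = - gram X $$ (k, l))"
    using carrier_matD[OF gram_carrier[OF X]] by (auto simp: mat_eq_iff)
  finally show ?thesis .
qed

text \<open>Both \<open>X\<close> and the torus element are moved to the basis: on the right \<open>torus_elem a * P = P * D a\<close>, and on
the left the transpose of this equation, in which the antisymmetry of the torus element produces
the sign.\<close>

lemma gram_ad:
  assumes X: "X \<in> carrier_mat m m" and kl: "k < m" "l < m"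
  shows "gram (torus_elem a * X - X * torus_elem a) $$ (k, l) =
    - \<i> * complex_of_real (weight a k + weight a l) * gram X $$ (k, l)"
proof -
  let ?T = "torus_elem a" and ?PT = "transpose_mat P"
  note c = X transpose_PQ PQ_carrier torus_elem_carrier D_carrier mult_carrier_mat[of _ m m _ m] gram_carrier[OF X]
  have PT: "?PT * ?T = - (D a * ?PT)"
  proof -
    have "transpose_mat (?PT * ?T) = transpose_mat ?T * P"
      by (subst transpose_mult[of _ m m _ m]) simp_all
    also have "\<dots> = - (P * D a)"
      unfolding torus_elem_transpose torus_elem_P[symmetric]
      by (rule uminus_mult_left_mat) (simp add: carrier_matD[OF torus_elem_carrier] carrier_matD[OF PQ_carrier(1)])
    finally have "?PT * ?T = transpose_mat (- (P * D a))" by (metis transpose_transpose)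
    also have "\<dots> = - (transpose_mat (D a) * ?PT)"
      unfolding transpose_uminus by (subst transpose_mult[of _ m m _ m]) simp_all
    also have "transpose_mat (D a) = D a"
      by (rule eq_matI) (auto simp: D_def mat_diag_def)
    finally show ?thesis .
  qed
  have "gram (?T * X - X * ?T) = ?PT * (?T * X) * P - ?PT * (X * ?T) * P"
    unfolding gram_def
    by (simp only: mult_minus_distrib_mat[of _ m m _ m] minus_mult_distrib_mat[of _ m m _ _ m] c)
  also have "?PT * (?T * X) * P = (?PT * ?T) * (X * P)" by (simp only: assoc_m c)
  also have "\<dots> = - (D a * ?PT * (X * P))"
    unfolding PT
    by (rule uminus_mult_left_mat) (simp add: carrier_matD[OF X] carrier_matD[OF PQ_carrier(1)])
  also have "D a * ?PT * (X * P) = D a * gram X" unfolding gram_def by (simp only: assoc_m c)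
  also have "?PT * (X * ?T) * P = ?PT * X * (?T * P)" by (simp only: assoc_m c)
  also have "\<dots> = gram X * D a" unfolding torus_elem_P gram_def by (simp only: assoc_m c)
  finally have "gram (?T * X - X * ?T) = - (D a * gram X) - gram X * D a" .
  then show ?thesis
    using kl carrier_matD[OF c(8)] unfolding D_def
    by (simp add: mat_diag_mult_left[of _ m m] mat_diag_mult_right[of _ m m] c algebra_simps)
qed

sublocale lie: lie_group_data m "soC m" torus positive_roots "Spin m" "spin_exp m" .

lemma ad_eigenspace_iff:
  "X \<in> lie.ad_eigenspace (torus_elem a) j \<longleftrightarrow>
    X \<in> soC m \<and> (\<forall>k<m. \<forall>l<m. gram X $$ (k, l) \<noteq> 0 \<longrightarrow> - (weight a k + weight a l) = of_int j)"
proof (cases "X \<in> soC m")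
  case True
  then have X: "X \<in> carrier_mat m m" by (simp add: soC_def)
  have Ys: "gram (z \<cdot>\<^sub>m X) $$ (k, l) = z * gram X $$ (k, l)" if "k < m" "l < m" for z k l
    using that X by (simp add: gram_index sum_distrib_left carrier_matD[OF X] ac_simps)
  have c: "torus_elem a * X - X * torus_elem a \<in> carrier_mat m m"
    using X by (intro minus_carrier_mat mult_carrier_mat[of _ m m _ m] torus_elem_carrier)
  have "torus_elem a * X - X * torus_elem a = (\<i> * of_int j) \<cdot>\<^sub>m X \<longleftrightarrow>
      gram (torus_elem a * X - X * torus_elem a) = gram ((\<i> * of_int j) \<cdot>\<^sub>m X)"
    using gram_inj[OF c] X by auto
  also have "\<dots> \<longleftrightarrow> (\<forall>k<m. \<forall>l<m. gram (torus_elem a * X - X * torus_elem a) $$ (k, l) = gram ((\<i> * of_int j) \<cdot>\<^sub>m X) $$ (k, l))"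
    using carrier_matD[OF gram_carrier[OF c]] carrier_matD[OF gram_carrier[of "(\<i> * of_int j) \<cdot>\<^sub>m X"]] X
    by (auto simp: mat_eq_iff)
  also have "\<dots> \<longleftrightarrow> (\<forall>k<m. \<forall>l<m. gram X $$ (k, l) \<noteq> 0 \<longrightarrow> - (weight a k + weight a l) = of_int j)"
  proof -
    have "- \<i> * complex_of_real w * y = \<i> * of_int j * y \<longleftrightarrow> (y \<noteq> 0 \<longrightarrow> - w = of_int j)" for w y
    proof -
      have "- \<i> * complex_of_real w * y = (\<i> * y) * complex_of_real (- w)"
        "\<i> * of_int j * y = (\<i> * y) * complex_of_real (of_int j)" by simp_all
      then show ?thesis by (simp only: mult_cancel_left of_real_eq_iff) auto
    qed
    then have "gram (torus_elem a * X - X * torus_elem a) $$ (k, l) = gram ((\<i> * of_int j) \<cdot>\<^sub>m X) $$ (k, l) \<longleftrightarrow>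
        (gram X $$ (k, l) \<noteq> 0 \<longrightarrow> - (weight a k + weight a l) = of_int j)" if "k < m" "l < m" for k l
      unfolding gram_ad[OF X that] Ys[OF that] by blast
    then show ?thesis by blast
  qed
  finally show ?thesis using True by (simp add: lie.ad_eigenspace_def)
qed (simp add: lie.ad_eigenspace_def)

lemma weight_int: "(\<And>j. j \<in> {1..n} \<Longrightarrow> a j \<in> \<int>) \<Longrightarrow> weight a k \<in> \<int>"
proof -
  assume "\<And>j. j \<in> {1..n} \<Longrightarrow> a j \<in> \<int>"
  moreover have "k < n \<Longrightarrow> Suc k \<in> {1..n}" "k < 2 * n \<Longrightarrow> \<not> k < n \<Longrightarrow> Suc k - n \<in> {1..n}" by auto
  ultimately show ?thesis unfolding weight_def by simp
qed

text \<open>For integral \<open>a\<close> every entry of the Gram matrix belongs to an integral eigenvalue. One inclusion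
adds up entries; for the other, \<open>X\<close> is split into the parts whose entries belong to one
eigenvalue, each of which is again antisymmetric because the eigenvalue is symmetric in the two
indices.\<close>

lemma filtration_iff:
  assumes int: "\<And>j. j \<in> {1..n} \<Longrightarrow> a j \<in> \<int>"
  shows "X \<in> lie.filtration (torus_elem a) i \<longleftrightarrow>
    X \<in> soC m \<and> (\<forall>k<m. \<forall>l<m. gram X $$ (k, l) \<noteq> 0 \<longrightarrow> - (weight a k + weight a l) \<le> of_int i)"
proof
  have Ysum: "gram (finsum (Mat m) Z J) $$ (k, l) = (\<Sum>j\<in>J. gram (Z j) $$ (k, l))"
    if "finite J" "\<And>j. j \<in> J \<Longrightarrow> Z j \<in> carrier_mat m m" "k < m" "l < m" for Z :: "int \<Rightarrow> complex mat" and J k l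
  proof -
    have fin: "finsum (Mat m) Z J \<in> carrier_mat m m"
      "\<And>r s. r < m \<Longrightarrow> s < m \<Longrightarrow> finsum (Mat m) Z J $$ (r, s) = (\<Sum>j\<in>J. Z j $$ (r, s))"
      using that by (auto intro: finsum_mat_index)
    have "gram (finsum (Mat m) Z J) $$ (k, l) =
        (\<Sum>r<m. \<Sum>s<m. \<Sum>j\<in>J. P $$ (r, k) * Z j $$ (r, s) * P $$ (s, l))"
      unfolding gram_index[OF fin(1) that(3,4)]
      by (intro sum.cong refl) (simp add: fin(2) sum_distrib_left sum_distrib_right)
    also have "\<dots> = (\<Sum>j\<in>J. \<Sum>r<m. \<Sum>s<m. P $$ (r, k) * Z j $$ (r, s) * P $$ (s, l))"
      by (simp only: sum.swap[of _ _ J])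
    also have "\<dots> = (\<Sum>j\<in>J. gram (Z j) $$ (k, l))"
      using that by (intro sum.cong refl) (simp add: gram_index)
    finally show ?thesis .
  qed
  show "X \<in> lie.filtration (torus_elem a) i \<Longrightarrow>
    X \<in> soC m \<and> (\<forall>k<m. \<forall>l<m. gram X $$ (k, l) \<noteq> 0 \<longrightarrow> - (weight a k + weight a l) \<le> of_int i)"
  proof -
    assume "X \<in> lie.filtration (torus_elem a) i"
    then obtain J Z where X: "X = finsum (Mat m) Z J" and J: "finite J" "J \<subseteq> {..i}"
      and Z: "\<And>j. j \<in> J \<Longrightarrow> Z j \<in> lie.ad_eigenspace (torus_elem a) j"
      unfolding lie.filtration_def by blast
    have Zc: "Z j \<in> carrier_mat m m" "Z j \<in> soC m" if "j \<in> J" for j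
    proof -
      show "Z j \<in> soC m" using Z[OF that] by (simp add: ad_eigenspace_iff)
      then show "Z j \<in> carrier_mat m m" by (simp add: soC_def)
    qed
    have Xc: "X \<in> carrier_mat m m" unfolding X using J Zc by (intro finsum_mat_index(1))
    have YX: "gram X $$ (k, l) = (\<Sum>j\<in>J. gram (Z j) $$ (k, l))" if "k < m" "l < m" for k l
      unfolding X using that J Zc by (intro Ysum)
    have "X \<in> soC m"
      unfolding soC_iff_gram[OF Xc]
    proof (intro allI impI)
      fix k l assume kl: "k < m" "l < m"
      have "gram (Z j) $$ (l, k) = - gram (Z j) $$ (k, l)" if "j \<in> J" for j
        using soC_iff_gram[OF Zc(1)[OF that]] Zc(2)[OF that] kl by blast
      then show "gram X $$ (l, k) = - gram X $$ (k, l)" using kl by (simp add: YX sum_negf)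
    qed
    moreover have "- (weight a k + weight a l) \<le> of_int i" if kl: "k < m" "l < m" and nz: "gram X $$ (k, l) \<noteq> 0" for k l
    proof -
      obtain j where j: "j \<in> J" "gram (Z j) $$ (k, l) \<noteq> 0"
        using nz unfolding YX[OF kl] by (rule sum.not_neutral_contains_not_neutral)
      then have "- (weight a k + weight a l) = of_int j" using Z[OF j(1)] kl by (simp add: ad_eigenspace_iff)
      then show ?thesis using J(2) j(1) by auto
    qed
    ultimately show ?thesis by blast
  qed
  assume X: "X \<in> soC m \<and> (\<forall>k<m. \<forall>l<m. gram X $$ (k, l) \<noteq> 0 \<longrightarrow> - (weight a k + weight a l) \<le> of_int i)"
  then have Xc: "X \<in> carrier_mat m m" by (simp add: soC_def)
  \<comment> \<open>The eigenvalue at the entry (k, l), as an integer.\<close>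
  define f where "f k l = \<lfloor>- (weight a k + weight a l)\<rfloor>" for k l
  have f: "of_int (f k l) = - (weight a k + weight a l)" for k l
  proof -
    have "- (weight a k + weight a l) \<in> \<int>" using weight_int[of a, OF int] by auto
    then show ?thesis unfolding f_def by (metis Ints_cases floor_of_int)
  qed
  have f_sym: "f k l = f l k" for k l by (simp add: f_def add.commute)
  define J where "J = (\<lambda>(k, l). f k l) ` ({..<m} \<times> {..<m}) \<inter> {..i}"
  define W where "W j = mat m m (\<lambda>(k, l). if f k l = j then gram X $$ (k, l) else 0)" for j
  define Z where "Z j = ungram (W j)" for j
  have W: "W j \<in> carrier_mat m m" for j by (simp add: W_def)
  have Zc: "Z j \<in> carrier_mat m m" and YZ: "gram (Z j) = W j" for j
    using W by (simp_all add: Z_def gram_ungram)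
  have J: "finite J" "J \<subseteq> {..i}" by (auto simp: J_def)
  have Z: "Z j \<in> lie.ad_eigenspace (torus_elem a) j" for j
    unfolding ad_eigenspace_iff soC_iff_gram[OF Zc] YZ
  proof (intro conjI allI impI)
    fix k l assume kl: "k < m" "l < m"
    then have "gram X $$ (l, k) = - gram X $$ (k, l)" using X soC_iff_gram[OF Xc] by blast
    then show "W j $$ (l, k) = - W j $$ (k, l)"
      using kl by (simp add: W_def f_sym[of l k])
    assume "W j $$ (k, l) \<noteq> 0"
    then have "f k l = j" using kl by (auto simp: W_def split: if_splits)
    then show "- (weight a k + weight a l) = of_int j" using f[of k l] by simp
  qed
  have "gram (finsum (Mat m) Z J) = gram X"
  proof (rule eq_matI)
    fix k l assume "k < dim_row (gram X)" "l < dim_col (gram X)"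
    then have kl: "k < m" "l < m" using carrier_matD[OF gram_carrier[OF Xc]] by auto
    have "gram (finsum (Mat m) Z J) $$ (k, l) = (\<Sum>j\<in>J. if f k l = j then gram X $$ (k, l) else 0)"
      unfolding Ysum[OF J(1) Zc kl] YZ using kl by (intro sum.cong refl) (simp add: W_def)
    also have "\<dots> = (if f k l \<in> J then gram X $$ (k, l) else 0)" using J(1) by simp
    also have "\<dots> = gram X $$ (k, l)"
    proof (cases "gram X $$ (k, l) = 0")
      case False
      then have "of_int (f k l) \<le> (of_int i :: real)" using X kl f[of k l] by auto
      then have "f k l \<in> J" using kl by (auto simp: J_def)
      then show ?thesis by simp
    qed simp
    finally show "gram (finsum (Mat m) Z J) $$ (k, l) = gram X $$ (k, l)" .
  qed (use carrier_matD[OF gram_carrier[OF Xc]] carrier_matD[OF gram_carrier[OF finsum_mat_index(1)[OF J(1) Zc]]] in auto)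
  then have "X = finsum (Mat m) Z J"
    by (intro gram_inj[OF Xc finsum_mat_index(1)[OF J(1) Zc]]) simp
  then show "X \<in> lie.filtration (torus_elem a) i"
    unfolding lie.filtration_def using J Z by blast
qed

section \<open>Dominant elements and their order\<close>

text \<open>The coefficients with respect to \<open>E\<^sub>1, \<dots>, E\<^sub>n\<close> of \<open>\<Sum> c\<^sub>i H\<^sub>i\<close>, as \<open>H\<^sub>i = E\<^sub>1 + \<dots> + E\<^sub>i\<close>.\<close>

definition tail :: "(nat \<Rightarrow> real) \<Rightarrow> nat \<Rightarrow> real" where
  "tail c k = (\<Sum>i\<in>{k..n}. c i)"

text \<open>The element \<open>\<Sum> c\<^sub>i H\<^sub>i\<close>. It is defined without the \<open>H\<^sub>i\<close>, which are then identified as the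
elements whose coefficients are indicators of single indices (\<open>H_eq\<close>).\<close>

definition hsum :: "(nat \<Rightarrow> real) \<Rightarrow> complex mat" where
  "hsum c = torus_elem (tail c)"

definition nonneg :: "(nat \<Rightarrow> real) \<Rightarrow> bool" where
  "nonneg c \<longleftrightarrow> (\<forall>i\<in>{1..n}. 0 \<le> c i)"

lemma tail_step: "k \<le> n \<Longrightarrow> tail c k = c k + tail c (Suc k)"
  by (simp add: tail_def sum.atLeast_Suc_atMost)

lemma tail_cong: "(\<And>i. i \<in> {1..n} \<Longrightarrow> c i = c' i) \<Longrightarrow> 1 \<le> k \<Longrightarrow> tail c k = tail c' k"
  unfolding tail_def by (rule sum.cong) auto

lemma tail_nonneg: "nonneg c \<Longrightarrow> 1 \<le> k \<Longrightarrow> 0 \<le> tail c k"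
  unfolding tail_def nonneg_def by (rule sum_nonneg) auto

lemma tail_mono: "nonneg c \<Longrightarrow> 1 \<le> j \<Longrightarrow> j \<le> k \<Longrightarrow> tail c k \<le> tail c j"
  unfolding tail_def nonneg_def by (rule sum_mono2) auto

lemma tail_diff: "tail (\<lambda>i. c i - c' i) k = tail c k - tail c' k"
  by (simp add: tail_def sum_subtractf)

lemma torus_elem_hsum: "\<exists>c. torus_elem a = hsum c"
proof
  \<comment> \<open>Differences of consecutive coefficients; the last one has no successor.\<close>
  let ?c = "\<lambda>i. a i - (if i < n then a (Suc i) else 0)"
  have "k \<le> n \<Longrightarrow> tail ?c k = a k" for k
  proof (induction rule: inc_induct)
    case base
    then show ?case by (simp add: tail_def)
  next
    case (step k)
    then show ?case by (simp add: tail_step)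
  qed
  then show "torus_elem a = hsum ?c" unfolding hsum_def by (intro torus_elem_cong) simp
qed

lemma torus_hsum: "torus = range hsum"
  unfolding torus_def using torus_elem_hsum by (auto simp: hsum_def)

lemma hsum_eq_iff: "hsum c = hsum c' \<longleftrightarrow> (\<forall>i\<in>{1..n}. c i = c' i)"
proof
  assume eq: "hsum c = hsum c'"
  show "\<forall>i\<in>{1..n}. c i = c' i"
  proof
    fix i assume i: "i \<in> {1..n}"
    have "tail c i = tail c' i" using torus_elem_inj[OF eq[unfolded hsum_def] i] .
    moreover have "tail c (Suc i) = tail c' (Suc i)"
    proof (cases "i < n")
      case True
      then show ?thesis using torus_elem_inj[OF eq[unfolded hsum_def], of "Suc i"] by simp
    qed (simp add: tail_def)
    ultimately show "c i = c' i" using tail_step[of i c] tail_step[of i c'] i by simp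
  qed
next
  assume "\<forall>i\<in>{1..n}. c i = c' i"
  then show "hsum c = hsum c'" unfolding hsum_def by (intro torus_elem_cong tail_cong) auto
qed

lemma hsum_diff: "hsum c - hsum c' = hsum (\<lambda>i. c i - c' i)"
  unfolding hsum_def torus_elem_diff by (intro torus_elem_cong) (simp add: tail_diff)

lemma simple_root_hsum: "i \<in> {1..n} \<Longrightarrow> simple_root i (hsum c) = \<i> * complex_of_real (c i)"
proof -
  assume i: "i \<in> {1..n}"
  show ?thesis
  proof (cases "i < n")
    case True
    then show ?thesis using i
      by (simp add: simple_root_def hsum_def L_torus_elem tail_step[of i c] algebra_simps)
  next
    case False
    then show ?thesis using i by (simp add: simple_root_def hsum_def L_torus_elem tail_def)
  qed
qed

lemma H_eq:
  assumes j: "j \<in> {1..n}"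
  shows "H j = hsum (\<lambda>i. if i = j then 1 else 0)"
  unfolding H_def
proof (rule the_equality)
  show "hsum (\<lambda>i. if i = j then 1 else 0) \<in> torus \<and>
      (\<forall>i\<in>{1..n}. simple_root i (hsum (\<lambda>i. if i = j then 1 else 0)) = (if i = j then \<i> else 0))"
    using simple_root_hsum by (auto simp: torus_hsum)
next
  fix h assume h: "h \<in> torus \<and> (\<forall>i\<in>{1..n}. simple_root i h = (if i = j then \<i> else 0))"
  then obtain c where c: "h = hsum c" by (auto simp: torus_hsum)
  have "c i = (if i = j then 1 else 0)" if "i \<in> {1..n}" for i
    using h simple_root_hsum[OF that, of c] that by (auto simp: c split: if_splits)
  then show "h = hsum (\<lambda>i. if i = j then 1 else 0)" unfolding c hsum_eq_iff by blast
qed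

lemma xi_eq:
  assumes I: "I \<subseteq> {1..n}"
  shows "xi I = hsum (\<lambda>i. if i \<in> I then 1 else 0)"
  unfolding hsum_def
proof (rule torus_elem_eqI)
  have fin: "finite I" using I finite_subset by blast
  have H: "H i \<in> carrier_mat m m" if "i \<in> I" for i
    using that I H_eq[of i] by (auto simp: hsum_def)
  note xi = xi_def[unfolded m_def[symmetric]]
  show "xi I \<in> carrier_mat m m" unfolding xi by (rule finsum_mat_index(1)[OF fin H])
  fix r s assume rs: "r < m" "s < m"
  have "xi I $$ (r, s) = (\<Sum>i\<in>I. H i $$ (r, s))"
    unfolding xi by (rule finsum_mat_index(2)[OF fin H rs])
  also have "\<dots> = (\<Sum>i\<in>I. \<Sum>j\<in>{1..n}. complex_of_real (tail (\<lambda>k. if k = i then 1 else 0) j) * rot j $$ (r, s))"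
  proof (rule sum.cong[OF refl])
    fix i assume "i \<in> I"
    then have "i \<in> {1..n}" using I by blast
    then show "H i $$ (r, s) = (\<Sum>j\<in>{1..n}. complex_of_real (tail (\<lambda>k. if k = i then 1 else 0) j) * rot j $$ (r, s))"
      by (simp only: H_eq hsum_def torus_elem_index[OF rs])
  qed
  also have "\<dots> = (\<Sum>j\<in>{1..n}. \<Sum>i\<in>I. complex_of_real (tail (\<lambda>k. if k = i then 1 else 0) j) * rot j $$ (r, s))"
    by (rule sum.swap)
  also have "\<dots> = (\<Sum>j\<in>{1..n}. complex_of_real (tail (\<lambda>i. if i \<in> I then 1 else 0) j) * rot j $$ (r, s))"
  proof (rule sum.cong[OF refl])
    fix j
    have "tail (\<lambda>i. if i \<in> I then 1 else 0) j = (\<Sum>k\<in>{j..n}. \<Sum>i\<in>I. if k = i then 1 else 0)"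
      unfolding tail_def using fin by (intro sum.cong refl) simp
    also have "\<dots> = (\<Sum>i\<in>I. tail (\<lambda>k. if k = i then 1 else 0) j)" unfolding tail_def by (rule sum.swap)
    finally show "(\<Sum>i\<in>I. complex_of_real (tail (\<lambda>k. if k = i then 1 else 0) j) * rot j $$ (r, s)) =
        complex_of_real (tail (\<lambda>i. if i \<in> I then 1 else 0) j) * rot j $$ (r, s)"
      by (simp add: sum_distrib_right)
  qed
  finally show "xi I $$ (r, s) =
    (\<Sum>j\<in>{1..n}. complex_of_real (tail (\<lambda>i. if i \<in> I then 1 else 0) j) * rot j $$ (r, s))" .
qed

lemma xi_plus_eq:
  assumes I: "I \<subseteq> {1..n}" and j: "j \<in> {1..n}"
  shows "xi I + 2 \<cdot>\<^sub>m H j = hsum (\<lambda>i. (if i \<in> I then 1 else 0) + 2 * (if i = j then 1 else 0))"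
proof -
  have "2 \<cdot>\<^sub>m H j = complex_of_real 2 \<cdot>\<^sub>m torus_elem (tail (\<lambda>i. if i = j then 1 else 0))"
    by (simp add: H_eq[OF j] hsum_def)
  then have "xi I + 2 \<cdot>\<^sub>m H j = torus_elem (\<lambda>k. tail (\<lambda>i. if i \<in> I then 1 else 0) k + 2 * tail (\<lambda>i. if i = j then 1 else 0) k)"
    by (simp only: torus_elem_smult torus_elem_add xi_eq[OF I] hsum_def)
  also have "\<dots> = hsum (\<lambda>i. (if i \<in> I then 1 else 0) + 2 * (if i = j then 1 else 0))"
    unfolding hsum_def by (intro torus_elem_cong) (simp only: tail_def sum.distrib sum_distrib_left)
  finally show ?thesis .
qed

lemma dominant_hsum_iff: "(\<forall>\<alpha>\<in>positive_roots. 0 \<le> \<alpha> (hsum c) / \<i>) \<longleftrightarrow> nonneg c"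
proof
  assume pos: "\<forall>\<alpha>\<in>positive_roots. 0 \<le> \<alpha> (hsum c) / \<i>"
  show "nonneg c"
    unfolding nonneg_def
  proof
    fix i assume i: "i \<in> {1..n}"
    have "simple_root i \<in> positive_roots"
    proof (cases "i < n")
      case True
      then have eq: "simple_root i = (\<lambda>\<xi>. L i \<xi> - L (Suc i) \<xi>)"
        by (intro ext) (simp add: simple_root_def)
      have "1 \<le> i \<and> i < Suc i \<and> Suc i \<le> n" using i True by simp
      then show ?thesis unfolding positive_roots_def eq by blast
    next
      case False
      then have "simple_root i = L i" using i by (intro ext) (simp add: simple_root_def)
      then show ?thesis unfolding positive_roots_def using i by auto
    qed
    then have "0 \<le> simple_root i (hsum c) / \<i>" using pos by blast
    then show "0 \<le> c i" by (simp add: simple_root_hsum[OF i] less_eq_complex_def)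
  qed
next
  assume c: "nonneg c"
  have L: "L i (hsum c) / \<i> = complex_of_real (tail c i)" if "1 \<le> i" "i \<le> n" for i
    using that by (simp add: hsum_def L_torus_elem)
  have "0 \<le> \<alpha> (hsum c) / \<i>" if "\<alpha> \<in> positive_roots" for \<alpha>
  proof -
    consider i j where "1 \<le> i" "i < j" "j \<le> n" "\<alpha> = (\<lambda>\<xi>. L i \<xi> + L j \<xi>)"
      | i j where "1 \<le> i" "i < j" "j \<le> n" "\<alpha> = (\<lambda>\<xi>. L i \<xi> - L j \<xi>)"
      | i where "1 \<le> i" "i \<le> n" "\<alpha> = L i"
      using \<open>\<alpha> \<in> positive_roots\<close> unfolding positive_roots_def by blast
    then show ?thesis
    proof cases
      case 1
      then have ij: "1 \<le> j" "i \<le> n" by simp_all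
      have "\<alpha> (hsum c) / \<i> = complex_of_real (tail c i + tail c j)"
        by (simp only: 1(4) add_divide_distrib L[OF 1(1) ij(2)] L[OF ij(1) 1(3)] of_real_add)
      moreover have "0 \<le> tail c i + tail c j" using 1 tail_nonneg[OF c] by (intro add_nonneg_nonneg) auto
      ultimately show ?thesis by (simp add: less_eq_complex_def)
    next
      case 2
      then have ij: "1 \<le> j" "i \<le> n" by simp_all
      have "\<alpha> (hsum c) / \<i> = complex_of_real (tail c i - tail c j)"
        by (simp only: 2(4) diff_divide_distrib L[OF 2(1) ij(2)] L[OF ij(1) 2(3)] of_real_diff)
      moreover have "0 \<le> tail c i - tail c j" using 2 tail_mono[OF c, of i j] by simp
      ultimately show ?thesis by (simp add: less_eq_complex_def)
    next
      case 3
      have "\<alpha> (hsum c) / \<i> = complex_of_real (tail c i)" by (simp only: 3(3) L[OF 3(1,2)])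
      moreover have "0 \<le> tail c i" using 3 tail_nonneg[OF c] by simp
      ultimately show ?thesis by (simp add: less_eq_complex_def)
    qed
  qed
  then show "\<forall>\<alpha>\<in>positive_roots. 0 \<le> \<alpha> (hsum c) / \<i>" by blast
qed

text \<open>Exchanging the order of summation, the sum of all tails of \<open>c\<close> is \<open>\<Sum> i c\<^sub>i\<close>.\<close>

lemma even_lattice_tail_iff:
  "even_lattice (tail c) \<longleftrightarrow>
    (\<exists>k :: nat \<Rightarrow> int. (\<forall>i\<in>{1..n}. c i = of_int (k i)) \<and> even (\<Sum>i\<in>{1..n}. int i * k i))"
proof -
  have weighted: "(\<Sum>j\<in>{1..n}. \<Sum>i\<in>{j..n}. k i) = (\<Sum>i\<in>{1..n}. int i * k i)" for k :: "nat \<Rightarrow> int"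
  proof -
    have "(\<Sum>j\<in>{1..n}. \<Sum>i\<in>{j..n}. k i) = (\<Sum>j\<in>{1..n}. \<Sum>i\<in>{1..n}. if j \<le> i then k i else 0)"
    proof (rule sum.cong[OF refl])
      fix j assume "j \<in> {1..n}"
      then show "(\<Sum>i\<in>{j..n}. k i) = (\<Sum>i\<in>{1..n}. if j \<le> i then k i else 0)"
        by (intro sum.mono_neutral_cong_left) auto
    qed
    also have "\<dots> = (\<Sum>i\<in>{1..n}. \<Sum>j\<in>{1..n}. if j \<le> i then k i else 0)" by (rule sum.swap)
    also have "\<dots> = (\<Sum>i\<in>{1..n}. \<Sum>j\<in>{1..i}. k i)"
    proof (rule sum.cong[OF refl])
      fix i assume "i \<in> {1..n}"
      then show "(\<Sum>j\<in>{1..n}. if j \<le> i then k i else 0) = (\<Sum>j\<in>{1..i}. k i)"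
        by (intro sum.mono_neutral_cong_right) auto
    qed
    finally show ?thesis by simp
  qed
  show ?thesis
  proof
    assume "even_lattice (tail c)"
    then obtain h :: "nat \<Rightarrow> int" where h: "\<forall>j\<in>{1..n}. tail c j = of_int (h j)" "even (\<Sum>j\<in>{1..n}. h j)"
      unfolding even_lattice_def by blast
    \<comment> \<open>The tails of a sequence determine it by differences.\<close>
    define k where "k i = h i - (if i < n then h (Suc i) else 0)" for i
    have k: "c i = of_int (k i)" if "i \<in> {1..n}" for i
    proof (cases "i < n")
      case True
      then show ?thesis using h(1) that tail_step[of i c] by (simp add: k_def)
    next
      case False
      then have "i = n" using that by simp
      then show ?thesis using h(1)[rule_format, OF that] by (simp add: k_def tail_def)
    qed
    have "(\<Sum>i\<in>{j..n}. k i) = h j" if "j \<in> {1..n}" for j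
    proof -
      have "of_int (\<Sum>i\<in>{j..n}. k i) = (\<Sum>i\<in>{j..n}. c i)" using that by (simp add: k)
      also have "\<dots> = of_int (h j)" using h(1) that by (auto simp: tail_def)
      finally show ?thesis by (simp only: of_int_eq_iff)
    qed
    then have "even (\<Sum>j\<in>{1..n}. \<Sum>i\<in>{j..n}. k i)" using h(2) by simp
    then show "\<exists>k :: nat \<Rightarrow> int. (\<forall>i\<in>{1..n}. c i = of_int (k i)) \<and> even (\<Sum>i\<in>{1..n}. int i * k i)"
      using k unfolding weighted by blast
  next
    assume "\<exists>k :: nat \<Rightarrow> int. (\<forall>i\<in>{1..n}. c i = of_int (k i)) \<and> even (\<Sum>i\<in>{1..n}. int i * k i)"
    then obtain k :: "nat \<Rightarrow> int" where k: "\<forall>i\<in>{1..n}. c i = of_int (k i)" "even (\<Sum>i\<in>{1..n}. int i * k i)" by blast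
    have "tail c j = of_int (\<Sum>i\<in>{j..n}. k i)" if "j \<in> {1..n}" for j
      using k(1) that by (simp add: tail_def)
    then show "even_lattice (tail c)"
      unfolding even_lattice_def
      using k(2)[unfolded weighted[symmetric]] by (intro exI[of _ "\<lambda>j. \<Sum>i\<in>{j..n}. k i"]) simp
  qed
qed

lemma hsum_integral_iff: "hsum c \<in> lie.integral \<longleftrightarrow> even_lattice (tail c)"
proof -
  have "complex_of_real (2 * pi) \<cdot>\<^sub>m hsum c = torus_elem (\<lambda>j. 2 * pi * tail c j)"
    unfolding hsum_def torus_elem_smult ..
  also have "\<dots> = so_elem (\<lambda>j. 2 * pi * tail c j)" by (rule torus_elem_so_elem)
  finally have "complex_of_real (2 * pi) \<cdot>\<^sub>m hsum c = so_elem (\<lambda>j. 2 * pi * tail c j)" .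
  then show ?thesis
    unfolding lie.integral_def by (simp add: torus_hsum spin_exp_so_elem_eq_one_iff)
qed

lemma hsum_integral2_iff: "hsum c \<in> lie.integral2 \<longleftrightarrow> even_lattice (tail (\<lambda>i. c i / 2))"
proof -
  have "complex_of_real pi \<cdot>\<^sub>m hsum c = torus_elem (\<lambda>j. 2 * pi * tail (\<lambda>i. c i / 2) j)"
    unfolding hsum_def torus_elem_smult
    by (rule torus_elem_cong) (simp add: tail_def sum_divide_distrib[symmetric])
  also have "\<dots> = so_elem (\<lambda>j. 2 * pi * tail (\<lambda>i. c i / 2) j)" by (rule torus_elem_so_elem)
  finally have "complex_of_real pi \<cdot>\<^sub>m hsum c = so_elem (\<lambda>j. 2 * pi * tail (\<lambda>i. c i / 2) j)" .
  then show ?thesis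
    unfolding lie.integral2_def by (simp add: torus_hsum spin_exp_so_elem_eq_one_iff)
qed

text \<open>The zero weight is the empty tail, starting at \<open>n + 1\<close>, so it needs no case of its own.\<close>

lemma weight_tail_cases:
  obtains i where "1 \<le> i" "\<And>c. weight (tail c) k = tail c i"
  | i where "1 \<le> i" "\<And>c. weight (tail c) k = - tail c i"
proof -
  consider "k < n" | "n \<le> k" "k < 2 * n" | "2 * n \<le> k" by linarith
  then show ?thesis
  proof cases
    case 1
    then show ?thesis using that(1)[of "Suc k"] by (simp add: weight_def)
  next
    case 2
    then show ?thesis using that(2)[of "Suc k - n"] by (simp add: weight_def)
  next
    case 3
    then show ?thesis using that(1)[of "Suc n"] by (simp add: weight_def tail_def)
  qed
qed

text \<open>Up to sign, a sum of two weights is zero, a positive root or twice a positive root, and positive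
  roots are nonnegative on the dominant chamber.\<close>

lemma weight_sum_sign:
  "(\<forall>c. nonneg c \<longrightarrow> 0 \<le> weight (tail c) k + weight (tail c) l) \<or>
    (\<forall>c. nonneg c \<longrightarrow> weight (tail c) k + weight (tail c) l \<le> 0)"
proof -
  have diff: "(\<forall>c. nonneg c \<longrightarrow> 0 \<le> tail c i - tail c j) \<or> (\<forall>c. nonneg c \<longrightarrow> tail c i - tail c j \<le> 0)"
    if "1 \<le> i" "1 \<le> j" for i j
    using tail_mono[of _ i j] tail_mono[of _ j i] that by (cases "i \<le> j") auto
  show ?thesis
  proof (cases k rule: weight_tail_cases)
    case (1 i)
    show ?thesis
    proof (cases l rule: weight_tail_cases)
      case l: (1 j)
      have "0 \<le> tail c i + tail c j" if "nonneg c" for c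
        using tail_nonneg[OF that 1(1)] tail_nonneg[OF that l(1)] by simp
      then show ?thesis by (simp add: 1(2) l(2))
    next
      case (2 j)
      then show ?thesis using diff[OF 1(1) 2(1)] by (simp add: 1(2))
    qed
  next
    case (2 i)
    show ?thesis
    proof (cases l rule: weight_tail_cases)
      case (1 j)
      then show ?thesis using diff[OF 1(1) 2(1)] by (simp add: 2(2))
    next
      case l: (2 j)
      have "- tail c i - tail c j \<le> 0" if "nonneg c" for c
        using tail_nonneg[OF that 2(1)] tail_nonneg[OF that l(1)] by simp
      then show ?thesis by (simp add: 2(2) l(2))
    qed
  qed
qed

lemma weight_tail_diff:
  "weight (tail (\<lambda>i. c i - c' i)) k = weight (tail c) k - weight (tail c') k"
  by (simp add: weight_def tail_diff)

text \<open>If \<open>c' \<le> c\<close>, compare the eigenvalues of \<open>hsum c\<close> and \<open>hsum c'\<close> on an entry, both minus a sum of two weights.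
If the sum is nonnegative on the chamber, the eigenvalue of \<open>hsum c'\<close> is at most \<open>0\<close>, so the entry
is allowed in every step of the filtration that occurs. If it is nonpositive, then it is so at the dominant
element \<open>hsum (c - c')\<close>, and the eigenvalue does not increase from \<open>c\<close> to \<open>c'\<close>. Conversely, a root vector for the
\<open>i\<close>-th simple root has eigenvalue \<open>c i\<close>, respectively \<open>c' i\<close>.\<close>

lemma can_le_iff:
  assumes c: "nonneg c" "\<And>i. i \<in> {1..n} \<Longrightarrow> c i \<in> \<int>" and c': "nonneg c'" "\<And>i. i \<in> {1..n} \<Longrightarrow> c' i \<in> \<int>"
  shows "lie.can_le (hsum c) (hsum c') \<longleftrightarrow> (\<forall>i\<in>{1..n}. c' i \<le> c i)"
proof -
  have tail_int: "tail d j \<in> \<int>" if "\<And>i. i \<in> {1..n} \<Longrightarrow> d i \<in> \<int>" "j \<in> {1..n}" for d j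
    unfolding tail_def using that by (intro Ints_sum) auto
  have filtration_hsum: "X \<in> lie.filtration (hsum d) i \<longleftrightarrow> X \<in> soC m \<and>
      (\<forall>k<m. \<forall>l<m. gram X $$ (k, l) \<noteq> 0 \<longrightarrow> - (weight (tail d) k + weight (tail d) l) \<le> of_int i)"
    if "\<And>i. i \<in> {1..n} \<Longrightarrow> d i \<in> \<int>" for d X i
    unfolding hsum_def using that by (intro filtration_iff tail_int)
  have filt: "X \<in> lie.filtration (hsum c) i \<longleftrightarrow> X \<in> soC m \<and>
      (\<forall>k<m. \<forall>l<m. gram X $$ (k, l) \<noteq> 0 \<longrightarrow> - (weight (tail c) k + weight (tail c) l) \<le> of_int i)" for X i
    using c(2) by (rule filtration_hsum)
  have filt': "X \<in> lie.filtration (hsum c') i \<longleftrightarrow> X \<in> soC m \<and>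
      (\<forall>k<m. \<forall>l<m. gram X $$ (k, l) \<noteq> 0 \<longrightarrow> - (weight (tail c') k + weight (tail c') l) \<le> of_int i)" for X i
    using c'(2) by (rule filtration_hsum)
  show ?thesis
  proof
    assume le: "\<forall>i\<in>{1..n}. c' i \<le> c i"
    show "lie.can_le (hsum c) (hsum c')"
      unfolding lie.can_le_def
    proof (intro allI impI subsetI)
      fix i :: int and X assume i: "0 \<le> i" and X: "X \<in> lie.filtration (hsum c) i"
      show "X \<in> lie.filtration (hsum c') i"
        unfolding filt'
      proof (intro conjI allI impI)
        show "X \<in> soC m" using X unfolding filt by blast
        fix k l assume kl: "k < m" "l < m" and "gram X $$ (k, l) \<noteq> 0"
        then have *: "- (weight (tail c) k + weight (tail c) l) \<le> of_int i"
          using X unfolding filt by blast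
        have diff: "nonneg (\<lambda>i. c i - c' i)" using le by (simp add: nonneg_def)
        show "- (weight (tail c') k + weight (tail c') l) \<le> of_int i"
          using weight_sum_sign[of k l]
        proof
          assume "\<forall>c. nonneg c \<longrightarrow> 0 \<le> weight (tail c) k + weight (tail c) l"
          then have "0 \<le> weight (tail c') k + weight (tail c') l" using c'(1) by blast
          moreover have "(0 :: real) \<le> of_int i" using i by simp
          ultimately show ?thesis by linarith
        next
          assume "\<forall>c. nonneg c \<longrightarrow> weight (tail c) k + weight (tail c) l \<le> 0"
          then have "weight (tail (\<lambda>i. c i - c' i)) k + weight (tail (\<lambda>i. c i - c' i)) l \<le> 0"
            using diff by blast
          then show ?thesis using * unfolding weight_tail_diff by linarith
        qed
      qed
    qed
  next
    assume le: "lie.can_le (hsum c) (hsum c')"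
    show "\<forall>i\<in>{1..n}. c' i \<le> c i"
    proof
      fix i assume i: "i \<in> {1..n}"
      \<comment> \<open>The vectors numbered k and l are e (n + i) and e (i + 1), the latter replaced by e (2 n + 1) for i = n. Their entry spans the root space of the i-th simple root.\<close>
      define k where "k = n + i - 1"
      define l where "l = (if i < n then i else 2 * n)"
      have kl: "k < m" "l < m" "k \<noteq> l" using i by (auto simp: k_def l_def m_def)
      have w: "weight (tail d) k = - tail d i" "weight (tail d) l = tail d (Suc i)" for d
        using i by (auto simp: weight_def k_def l_def tail_def)
      have wd: "- (weight (tail d) k + weight (tail d) l) = d i" for d
        using tail_step[of i d] i by (simp add: w)
      have wd': "- (weight (tail d) l + weight (tail d) k) = d i" for d
        using wd[of d] by (simp add: add.commute)
      define Z :: "complex mat" where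
        "Z = mat m m (\<lambda>p. if p = (k, l) then 1 else if p = (l, k) then - 1 else 0)"
      have Z: "Z \<in> carrier_mat m m" by (simp add: Z_def)
      define X where "X = ungram Z"
      have X: "X \<in> carrier_mat m m" and YX: "gram X = Z" using Z by (simp_all add: X_def gram_ungram)
      have soX: "X \<in> soC m"
        unfolding soC_iff_gram[OF X] YX using kl by (auto simp: Z_def)
      obtain z where z: "c i = of_int z" using c(2)[OF i] Ints_cases by blast
      have "0 \<le> z" using c(1)[unfolded nonneg_def, rule_format, OF i] z by simp
      have "X \<in> lie.filtration (hsum c) z"
        unfolding filt
      proof (intro conjI allI impI)
        fix p q assume "p < m" "q < m" "gram X $$ (p, q) \<noteq> 0"
        then have "p = k \<and> q = l \<or> p = l \<and> q = k" by (auto simp: YX Z_def split: if_splits)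
        then show "- (weight (tail c) p + weight (tail c) q) \<le> of_int z"
          using wd[of c] wd'[of c] z by auto
      qed (rule soX)
      then have "X \<in> lie.filtration (hsum c') z" using le \<open>0 \<le> z\<close> unfolding lie.can_le_def by blast
      moreover have "gram X $$ (k, l) \<noteq> 0" using kl by (simp add: YX Z_def)
      ultimately have "- (weight (tail c') k + weight (tail c') l) \<le> of_int z"
        unfolding filt' using kl by blast
      then show "c' i \<le> c i" by (simp only: wd z)
    qed
  qed
qed

section \<open>Maximal elements\<close>

text \<open>The dominant integral elements have natural numbers as coefficients with respect to the \<open>H\<^sub>i\<close>.\<close>

definition nsum :: "(nat \<Rightarrow> nat) \<Rightarrow> complex mat" where
  "nsum k = hsum (\<lambda>i. real (k i))"

lemma nsum_eq_iff: "nsum k = nsum k' \<longleftrightarrow> (\<forall>i\<in>{1..n}. k i = k' i)"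
  by (simp add: nsum_def hsum_eq_iff)

lemma dominant_integral_eq:
  "lie.dominant_integral = {nsum k | k. even (\<Sum>i\<in>{1..n}. i * k i)}"
proof (intro equalityI subsetI)
  fix \<xi> assume \<xi>: "\<xi> \<in> lie.dominant_integral"
  then have "\<xi> \<in> torus" unfolding lie.dominant_integral_def lie.integral_def by blast
  then obtain c where c: "\<xi> = hsum c" unfolding torus_hsum by blast
  have "nonneg c" "even_lattice (tail c)"
    unfolding dominant_hsum_iff[symmetric] hsum_integral_iff[symmetric]
    using \<xi> unfolding c lie.dominant_integral_def by blast+
  then obtain h :: "nat \<Rightarrow> int" where h: "\<forall>i\<in>{1..n}. c i = of_int (h i)" "even (\<Sum>i\<in>{1..n}. int i * h i)"
    unfolding even_lattice_tail_iff by blast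
  have h0: "0 \<le> h i" if "i \<in> {1..n}" for i
    using \<open>nonneg c\<close>[unfolded nonneg_def, rule_format, OF that] h(1)[rule_format, OF that] by simp
  define k where "k i = nat (h i)" for i
  have k: "int (k i) = h i" if "i \<in> {1..n}" for i using h0[OF that] by (simp add: k_def)
  have "\<xi> = nsum k"
    unfolding c nsum_def hsum_eq_iff
  proof
    fix i assume i: "i \<in> {1..n}"
    have "c i = of_int (int (k i))" using h(1)[rule_format, OF i] k[OF i] by simp
    then show "c i = real (k i)" by simp
  qed
  moreover have "int (\<Sum>i\<in>{1..n}. i * k i) = (\<Sum>i\<in>{1..n}. int i * h i)"
    unfolding of_nat_sum by (intro sum.cong refl) (simp only: of_nat_mult k)
  then have "even (\<Sum>i\<in>{1..n}. i * k i)" using h(2) by (metis even_of_nat)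
  ultimately show "\<xi> \<in> {nsum k | k. even (\<Sum>i\<in>{1..n}. i * k i)}" by blast
next
  fix \<xi> assume "\<xi> \<in> {nsum k | k. even (\<Sum>i\<in>{1..n}. i * k i)}"
  then obtain k where k: "\<xi> = nsum k" "even (\<Sum>i\<in>{1..n}. i * k i)" by blast
  have "even (int (\<Sum>i\<in>{1..n}. i * k i))" using k(2) by (simp only: even_of_nat)
  then have "even (\<Sum>i\<in>{1..n}. int i * int (k i))" by (simp only: of_nat_sum of_nat_mult)
  then have "even_lattice (tail (\<lambda>i. real (k i)))"
    unfolding even_lattice_tail_iff by (intro exI[of _ "\<lambda>i. int (k i)"]) simp
  moreover have "nonneg (\<lambda>i. real (k i))" by (simp add: nonneg_def)
  ultimately show "\<xi> \<in> lie.dominant_integral"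
    unfolding dominant_hsum_iff[symmetric] hsum_integral_iff[symmetric]
    by (simp only: k(1) nsum_def lie.dominant_integral_def mem_Collect_eq)
qed

text \<open>Condition \<open>\<xi> - \<xi>' \<in> integral2\<close> says that half the difference lies in the lattice.\<close>

lemma sym_le_iff:
  "lie.sym_le (nsum k) (nsum k') \<longleftrightarrow>
    (\<exists>d. (\<forall>i\<in>{1..n}. k i = k' i + 2 * d i) \<and> even (\<Sum>i\<in>{1..n}. i * d i))"
proof -
  have le: "lie.can_le (nsum k) (nsum k') \<longleftrightarrow> (\<forall>i\<in>{1..n}. k' i \<le> k i)"
    unfolding nsum_def by (subst can_le_iff) (auto simp: nonneg_def)
  have diff: "nsum k - nsum k' \<in> lie.integral2 \<longleftrightarrow>
      (\<exists>h :: nat \<Rightarrow> int. (\<forall>i\<in>{1..n}. (real (k i) - real (k' i)) / 2 = of_int (h i)) \<and>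
        even (\<Sum>i\<in>{1..n}. int i * h i))"
    unfolding nsum_def hsum_diff hsum_integral2_iff even_lattice_tail_iff ..
  show ?thesis
  proof
    assume "lie.sym_le (nsum k) (nsum k')"
    then have k: "\<forall>i\<in>{1..n}. k' i \<le> k i" and "nsum k - nsum k' \<in> lie.integral2"
      by (simp_all add: lie.sym_le_def le)
    then obtain h :: "nat \<Rightarrow> int" where h: "\<forall>i\<in>{1..n}. (real (k i) - real (k' i)) / 2 = of_int (h i)"
        "even (\<Sum>i\<in>{1..n}. int i * h i)"
      unfolding diff by blast
    have h': "int (k i) = int (k' i) + 2 * h i" if "i \<in> {1..n}" for i
    proof -
      have "real_of_int (int (k i)) = real_of_int (int (k' i) + 2 * h i)"
        using h(1)[rule_format, OF that] by simp
      then show ?thesis by (simp only: of_int_eq_iff)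
    qed
    define d where "d i = nat (h i)" for i
    have d: "int (d i) = h i" if "i \<in> {1..n}" for i
      using h'[OF that] k[rule_format, OF that] by (simp add: d_def)
    have "k i = k' i + 2 * d i" if "i \<in> {1..n}" for i using h'[OF that] d[OF that] by linarith
    moreover have "int (\<Sum>i\<in>{1..n}. i * d i) = (\<Sum>i\<in>{1..n}. int i * h i)"
      unfolding of_nat_sum by (intro sum.cong refl) (simp only: of_nat_mult d)
    then have "even (\<Sum>i\<in>{1..n}. i * d i)" using h(2) by (metis even_of_nat)
    ultimately show "\<exists>d. (\<forall>i\<in>{1..n}. k i = k' i + 2 * d i) \<and> even (\<Sum>i\<in>{1..n}. i * d i)" by blast
  next
    assume "\<exists>d. (\<forall>i\<in>{1..n}. k i = k' i + 2 * d i) \<and> even (\<Sum>i\<in>{1..n}. i * d i)"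
    then obtain d where d: "\<forall>i\<in>{1..n}. k i = k' i + 2 * d i" "even (\<Sum>i\<in>{1..n}. i * d i)" by blast
    have "even (int (\<Sum>i\<in>{1..n}. i * d i))" using d(2) by (simp only: even_of_nat)
    then have "even (\<Sum>i\<in>{1..n}. int i * int (d i))" by (simp only: of_nat_sum of_nat_mult)
    moreover have "(real (k i) - real (k' i)) / 2 = of_int (int (d i))" if "i \<in> {1..n}" for i
      using d(1)[rule_format, OF that] by simp
    ultimately have "nsum k - nsum k' \<in> lie.integral2"
      unfolding diff by (intro exI[of _ "\<lambda>i. int (d i)"]) blast
    moreover have "\<forall>i\<in>{1..n}. k' i \<le> k i" using d(1) by simp
    ultimately show "lie.sym_le (nsum k) (nsum k')" by (simp add: lie.sym_le_def le)
  qed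
qed

text \<open>No nonzero \<open>d\<close> witnesses a strictly larger element in the sense of \<open>sym_le_iff\<close>.\<close>

definition irreducible_coeffs :: "(nat \<Rightarrow> nat) \<Rightarrow> bool" where
  "irreducible_coeffs k \<longleftrightarrow>
    (\<forall>d. (\<forall>i\<in>{1..n}. 2 * d i \<le> k i) \<and> even (\<Sum>i\<in>{1..n}. i * d i) \<longrightarrow> (\<forall>i\<in>{1..n}. d i = 0))"

lemma irreducible_coeffsD:
  assumes "irreducible_coeffs k" "\<And>i. i \<in> {1..n} \<Longrightarrow> 2 * d i \<le> k i" "even (\<Sum>i\<in>{1..n}. i * d i)"
    and "i \<in> {1..n}"
  shows "d i = 0"
  using assms unfolding irreducible_coeffs_def by blast

lemma symmetric_canonical_eq:
  "lie.symmetric_canonical = {nsum k | k. even (\<Sum>i\<in>{1..n}. i * k i) \<and> irreducible_coeffs k}"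
proof -
  have max_iff: "(\<forall>\<xi>'\<in>lie.dominant_integral. lie.sym_le (nsum k) \<xi>' \<longrightarrow> \<xi>' = nsum k) \<longleftrightarrow> irreducible_coeffs k"
    if even: "even (\<Sum>i\<in>{1..n}. i * k i)" for k
  proof
    assume max: "\<forall>\<xi>'\<in>lie.dominant_integral. lie.sym_le (nsum k) \<xi>' \<longrightarrow> \<xi>' = nsum k"
    show "irreducible_coeffs k"
      unfolding irreducible_coeffs_def
    proof (intro allI impI)
      fix d assume d: "(\<forall>i\<in>{1..n}. 2 * d i \<le> k i) \<and> even (\<Sum>i\<in>{1..n}. i * d i)"
      define k' where "k' i = k i - 2 * d i" for i
      have k': "k i = k' i + 2 * d i" if "i \<in> {1..n}" for i using d that by (simp add: k'_def)
      have "(\<Sum>i\<in>{1..n}. i * k i) = (\<Sum>i\<in>{1..n}. i * k' i) + 2 * (\<Sum>i\<in>{1..n}. i * d i)"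
        unfolding sum_distrib_left sum.distrib[symmetric]
        by (intro sum.cong refl) (simp add: k' algebra_simps)
      then have "even (\<Sum>i\<in>{1..n}. i * k' i)" using even by presburger
      then have "nsum k' \<in> lie.dominant_integral" unfolding dominant_integral_eq by blast
      moreover have "lie.sym_le (nsum k) (nsum k')" unfolding sym_le_iff using k' d by blast
      ultimately have "nsum k' = nsum k" using max by blast
      then show "\<forall>i\<in>{1..n}. d i = 0" using k' by (simp add: nsum_eq_iff)
    qed
  next
    assume irr: "irreducible_coeffs k"
    show "\<forall>\<xi>'\<in>lie.dominant_integral. lie.sym_le (nsum k) \<xi>' \<longrightarrow> \<xi>' = nsum k"
    proof (intro ballI impI)
      fix \<xi>' assume "\<xi>' \<in> lie.dominant_integral" and le: "lie.sym_le (nsum k) \<xi>'"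
      then obtain k' where \<xi>': "\<xi>' = nsum k'" unfolding dominant_integral_eq by blast
      obtain d where d: "\<forall>i\<in>{1..n}. k i = k' i + 2 * d i" "even (\<Sum>i\<in>{1..n}. i * d i)"
        using le unfolding \<xi>' sym_le_iff by blast
      have "2 * d i \<le> k i" if "i \<in> {1..n}" for i using d(1)[rule_format, OF that] by simp
      then have "\<forall>i\<in>{1..n}. d i = 0" using irreducible_coeffsD[OF irr _ d(2)] by blast
      then show "\<xi>' = nsum k" using d(1) by (simp add: \<xi>' nsum_eq_iff)
    qed
  qed
  show ?thesis
  proof (intro equalityI subsetI)
    fix \<xi> assume "\<xi> \<in> lie.symmetric_canonical"
    then have \<xi>: "\<xi> \<in> lie.dominant_integral" "\<forall>\<xi>'\<in>lie.dominant_integral. lie.sym_le \<xi> \<xi>' \<longrightarrow> \<xi>' = \<xi>"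
      by (simp_all add: lie.symmetric_canonical_def)
    then obtain k where k: "\<xi> = nsum k" "even (\<Sum>i\<in>{1..n}. i * k i)" unfolding dominant_integral_eq by blast
    then have "irreducible_coeffs k" using \<xi>(2) max_iff[OF k(2)] by (simp only: k(1))
    then show "\<xi> \<in> {nsum k | k. even (\<Sum>i\<in>{1..n}. i * k i) \<and> irreducible_coeffs k}" using k by blast
  next
    fix \<xi> assume "\<xi> \<in> {nsum k | k. even (\<Sum>i\<in>{1..n}. i * k i) \<and> irreducible_coeffs k}"
    then obtain k where k: "\<xi> = nsum k" "even (\<Sum>i\<in>{1..n}. i * k i)" "irreducible_coeffs k" by blast
    have "\<xi> \<in> lie.dominant_integral" unfolding dominant_integral_eq using k(1,2) by blast
    moreover have "\<forall>\<xi>'\<in>lie.dominant_integral. lie.sym_le \<xi> \<xi>' \<longrightarrow> \<xi>' = \<xi>"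
      unfolding k(1) max_iff[OF k(2)] by (rule k(3))
    ultimately show "\<xi> \<in> lie.symmetric_canonical" by (simp add: lie.symmetric_canonical_def)
  qed
qed

lemma sum_single:
  "i \<in> {1..n} \<Longrightarrow> (\<Sum>l\<in>{1..n}. l * (if l = i then c else 0)) = i * (c :: nat)"
  by (simp add: if_distrib cong: if_cong)

lemma irreducible_coeffs_small:
  assumes irr: "irreducible_coeffs k" and i: "i \<in> {1..n}" "2 \<le> k i"
  shows "odd i" "k i \<le> 3" "\<And>j. j \<in> {1..n} \<Longrightarrow> j \<noteq> i \<Longrightarrow> k j \<le> 1"
proof -
  have odd: "odd j" if j: "j \<in> {1..n}" "2 \<le> k j" for j
  proof
    assume "even j"
    then have "(if j = j then 1 else 0 :: nat) = 0"
      by (intro irreducible_coeffsD[OF irr _ _ j(1), of "\<lambda>l. if l = j then 1 else 0"])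
        (use j in \<open>simp_all only: sum_single, auto\<close>)
    then show False by simp
  qed
  show "odd i" by (rule odd[OF i])
  show "k i \<le> 3"
  proof (rule ccontr)
    assume "\<not> k i \<le> 3"
    then have "(if i = i then 2 else 0 :: nat) = 0"
      by (intro irreducible_coeffsD[OF irr _ _ i(1), of "\<lambda>l. if l = i then 2 else 0"])
        (use i in \<open>simp_all only: sum_single, auto\<close>)
    then show False by simp
  qed
  fix j assume j: "j \<in> {1..n}" "j \<noteq> i"
  show "k j \<le> 1"
  proof (rule ccontr)
    assume kj: "\<not> k j \<le> 1"
    define d where "d l = (if l = i then 1 else 0) + (if l = j then 1 else 0 :: nat)" for l
    have "(\<Sum>l\<in>{1..n}. l * d l) = i * 1 + j * 1"
      unfolding d_def distrib_left sum.distrib sum_single[OF i(1)] sum_single[OF j(1)] ..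
    moreover have "odd j" using odd[OF j(1)] kj by simp
    ultimately have "even (\<Sum>l\<in>{1..n}. l * d l)" using odd[OF i] by simp
    moreover have "2 * d l \<le> k l" if "l \<in> {1..n}" for l using i(2) kj j(2) by (simp add: d_def)
    ultimately have "d i = 0" using irreducible_coeffsD[OF irr _ _ i(1)] by blast
    then show False by (simp add: d_def)
  qed
qed

lemma xi_nsum:
  assumes "I \<subseteq> {1..n}"
  shows "xi I = nsum (\<lambda>i. if i \<in> I then 1 else 0)"
  unfolding xi_eq[OF assms] nsum_def hsum_eq_iff by simp

lemma xi_plus_nsum:
  assumes "I \<subseteq> {1..n}" "j \<in> {1..n}"
  shows "xi I + 2 \<cdot>\<^sub>m H j = nsum (\<lambda>i. (if i \<in> I then 1 else 0) + 2 * (if i = j then 1 else 0))"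
  unfolding xi_plus_eq[OF assms] nsum_def hsum_eq_iff by simp

lemma sum_indicator:
  assumes "I \<subseteq> {1..n}"
  shows "(\<Sum>i\<in>{1..n}. i * (if i \<in> I then 1 else 0)) = (\<Sum>i\<in>I. i)"
  using assms by (intro sum.mono_neutral_cong_right) auto

text \<open>For the coefficients of \<open>xi I + 2 H\<^sub>j\<close>, a possible \<open>d\<close> is supported at \<open>j\<close> with \<open>d j \<le> 1\<close>, and
then \<open>\<Sum> i d\<^sub>i = j * d j\<close> is even for odd \<open>j\<close> only if \<open>d j = 0\<close>.\<close>

lemma symmetric_canonical_classification:
  "\<eta> \<in> lie.symmetric_canonical \<longleftrightarrow>
    (\<exists>I. I \<subseteq> {1..n} \<and> even (\<Sum>i\<in>I. i) \<and> (\<eta> = xi I \<or> (\<exists>j\<in>{1..n}. odd j \<and> \<eta> = xi I + 2 \<cdot>\<^sub>m H j)))"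
proof
  assume "\<eta> \<in> lie.symmetric_canonical"
  then obtain k where \<eta>: "\<eta> = nsum k" and even: "even (\<Sum>i\<in>{1..n}. i * k i)" and irr: "irreducible_coeffs k"
    unfolding symmetric_canonical_eq by blast
  \<comment> \<open>The remainders modulo 2 form the indicator of I, and by irreducibility at most one quotient is nonzero.\<close>
  define I where "I = {i \<in> {1..n}. odd (k i)}"
  have I: "I \<subseteq> {1..n}" by (auto simp: I_def)
  have "(\<Sum>i\<in>{1..n}. i * k i) = (\<Sum>i\<in>{1..n}. i * (if i \<in> I then 1 else 0)) + 2 * (\<Sum>i\<in>{1..n}. i * (k i div 2))"
    unfolding sum_distrib_left sum.distrib[symmetric]
  proof (rule sum.cong[OF refl])
    fix i assume "i \<in> {1..n}"
    then have "k i = (if i \<in> I then 1 else 0) + 2 * (k i div 2)" by (auto simp: I_def)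
    then have "i * k i = i * ((if i \<in> I then 1 else 0) + 2 * (k i div 2))" by simp
    then show "i * k i = i * (if i \<in> I then 1 else 0) + 2 * (i * (k i div 2))" by (simp add: algebra_simps)
  qed
  then have evenI: "even (\<Sum>i\<in>I. i)" using even unfolding sum_indicator[OF I] by presburger
  show "\<exists>I. I \<subseteq> {1..n} \<and> even (\<Sum>i\<in>I. i) \<and> (\<eta> = xi I \<or> (\<exists>j\<in>{1..n}. odd j \<and> \<eta> = xi I + 2 \<cdot>\<^sub>m H j))"
  proof (cases "\<exists>j\<in>{1..n}. 2 \<le> k j")
    case False
    have "\<eta> = xi I"
      unfolding \<eta> xi_nsum[OF I] nsum_eq_iff
    proof
      fix i assume i: "i \<in> {1..n}"
      then have "k i = 0 \<or> k i = 1" using False by force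
      then show "k i = (if i \<in> I then 1 else 0)" using i by (auto simp: I_def)
    qed
    then show ?thesis using I evenI by blast
  next
    case True
    then obtain j where j: "j \<in> {1..n}" "2 \<le> k j" by blast
    note small = irreducible_coeffs_small[OF irr j]
    have "\<eta> = xi I + 2 \<cdot>\<^sub>m H j"
      unfolding \<eta> xi_plus_nsum[OF I j(1)] nsum_eq_iff
    proof
      fix i assume i: "i \<in> {1..n}"
      show "k i = (if i \<in> I then 1 else 0) + 2 * (if i = j then 1 else 0)"
      proof (cases "i = j")
        case True
        have "k j = 2 \<or> k j = 3" using j(2) small(2) by linarith
        then show ?thesis using i True by (auto simp: I_def)
      next
        case False
        have "k i = 0 \<or> k i = 1" using small(3)[OF i False] by linarith
        then show ?thesis using i False by (auto simp: I_def)
      qed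
    qed
    then show ?thesis using I evenI j(1) small(1) by blast
  qed
next
  assume "\<exists>I. I \<subseteq> {1..n} \<and> even (\<Sum>i\<in>I. i) \<and> (\<eta> = xi I \<or> (\<exists>j\<in>{1..n}. odd j \<and> \<eta> = xi I + 2 \<cdot>\<^sub>m H j))"
  then obtain I where I: "I \<subseteq> {1..n}" "even (\<Sum>i\<in>I. i)"
    and \<eta>: "\<eta> = xi I \<or> (\<exists>j\<in>{1..n}. odd j \<and> \<eta> = xi I + 2 \<cdot>\<^sub>m H j)" by blast
  from \<eta> show "\<eta> \<in> lie.symmetric_canonical"
  proof
    assume "\<eta> = xi I"
    moreover have "irreducible_coeffs (\<lambda>i. if i \<in> I then 1 else 0)"
      unfolding irreducible_coeffs_def
    proof (intro allI impI ballI)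
      fix d i assume d: "(\<forall>i\<in>{1..n}. 2 * d i \<le> (if i \<in> I then 1 else 0)) \<and> even (\<Sum>i\<in>{1..n}. i * d i)"
        and i: "i \<in> {1..n}"
      then have "2 * d i \<le> (if i \<in> I then 1 else 0)" by blast
      then show "d i = (0 :: nat)" by (auto split: if_splits)
    qed
    ultimately show ?thesis
      unfolding symmetric_canonical_eq xi_nsum[OF I(1)] using I(2) unfolding sum_indicator[OF I(1), symmetric] by blast
  next
    assume "\<exists>j\<in>{1..n}. odd j \<and> \<eta> = xi I + 2 \<cdot>\<^sub>m H j"
    then obtain j where j: "j \<in> {1..n}" "odd j" "\<eta> = xi I + 2 \<cdot>\<^sub>m H j" by blast
    define k where "k i = (if i \<in> I then 1 else 0) + 2 * (if i = j then 1 else 0 :: nat)" for i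
    have \<eta>k: "\<eta> = nsum k" unfolding j(3) xi_plus_nsum[OF I(1) j(1)] k_def ..
    have "(\<Sum>i\<in>{1..n}. i * k i) = (\<Sum>i\<in>{1..n}. i * (if i \<in> I then 1 else 0)) + 2 * (\<Sum>i\<in>{1..n}. i * (if i = j then 1 else 0))"
      unfolding sum_distrib_left sum.distrib[symmetric] by (intro sum.cong refl) (simp add: k_def)
    then have even: "even (\<Sum>i\<in>{1..n}. i * k i)" using I(2) unfolding sum_indicator[OF I(1)] by presburger
    have "irreducible_coeffs k"
      unfolding irreducible_coeffs_def
    proof (intro allI impI)
      fix d assume d: "(\<forall>i\<in>{1..n}. 2 * d i \<le> k i) \<and> even (\<Sum>i\<in>{1..n}. i * d i)"
      have other: "d i = 0" if "i \<in> {1..n}" "i \<noteq> j" for i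
      proof -
        have "2 * d i \<le> k i" using d that(1) by blast
        then show ?thesis using that(2) by (auto simp: k_def split: if_splits)
      qed
      have "2 * d j \<le> k j" using d j(1) by blast
      then have dj: "d j \<le> 1" by (auto simp: k_def split: if_splits)
      have "(\<Sum>i\<in>{1..n}. i * d i) = (\<Sum>i\<in>{j}. i * d i)"
        using other j(1) by (intro sum.mono_neutral_right) auto
      then have "even (j * d j)" using d by simp
      then have "d j = 0" using dj j(2) by (cases "d j = 1") auto
      then show "\<forall>i\<in>{1..n}. d i = 0" using other by metis
    qed
    then show ?thesis unfolding symmetric_canonical_eq \<eta>k using even by blast
  qed
qed

lemma spin_symmetric_canonical_eq: "spin_symmetric_canonical = lie.symmetric_canonical"
  by (simp add: spin_symmetric_canonical_def m_def)

end

theorem theorem6p3: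
  fixes n :: nat and e :: "nat \<Rightarrow> complex vec"
  assumes "n \<ge> 1" and "adapted_basis n e"
  defines "H \<equiv> adapted_basis.H n e"
    and "\<xi> \<equiv> adapted_basis.xi n e"
    and "SC \<equiv> adapted_basis.spin_symmetric_canonical n e"
  shows "(\<forall>I. I \<subseteq> {1..n} \<and> even (\<Sum>i\<in>I. i) \<longrightarrow>
            \<xi> I \<in> SC \<and> (\<forall>j\<in>{1..n}. odd j \<longrightarrow> \<xi> I + 2 \<cdot>\<^sub>m H j \<in> SC)) \<and>
         (\<forall>\<eta>\<in>SC. \<exists>I. I \<subseteq> {1..n} \<and> even (\<Sum>i\<in>I. i) \<and>
            (\<eta> = \<xi> I \<or> (\<exists>j\<in>{1..n}. odd j \<and> \<eta> = \<xi> I + 2 \<cdot>\<^sub>m H j)))"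
proof -
  note defs = H_def \<xi>_def SC_def
  interpret adapted_basis n e by (rule assms(2))
  interpret adapted_basis_dim n e "2 * n + 1" by standard simp
  note SC_iff = symmetric_canonical_classification[folded spin_symmetric_canonical_eq]
  show ?thesis
    unfolding defs
  proof (intro conjI allI impI ballI)
    fix I :: "nat set" assume I: "I \<subseteq> {1..n} \<and> even (\<Sum>i\<in>I. i)"
    then show "xi I \<in> spin_symmetric_canonical" unfolding SC_iff by blast
    fix j assume "j \<in> {1..n}" "odd j"
    with I show "xi I + 2 \<cdot>\<^sub>m adapted_basis.H n e j \<in> spin_symmetric_canonical"
      unfolding SC_iff by blast
  next
    fix \<eta> assume "\<eta> \<in> spin_symmetric_canonical"
    then show "\<exists>I. I \<subseteq> {1..n} \<and> even (\<Sum>i\<in>I. i) \<and>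
      (\<eta> = xi I \<or> (\<exists>j\<in>{1..n}. odd j \<and> \<eta> = xi I + 2 \<cdot>\<^sub>m adapted_basis.H n e j))"
      unfolding SC_iff .
  qed
qed

end
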